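(* Let $X_*,Y_*$ be tame filtered CW-complexes, let $\varepsilon\ge0$, and assume that there exists an $\varepsilon$-acyclic carrier $F^\varepsilon_*:X_*\rightrightarrows Y[\varepsilon]_*$. Then there exist chain maps $f_a^\varepsilon:C_*(X_a)\to C_*(Y_{a+\varepsilon})$ carried by $F_a^\varepsilon$ for all $a\in\mathbb R$, such that $Y(a+\varepsilon\le b+\varepsilon)\circ f_a^\varepsilon=f_b^\varepsilon\circ X(a\le b)$ for all $a\le b$. Furthermore, given another such family of chain maps $g_a^\varepsilon:C_*(X_a)\to C_*(Y_{a+\varepsilon})$, there exist chain homotopies $H_a^\varepsilon:g_a^\varepsilon\simeq f_a^\varepsilon$ which are carried by $F_a^\varepsilon$ for all $a\in\mathbb R$.
   Context: CW-complexes are finite and regular, with the cell structure part of the data; $C_*$ denotes cellular chains with coefficients in a fixed field. A filtered CW-complex $X$ is a functor $r\mapsto X_r$ from $(\mathbb R,\le)$ to finite regular CW-complexes in which all maps $X(r\le s):X_r\to X_s$ are inclusions of subcomplexes; the same symbol denotes the induced chain maps. It is tame if $\mathbb R$ decomposes into finitely many right-open intervals along each of which $X$ is constant. $Y[\varepsilon]_a=Y_{a+\varepsilon}$. A carrier $F:\Phi\rightrightarrows\Gamma$ between CW-complexes assigns to each cell $\sigma$ of $\Phi$ a subcomplex $F(\sigma)$ of $\Gamma$ with $F(\tau)\subseteq F(\sigma)$ whenever $\tau$ is a face of $\sigma$; it is acyclic if every $F(\sigma)$ is nonempty and acyclic (has the homology of a point). A linear map $w:C_p(\Phi)\to C_{p+r}(\Gamma)$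 is carried by $F$ if for each $p$-cell $\sigma$ all cells occurring in $w(\sigma)$ with nonzero coefficient lie in $F(\sigma)$. An $\varepsilon$-acyclic carrier $F^\varepsilon_*:X_*\rightrightarrows Y[\varepsilon]_*$ is a family of acyclic carriers $F_a^\varepsilon:X_a\rightrightarrows Y_{a+\varepsilon}$, $a\in\mathbb R$, with $Y(a+\varepsilon\le b+\varepsilon)(F_a^\varepsilon(c))\subseteq F_b^\varepsilon(X(a\le b)(c))$ for all $a\le b$ and all cells $c$ of $X_a$.
   Formalization: Chain maps (both f and g) are required to preserve augmentation; without this the uniqueness part fails, e.g. for one-point complexes, where the zero map and the identity are both carried chain maps but not chain homotopic. *)

theory Defs
  imports "HOL-Homology.Homology"
begin

section \<open>Finite regular CW-complexes\<close>

record 'a cw =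
  cw_space :: "'a topology"
  cw_cells :: "nat \<Rightarrow> 'a set set"

text \<open>\<^term>\<open>cw_cells X p\<close> is the set of open \<open>p\<close>-cells of \<open>X\<close>, as sets of points. The unit ball of
  dimension \<open>p\<close> lives in \<^term>\<open>Euclidean_space p\<close>, as does \<^const>\<open>nsphere\<close>; for \<open>p = 0\<close> ball and open
  ball are a point and the sphere is empty.\<close>

definition unit_ball :: "nat \<Rightarrow> (nat \<Rightarrow> real) set" where
  "unit_ball p = {x. (\<forall>i\<ge>p. x i = 0) \<and> (\<Sum>i<p. (x i)\<^sup>2) \<le> 1}"

definition unit_open_ball :: "nat \<Rightarrow> (nat \<Rightarrow> real) set" where
  "unit_open_ball p = {x. (\<forall>i\<ge>p. x i = 0) \<and> (\<Sum>i<p. (x i)\<^sup>2) < 1}"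

definition unit_sphere :: "nat \<Rightarrow> (nat \<Rightarrow> real) set" where
  "unit_sphere p = {x. (\<forall>i\<ge>p. x i = 0) \<and> (\<Sum>i<p. (x i)\<^sup>2) = 1}"

definition all_cells :: "'a cw \<Rightarrow> 'a set set" where
  "all_cells X = (\<Union>p. cw_cells X p)"

text \<open>Skeleta are indexed by integers, like homology groups, so that the skeleta of negative
  dimension are empty.\<close>

definition skeleton :: "'a cw \<Rightarrow> int \<Rightarrow> 'a set" where
  "skeleton X n = \<Union> (\<Union>p \<in> {p. int p \<le> n}. cw_cells X p)"

definition closed_cell :: "'a cw \<Rightarrow> 'a set \<Rightarrow> 'a set" where
  "closed_cell X e = cw_space X closure_of e"

text \<open>For finitely many cells, closure-finiteness and the weak topology are automatic. Regularity is
  the requirement that the characteristic maps are homeomorphisms onto the closed cells.\<close>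

definition finite_regular_cw :: "'a cw \<Rightarrow> bool" where
  "finite_regular_cw X \<longleftrightarrow>
     Hausdorff_space (cw_space X) \<and>
     finite (all_cells X) \<and>
     \<Union> (all_cells X) = topspace (cw_space X) \<and>
     disjoint (all_cells X) \<and>
     (\<forall>p q. p \<noteq> q \<longrightarrow> cw_cells X p \<inter> cw_cells X q = {}) \<and>
     (\<forall>p. \<forall>e \<in> cw_cells X p. \<exists>h.
        homeomorphic_map (subtopology (Euclidean_space p) (unit_ball p))
                         (subtopology (cw_space X) (closed_cell X e)) h \<and>
        h ` unit_open_ball p = e \<and>
        h ` unit_sphere p \<subseteq> skeleton X (int p - 1))"

definition subcomplex :: "'a cw \<Rightarrow> 'a cw \<Rightarrow> bool" where
  "subcomplex A X \<longleftrightarrow>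
     (\<forall>p. cw_cells A p \<subseteq> cw_cells X p) \<and>
     cw_space A = subtopology (cw_space X) (\<Union> (all_cells A)) \<and>
     (\<forall>e \<in> all_cells A. closed_cell X e \<subseteq> \<Union> (all_cells A))"

definition is_face :: "'a cw \<Rightarrow> 'a set \<Rightarrow> 'a set \<Rightarrow> bool" where
  "is_face X \<tau> \<sigma> \<longleftrightarrow> \<tau> \<in> all_cells X \<and> \<sigma> \<in> all_cells X \<and> \<tau> \<subseteq> closed_cell X \<sigma>"


section \<open>Cellular chains with coefficients in a field\<close>

definition cell_homology :: "'a cw \<Rightarrow> nat \<Rightarrow> 'a set \<Rightarrow> 'a chain set monoid" where
  "cell_homology X p e =
     relative_homology_group (int p) (subtopology (cw_space X) (closed_cell X e)) (closed_cell X e - e)"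

text \<open>The homology class of a point \<open>v\<close> of \<open>T\<close>, i.e. of the singular 0-simplex at \<open>v\<close>.\<close>

definition point_class :: "'a topology \<Rightarrow> 'a \<Rightarrow> 'a chain set" where
  "point_class T v = homologous_rel_set 0 T {} (frag_of (restrict (\<lambda>_. v) (standard_simplex 0)))"

text \<open>Each cell \<open>e\<close> is oriented by a chosen generator of the infinite cyclic group
  \<open>H\<^sub>p(closed cell, boundary)\<close>, for a vertex by the class of the point. The choice only involves
  the closed cell as a space and the subset \<open>e\<close> of it, so a cell of a subcomplex has the same
  orientation there as in the whole complex.\<close>

definition cell_orientation :: "'a cw \<Rightarrow> nat \<Rightarrow> 'a set \<Rightarrow> 'a chain set" where
  "cell_orientation X p e =
     (if p = 0 then point_class (subtopology (cw_space X) (closed_cell X e)) (the_elem e)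
      else (SOME g. g \<in> carrier (cell_homology X p e) \<and>
                    subgroup_generated (cell_homology X p e) {g} = cell_homology X p e))"

text \<open>The integral cellular chain group \<open>H\<^sub>p(X\<^sup>p, X\<^sup>p\<^sup>-\<^sup>1)\<close>; the classes of the oriented
  \<open>p\<close>-cells form a basis of it.\<close>

definition skeletal_homology :: "'a cw \<Rightarrow> nat \<Rightarrow> 'a chain set monoid" where
  "skeletal_homology X p =
     relative_homology_group (int p) (subtopology (cw_space X) (skeleton X (int p)))
       (skeleton X (int p - 1))"

definition cell_class :: "'a cw \<Rightarrow> nat \<Rightarrow> 'a set \<Rightarrow> 'a chain set" where
  "cell_class X p e =
     hom_induced (int p)
       (subtopology (cw_space X) (closed_cell X e)) (closed_cell X e - e)
       (subtopology (cw_space X) (skeleton X (int p))) (skeleton X (int p - 1)) id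
       (cell_orientation X p e)"

text \<open>Incidence numbers of a \<open>(p+1)\<close>-cell \<open>\<sigma>\<close>: the coefficients of its image under the boundary
  map \<open>H\<^sub>p\<^sub>+\<^sub>1(X\<^sup>p\<^sup>+\<^sup>1, X\<^sup>p) \<rightarrow> H\<^sub>p(X\<^sup>p, X\<^sup>p\<^sup>-\<^sup>1)\<close> of the triple of skeleta, in the basis of
  \<open>p\<close>-cells (homology groups are written multiplicatively).\<close>

definition incidence :: "'a cw \<Rightarrow> nat \<Rightarrow> 'a set \<Rightarrow> 'a set \<Rightarrow> int" where
  "incidence X p \<sigma> =
     (THE n. (\<forall>\<tau>. \<tau> \<notin> cw_cells X p \<longrightarrow> n \<tau> = 0) \<and>
        hom_relboundary (int (Suc p)) (subtopology (cw_space X) (skeleton X (int (Suc p))))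
          (skeleton X (int p)) (skeleton X (int p - 1)) (cell_class X (Suc p) \<sigma>)
        = finprod (skeletal_homology X p)
            (\<lambda>\<tau>. cell_class X p \<tau> [^]\<^bsub>skeletal_homology X p\<^esub> n \<tau>) (cw_cells X p))"

text \<open>A \<open>p\<close>-chain is its coefficient function, which vanishes off the \<open>p\<close>-cells. Hence for a
  subcomplex \<open>A\<close> of \<open>X\<close> we have \<open>C\<^sub>p(A) \<subseteq> C\<^sub>p(X)\<close> and the chain map of the inclusion is the
  identity on coefficient functions.\<close>

definition chains :: "'a cw \<Rightarrow> nat \<Rightarrow> ('a set \<Rightarrow> 'k::field) set" where
  "chains X p = {c. \<forall>e. e \<notin> cw_cells X p \<longrightarrow> c e = 0}"

definition cell_chain :: "'a set \<Rightarrow> 'a set \<Rightarrow> 'k::field" where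
  "cell_chain \<sigma> = (\<lambda>e. if e = \<sigma> then 1 else 0)"

text \<open>The boundary \<open>C\<^sub>p(X) \<rightarrow> C\<^sub>p\<^sub>-\<^sub>1(X)\<close>; it is 0 for \<open>p = 0\<close>.\<close>

fun cell_boundary :: "'a cw \<Rightarrow> nat \<Rightarrow> ('a set \<Rightarrow> 'k::field) \<Rightarrow> ('a set \<Rightarrow> 'k)" where
  "cell_boundary X 0 c = (\<lambda>\<tau>. 0)"
| "cell_boundary X (Suc p) c =
     (\<lambda>\<tau>. \<Sum>\<sigma> \<in> cw_cells X (Suc p). c \<sigma> * of_int (incidence X p \<sigma> \<tau>))"

definition cell_cycles :: "'a cw \<Rightarrow> nat \<Rightarrow> ('a set \<Rightarrow> 'k::field) set" where
  "cell_cycles X p = {c \<in> chains X p. cell_boundary X p c = (\<lambda>_. 0)}"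

definition cell_boundaries :: "'a cw \<Rightarrow> nat \<Rightarrow> ('a set \<Rightarrow> 'k::field) set" where
  "cell_boundaries X p = cell_boundary X (Suc p) ` chains X (Suc p)"

text \<open>The homology of a point: \<open>H\<^sub>p = 0\<close> for \<open>p > 0\<close>, and \<open>H\<^sub>0\<close> is one-dimensional, i.e. has a
  basis consisting of the class of a single cycle \<open>z\<^sub>0\<close>.\<close>

definition acyclic_cw :: "'k::field itself \<Rightarrow> 'a cw \<Rightarrow> bool" where
  "acyclic_cw _ X \<longleftrightarrow>
     (\<forall>p>0. (cell_cycles X p :: ('a set \<Rightarrow> 'k) set) = cell_boundaries X p) \<and>
     (\<exists>z\<^sub>0 \<in> (cell_cycles X 0 :: ('a set \<Rightarrow> 'k) set). \<forall>z \<in> cell_cycles X 0.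
        \<exists>!r. (\<lambda>e. z e - r * z\<^sub>0 e) \<in> cell_boundaries X 0)"


section \<open>Chain maps and chain homotopies\<close>

text \<open>A graded map is a family of functions between the ambient function spaces, of which only the
  values on chains matter. \<open>graded_linear r X Y w\<close> says that \<open>w\<close> consists of linear maps
  \<open>C\<^sub>p(X) \<rightarrow> C\<^sub>p\<^sub>+\<^sub>r(Y)\<close>.\<close>

type_synonym ('a, 'b, 'k) graded_map = "nat \<Rightarrow> ('a set \<Rightarrow> 'k) \<Rightarrow> ('b set \<Rightarrow> 'k)"

definition graded_linear :: "nat \<Rightarrow> 'a cw \<Rightarrow> 'b cw \<Rightarrow> ('a, 'b, 'k::field) graded_map \<Rightarrow> bool" where
  "graded_linear r X Y w \<longleftrightarrow>
     (\<forall>p. \<forall>c \<in> chains X p.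
        w p c \<in> chains Y (p + r) \<and>
        (\<forall>d \<in> chains X p. w p (\<lambda>e. c e + d e) = (\<lambda>e. w p c e + w p d e)) \<and>
        (\<forall>s. w p (\<lambda>e. s * c e) = (\<lambda>e. s * w p c e)))"

definition augmentation :: "'a cw \<Rightarrow> ('a set \<Rightarrow> 'k::field) \<Rightarrow> 'k" where
  "augmentation X c = (\<Sum>v \<in> cw_cells X 0. c v)"

text \<open>As usual in the theory of acyclic carriers, chain maps are maps of augmented complexes.
  Otherwise the zero map would be a chain map carried by every carrier, and it is not homotopic to
  an augmentation-preserving one.\<close>

definition chain_map :: "'a cw \<Rightarrow> 'b cw \<Rightarrow> ('a, 'b, 'k::field) graded_map \<Rightarrow> bool" where
  "chain_map X Y f \<longleftrightarrow>
     graded_linear 0 X Y f \<and>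
     (\<forall>p. \<forall>c \<in> chains X (Suc p). cell_boundary Y (Suc p) (f (Suc p) c) = f p (cell_boundary X (Suc p) c)) \<and>
     (\<forall>c \<in> chains X 0. augmentation Y (f 0 c) = augmentation X c)"

text \<open>\<open>H : g \<simeq> f\<close>, i.e. \<open>\<partial>H + H\<partial> = f - g\<close>. In degree 0 the second summand vanishes, as
  \<open>\<partial> = 0\<close> there and \<open>H\<close> is linear.\<close>

definition chain_homotopy ::
  "'a cw \<Rightarrow> 'b cw \<Rightarrow> ('a, 'b, 'k::field) graded_map \<Rightarrow> ('a, 'b, 'k) graded_map \<Rightarrow> ('a, 'b, 'k) graded_map \<Rightarrow> bool"
  where
  "chain_homotopy X Y H g f \<longleftrightarrow>
     graded_linear 1 X Y H \<and>
     (\<forall>p. \<forall>c \<in> chains X p. \<forall>e.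
        cell_boundary Y (Suc p) (H p c) e + H (p - 1) (cell_boundary X p c) e = f p c e - g p c e)"


section \<open>Carriers\<close>

definition carrier_cw :: "'a cw \<Rightarrow> 'b cw \<Rightarrow> ('a set \<Rightarrow> 'b cw) \<Rightarrow> bool" where
  "carrier_cw X Y F \<longleftrightarrow>
     (\<forall>\<sigma> \<in> all_cells X. subcomplex (F \<sigma>) Y) \<and>
     (\<forall>\<tau> \<sigma>. is_face X \<tau> \<sigma> \<longrightarrow> subcomplex (F \<tau>) (F \<sigma>))"

definition acyclic_carrier :: "'k::field itself \<Rightarrow> 'a cw \<Rightarrow> 'b cw \<Rightarrow> ('a set \<Rightarrow> 'b cw) \<Rightarrow> bool" where
  "acyclic_carrier K X Y F \<longleftrightarrow>
     carrier_cw X Y F \<and>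
     (\<forall>\<sigma> \<in> all_cells X. topspace (cw_space (F \<sigma>)) \<noteq> {} \<and> acyclic_cw K (F \<sigma>))"

definition carried_by ::
  "nat \<Rightarrow> 'a cw \<Rightarrow> ('a set \<Rightarrow> 'b cw) \<Rightarrow> ('a, 'b, 'k::field) graded_map \<Rightarrow> bool" where
  "carried_by r X F w \<longleftrightarrow>
     (\<forall>p. \<forall>\<sigma> \<in> cw_cells X p. \<forall>e. w p (cell_chain \<sigma>) e \<noteq> 0 \<longrightarrow> e \<in> cw_cells (F \<sigma>) (p + r))"


section \<open>Filtered complexes\<close>

definition filtered_cw :: "(real \<Rightarrow> 'a cw) \<Rightarrow> bool" where
  "filtered_cw X \<longleftrightarrow> (\<forall>r. finite_regular_cw (X r)) \<and> (\<forall>r s. r \<le> s \<longrightarrow> subcomplex (X r) (X s))"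

definition right_open_interval :: "real set \<Rightarrow> bool" where
  "right_open_interval I \<longleftrightarrow>
     I = UNIV \<or> (\<exists>b. I = {..<b}) \<or> (\<exists>a. I = {a..}) \<or> (\<exists>a b. a < b \<and> I = {a..<b})"

definition tame :: "(real \<Rightarrow> 'a cw) \<Rightarrow> bool" where
  "tame X \<longleftrightarrow>
     (\<exists>P. finite P \<and> partition_on UNIV P \<and>
        (\<forall>I \<in> P. right_open_interval I \<and> (\<forall>a \<in> I. \<forall>b \<in> I. X a = X b)))"

definition shift :: "(real \<Rightarrow> 'a cw) \<Rightarrow> real \<Rightarrow> real \<Rightarrow> 'a cw" where
  "shift Y \<epsilon> = (\<lambda>a. Y (a + \<epsilon>))"

text \<open>The inclusion \<open>X(a \<le> b)\<close> sends a cell to itself, and likewise a subcomplex of \<open>Y\<^sub>a\<^sub>+\<^sub>\<epsilon>\<close>.\<close>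

definition eps_acyclic_carrier ::
  "'k::field itself \<Rightarrow> real \<Rightarrow> (real \<Rightarrow> 'a cw) \<Rightarrow> (real \<Rightarrow> 'b cw) \<Rightarrow> (real \<Rightarrow> 'a set \<Rightarrow> 'b cw) \<Rightarrow> bool" where
  "eps_acyclic_carrier K \<epsilon> X Y F \<longleftrightarrow>
     (\<forall>a. acyclic_carrier K (X a) (shift Y \<epsilon> a) (F a)) \<and>
     (\<forall>a b. a \<le> b \<longrightarrow> (\<forall>c \<in> all_cells (X a). subcomplex (F a c) (F b c)))"

text \<open>The last clause is \<open>Y(a+\<epsilon> \<le> b+\<epsilon>) \<circ> f\<^sub>a = f\<^sub>b \<circ> X(a \<le> b)\<close>, the chain maps of the
  inclusions being identities on coefficient functions.\<close>

definition carried_chain_maps ::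
  "real \<Rightarrow> (real \<Rightarrow> 'a cw) \<Rightarrow> (real \<Rightarrow> 'b cw) \<Rightarrow> (real \<Rightarrow> 'a set \<Rightarrow> 'b cw) \<Rightarrow>
   (real \<Rightarrow> ('a, 'b, 'k::field) graded_map) \<Rightarrow> bool" where
  "carried_chain_maps \<epsilon> X Y F f \<longleftrightarrow>
     (\<forall>a. chain_map (X a) (shift Y \<epsilon> a) (f a) \<and> carried_by 0 (X a) (F a) (f a)) \<and>
     (\<forall>a b. a \<le> b \<longrightarrow> (\<forall>p. \<forall>c \<in> chains (X a) p. f a p c = f b p c))"

end

theory Submission
  imports Defs
begin

text \<open>The incidence numbers are defined through singular homology, so the cellular chain complex has
  to be shown to be one. Pushing a cell radially towards its boundary and excision identify
  \<open>H\<^sub>*(closed cell, boundary)\<close> with the relative homology of attaching the cell. Attaching the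
  \<open>p\<close>-cells one at a time shows that the cell classes generate \<open>H\<^sub>p(X\<^sup>p, X\<^sup>p\<^sup>-\<^sup>1)\<close>. Coefficients are
  read off in \<open>H\<^sub>p(X\<^sup>p, X\<^sup>p - x)\<close>, where \<open>x\<close> is a point of the cell in question: there every other
  cell class vanishes. Since \<open>x\<close> may be any point of the open cell, a nonzero
  incidence number also forces the whole cell \<open>\<tau>\<close> to lie in the closure of \<open>\<sigma>\<close>, which is what
  carriers need.

  The classical inductive construction over the dimension of cells then gives chain maps and
  homotopies carried by an acyclic carrier. To make the chain maps commute with the
  filtration, it is applied once, to the final complexes \<open>X\<^sub>\<infinity>\<close> and \<open>Y\<^sub>\<infinity>\<close> (which exist by
  tameness) and the smallest carrier of each cell; the resulting map restricts to all
  stages. The homotopies need no compatibility and are built for each \<open>a\<close> separately.\<close>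

section \<open>The unit ball\<close>

text \<open>Besides the support of incidence numbers, their invariance under passing to a subcomplex
  has to be proved. It lets \<open>F \<sigma>\<close>, \<open>X a\<close> and
  \<open>Y (a + \<epsilon>)\<close> share one boundary formula: a filling found in
  \<open>F \<sigma>\<close> is then a filling in the ambient complex, and a chain map between final
  complexes restricts to the stages. It rests on orientations being chosen from the closed cell
  alone. Vertices are oriented by their point classes, so that the augmentation vanishes on
  boundaries; without this the construction could not start in degree 0.

  Chain maps chosen separately for each real \<open>a\<close> would be built from arbitrary
  fillings, and nothing would make two of them agree on a common cell. One choice for all times must
  respect every \<open>F a \<sigma>\<close> at once. The carriers of a cell and of its face may be
  smallest at different times; they are still nested, because every face of a cell is present
  whenever the cell is.\<close>

lemma unit_ball_L2: "unit_ball p = {x. (\<forall>i\<ge>p. x i = 0) \<and> L2_set x {..<p} \<le> 1}"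
  by (auto simp: unit_ball_def L2_set_def)

lemma unit_open_ball_L2: "unit_open_ball p = {x. (\<forall>i\<ge>p. x i = 0) \<and> L2_set x {..<p} < 1}"
  by (auto simp: unit_open_ball_def L2_set_def)

lemma unit_sphere_L2: "unit_sphere p = {x. (\<forall>i\<ge>p. x i = 0) \<and> L2_set x {..<p} = 1}"
  by (auto simp: unit_sphere_def L2_set_def)

lemma unit_ball_decomp:
  "unit_ball p = unit_open_ball p \<union> unit_sphere p" "unit_open_ball p \<inter> unit_sphere p = {}"
  by (auto simp: unit_ball_L2 unit_open_ball_L2 unit_sphere_L2)

lemma zero_in_unit_open_ball: "(\<lambda>_. 0) \<in> unit_open_ball p"
  by (simp add: unit_open_ball_def)

text \<open>Replaces the abstract topology of \<open>Euclidean_space\<close> by a subspace of the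
  type-class topology, where \<open>continuous_on\<close> and \<open>compact\<close> are
  available.\<close>

lemma subtopology_unit_ball:
  "subtopology (Euclidean_space p) (unit_ball p) = top_of_set (unit_ball p)"
proof -
  have "{x. \<forall>i\<ge>p. x i = 0} \<inter> unit_ball p = unit_ball p"
    by (auto simp: unit_ball_def)
  then show ?thesis
    by (simp add: Euclidean_space_def euclidean_product_topology subtopology_subtopology)
qed

lemma L2_set_scale: "L2_set (\<lambda>i. c * x i) A = \<bar>c\<bar> * L2_set x A"
  by (simp add: L2_set_def power_mult_distrib real_sqrt_mult flip: sum_distrib_left)

lemma L2_set_diff_ineq: "\<bar>L2_set x A - L2_set y A\<bar> \<le> L2_set (\<lambda>i. x i - y i) A"
proof -
  have "L2_set x A \<le> L2_set (\<lambda>i. x i - y i) A + L2_set y A"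
    using L2_set_triangle_ineq[of "\<lambda>i. x i - y i" y A] by simp
  moreover have "L2_set y A \<le> L2_set (\<lambda>i. y i - x i) A + L2_set x A"
    using L2_set_triangle_ineq[of "\<lambda>i. y i - x i" x A] by simp
  moreover have "L2_set (\<lambda>i. y i - x i) A = L2_set (\<lambda>i. x i - y i) A"
    by (simp add: L2_set_def power2_commute)
  ultimately show ?thesis by linarith
qed

lemma continuous_on_coordinate [continuous_intros]:
  "continuous_on S (\<lambda>x::'i \<Rightarrow> real. x i)"
  "continuous_on T (\<lambda>x::'c::topological_space \<times> ('i \<Rightarrow> real). snd x i)"
  by (rule continuous_on_product_then_coordinatewise,
      rule continuous_on_id continuous_on_snd[OF continuous_on_id])+

lemma continuous_on_L2_set [continuous_intros]:
  fixes f :: "'c::topological_space \<Rightarrow> 'i \<Rightarrow> real"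
  shows "(\<And>i. continuous_on S (\<lambda>x. f x i)) \<Longrightarrow> continuous_on S (\<lambda>x. L2_set (f x) A)"
  unfolding L2_set_def by (intro continuous_intros)

lemma coord_le_L2_set: "finite A \<Longrightarrow> i \<in> A \<Longrightarrow> \<bar>x i\<bar> \<le> L2_set x A"
proof -
  assume "finite A" "i \<in> A"
  then have "L2_set (\<lambda>i. \<bar>x i\<bar>) A \<ge> \<bar>x i\<bar>"
    by (intro member_le_L2_set) auto
  then show ?thesis by (simp add: L2_set_def)
qed

text \<open>The ball lives in an infinite product of lines, so Heine-Borel does not apply; instead
  it is a closed subset of a cube that is compact by Tychonoff.\<close>

lemma compact_unit_ball: "compact (unit_ball p)"
proof -
  have eq: "unit_ball p = (\<Pi>\<^sub>E i\<in>UNIV. {-1..1}) \<inter> ((\<Inter>i\<in>{p..}. {x. x i = 0}) \<inter> {x. L2_set x {..<p} \<le> 1})"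
  proof -
    have "\<bar>x i\<bar> \<le> 1" if "\<forall>i\<ge>p. x i = 0" "L2_set x {..<p} \<le> 1" for x :: "nat \<Rightarrow> real" and i
      using that coord_le_L2_set[of "{..<p}" i x] by (cases "i < p") auto
    then have "x i \<le> 1" "- 1 \<le> x i" if "\<forall>i\<ge>p. x i = 0" "L2_set x {..<p} \<le> 1"
      for x :: "nat \<Rightarrow> real" and i
      using that by (meson abs_le_iff minus_le_iff)+
    then show ?thesis
      by (auto simp: unit_ball_L2 PiE_iff)
  qed
  have "compactin (powertop_real UNIV) (\<Pi>\<^sub>E i\<in>UNIV. {-1..1::real})"
    by (simp add: compactin_PiE compactin_euclidean_iff)
  then have "compact (\<Pi>\<^sub>E i\<in>(UNIV::nat set). {-1..1::real})"
    by (simp add: euclidean_product_topology)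
  moreover have "closed ((\<Inter>i\<in>{p..}. {x. x i = (0::real)}) \<inter> {x. L2_set x {..<p} \<le> 1})"
    by (intro closed_Int closed_INT ballI closed_Collect_eq closed_Collect_le continuous_intros)
  ultimately show ?thesis
    unfolding eq by (rule compact_Int_closed)
qed

text \<open>Makes any point of an open cell the centre of a chart without moving the boundary. If
  \<phi> identifies x and y, then x - y is \<open>N x - N y\<close> times v; as v has norm below 1
  and norms are 1-Lipschitz, the two radii agree and so do the points. Compactness makes the inverse
  continuous.\<close>

lemma homeomorphic_map_unit_ball_recentre:
  assumes v: "v \<in> unit_open_ball p"
  obtains \<phi> where "homeomorphic_map (top_of_set (unit_ball p)) (top_of_set (unit_ball p)) \<phi>"
    and "\<phi> (\<lambda>_. 0) = v" and "\<And>x. x \<in> unit_sphere p \<Longrightarrow> \<phi> x = x"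
    and "\<phi> ` unit_open_ball p = unit_open_ball p"
proof -
  define N where "N x = L2_set x {..<p}" for x :: "nat \<Rightarrow> real"
  \<comment> \<open>\<open>\<phi>\<close> maps the radius from \<open>0\<close> to a point of the sphere affinely onto the segment from \<open>v\<close> to it.\<close>
  define \<phi> where "\<phi> x = (\<lambda>i. x i + (1 - N x) * v i)" for x :: "nat \<Rightarrow> real"
  have Nv: "N v < 1" and v0: "\<And>i. i \<ge> p \<Longrightarrow> v i = 0"
    using v by (auto simp: unit_open_ball_L2 N_def)
  have N0: "N x \<ge> 0" for x by (simp add: N_def L2_set_nonneg)
  have into: "N (\<phi> x) \<le> N x + (1 - N x) * N v" if "N x \<le> 1" for x
    using L2_set_triangle_ineq[of x "\<lambda>i. (1 - N x) * v i" "{..<p}"] that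
    unfolding \<phi>_def N_def by (simp add: L2_set_scale)
  have sph: "\<phi> x = x" if "x \<in> unit_sphere p" for x
    using that by (simp add: unit_sphere_L2 \<phi>_def N_def)
  have open_into: "\<phi> x \<in> unit_open_ball p" if "x \<in> unit_open_ball p" for x
  proof -
    have x: "N x < 1" "\<And>i. i \<ge> p \<Longrightarrow> x i = 0" using that by (auto simp: unit_open_ball_L2 N_def)
    have "(1 - N x) * N v < (1 - N x) * 1"
      using x Nv by (intro mult_strict_left_mono) auto
    then have "N (\<phi> x) < 1" using into[OF less_imp_le[OF x(1)]] by (simp add: algebra_simps)
    moreover have "\<forall>i\<ge>p. \<phi> x i = 0" using x v0 by (simp add: \<phi>_def)
    ultimately show ?thesis by (simp add: unit_open_ball_L2 N_def)
  qed
  have ball_into: "\<phi> x \<in> unit_ball p" if "x \<in> unit_ball p" for x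
    using that open_into[of x] sph[of x] by (auto simp: unit_ball_decomp)
  have inj: "inj_on \<phi> (unit_ball p)"
  proof
    fix x y assume xy: "x \<in> unit_ball p" "y \<in> unit_ball p" "\<phi> x = \<phi> y"
    then have "x i - y i = (N x - N y) * v i" for i
    proof -
      have "\<phi> x i = \<phi> y i" using xy(3) by simp
      then show ?thesis unfolding \<phi>_def by (simp only: algebra_simps)
    qed
    then have "(\<lambda>i. x i - y i) = (\<lambda>i. (N x - N y) * v i)" by auto
    then have "N (\<lambda>i. x i - y i) = \<bar>N x - N y\<bar> * N v"
      by (simp add: N_def L2_set_scale)
    moreover have "\<bar>N x - N y\<bar> \<le> N (\<lambda>i. x i - y i)"
      unfolding N_def by (rule L2_set_diff_ineq)
    moreover have "\<bar>N x - N y\<bar> * N v < \<bar>N x - N y\<bar> * 1" if "N x \<noteq> N y"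
      using that Nv by (intro mult_strict_left_mono) auto
    ultimately have "N x = N y" by (metis linorder_not_less mult.right_neutral)
    then show "x = y" using xy(3) by (simp add: \<phi>_def fun_eq_iff)
  qed
  have surj: "\<exists>y \<in> unit_ball p. \<phi> y = z" if z: "z \<in> unit_ball p" for z
  proof -
    \<comment> \<open>The unknown \<open>r\<close> is the radius of the preimage. Once it is known,
      the preimage has to be \<open>?y r\<close>, and the only condition is that \<open>?y r\<close>
      really has norm \<open>r\<close>; the intermediate value theorem solves it.\<close>
    let ?y = "\<lambda>r i. z i - (1 - r) * v i"
    let ?k = "\<lambda>r. N (?y r) - r"
    have "\<exists>r\<ge>0. r \<le> 1 \<and> ?k r = 0"
    proof (rule IVT2')
      show "?k 1 \<le> 0" "0 \<le> ?k 0" using z N0 by (auto simp: unit_ball_L2 N_def)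
      show "continuous_on {0..1} ?k" unfolding N_def by (intro continuous_intros)
    qed simp
    then obtain r where r: "0 \<le> r" "r \<le> 1" "N (?y r) = r" by auto
    then have "\<phi> (?y r) = z" by (simp add: \<phi>_def)
    moreover have "?y r \<in> unit_ball p"
      using r z v0 by (simp add: unit_ball_L2 N_def)
    ultimately show ?thesis by blast
  qed
  have im: "\<phi> ` unit_ball p = unit_ball p" using ball_into surj by force
  have opim: "\<phi> ` unit_open_ball p = unit_open_ball p"
  proof
    show "unit_open_ball p \<subseteq> \<phi> ` unit_open_ball p"
    proof
      fix z assume z: "z \<in> unit_open_ball p"
      then obtain y where y: "y \<in> unit_ball p" "\<phi> y = z"
        using surj unit_ball_decomp by blast
      then have "y \<notin> unit_sphere p" using sph z unit_ball_decomp(2)[of p] by auto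
      then show "z \<in> \<phi> ` unit_open_ball p" using y by (auto simp: unit_ball_decomp)
    qed
  qed (use open_into in auto)
  have "continuous_on (unit_ball p) \<phi>"
    unfolding \<phi>_def N_def by (intro continuous_intros)
  then have "homeomorphic_map (top_of_set (unit_ball p)) (top_of_set (unit_ball p)) \<phi>"
    by (intro continuous_imp_homeomorphic_map)
      (auto simp: im inj compact_space_subtopology compact_unit_ball
        Hausdorff_space_subtopology ball_into)
  moreover have "\<phi> (\<lambda>_. 0) = v" by (simp add: \<phi>_def N_def L2_set_0')
  ultimately show ?thesis using that sph opim by blast
qed

lemma contractible_unit_ball: "contractible_space (top_of_set (unit_ball p))"
proof -
  let ?h = "\<lambda>(t,x) (i::nat). (1 - t) * x i :: real"
  have "continuous_on ({0..1} \<times> unit_ball p) ?h"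
    unfolding case_prod_unfold by (intro continuous_intros)
  moreover have "?h (t,x) \<in> unit_ball p" if "t \<in> {0..1}" "x \<in> unit_ball p" for t x
    using that mult_le_one[of "1-t" "L2_set x {..<p}"]
    by (auto simp: unit_ball_L2 L2_set_scale L2_set_nonneg)
  ultimately have "homotopic_with (\<lambda>x. True) (top_of_set (unit_ball p)) (top_of_set (unit_ball p)) id (\<lambda>x i. 0)"
    by (subst homotopic_with) (auto intro!: exI[of _ ?h] simp: image_subset_iff)
  then show ?thesis unfolding contractible_space_def by blast
qed

text \<open>Contractibility of the ball turns the relative group into the reduced homology of the
  sphere one degree lower. For \<open>p = 0\<close> the sphere is empty and the group is the zeroth
  homology of a point.\<close>

lemma homology_ball_sphere:
  "relative_homology_group (int p) (top_of_set (unit_ball p)) (unit_sphere p) \<cong> integer_group"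
proof (cases p)
  case 0
  have "topspace (top_of_set (unit_ball 0)) = {\<lambda>_. 0}"
    by (auto simp: unit_ball_def)
  moreover have "unit_sphere 0 = {}" by (auto simp: unit_sphere_def)
  ultimately show ?thesis using homology_coefficients 0 by (metis of_nat_0)
next
  case (Suc n)
  have top: "subtopology (top_of_set (unit_ball p)) (unit_sphere p) = nsphere n"
  proof -
    have "unit_ball p \<inter> unit_sphere p = unit_sphere p" by (auto simp: unit_ball_decomp)
    moreover have "unit_sphere p = {x. (\<Sum>i\<le>n. (x i)\<^sup>2) = 1 \<and> (\<forall>i>n. x i = 0)}"
      by (auto simp: unit_sphere_def Suc lessThan_Suc_atMost Suc_le_eq)
    ultimately show ?thesis
      by (simp add: nsphere subtopology_subtopology euclidean_product_topology)
  qed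
  have "topspace (nsphere n) \<noteq> {}" by simp
  then have "topspace (top_of_set (unit_ball p)) \<inter> unit_sphere p \<noteq> {}"
    by (metis top topspace_subtopology)
  then have "relative_homology_group (int p) (top_of_set (unit_ball p)) (unit_sphere p) \<cong>
     reduced_homology_group (int p - 1) (nsphere n)"
    using isomorphic_group_relative_homology_of_contractible[OF contractible_unit_ball] top by metis
  also have "reduced_homology_group (int p - 1) (nsphere n) \<cong> integer_group"
    using reduced_homology_group_nsphere[of n] Suc by simp
  finally show ?thesis .
qed

section \<open>Attaching a cell\<close>

lemma iso_cancel_left:
  assumes "f \<in> hom G H" and "g \<in> iso H K" and "g \<circ> f \<in> iso G K"
  shows "f \<in> iso G H"
proof -
  have f: "f ` carrier G \<subseteq> carrier H" using assms(1) by (auto simp: hom_def)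
  have g: "inj_on g (carrier H)" "g ` carrier H = carrier K"
    and gf: "inj_on (g \<circ> f) (carrier G)" "(g \<circ> f) ` carrier G = carrier K"
    using assms by (auto simp: iso_def bij_betw_def)
  have "inj_on f (carrier G)" using gf(1) inj_on_imageI2 by blast
  moreover have "f ` carrier G = carrier H"
  proof
    show "carrier H \<subseteq> f ` carrier G"
    proof
      fix y assume y: "y \<in> carrier H"
      then have "g y \<in> (g \<circ> f) ` carrier G" using g gf by blast
      then obtain x where "x \<in> carrier G" "g y = g (f x)" by auto
      then show "y \<in> f ` carrier G" using g(1) y f inj_onD by fastforce
    qed
  qed (rule f)
  ultimately show ?thesis using assms(1) by (simp add: iso_def bij_betw_def)
qed

text \<open>A space that is the union of a closed part \<open>A\<close> and one closed cell
  \<open>D\<close> meeting it in the boundary sphere. No CW structure on \<open>A\<close> is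
  assumed, so the locale applies both to partial skeleta and to a closed cell over its own
  boundary.\<close>

locale cell_attachment =
  fixes T :: "'a topology" and A D :: "'a set" and p :: nat and h :: "(nat \<Rightarrow> real) \<Rightarrow> 'a"
  assumes closedA: "closedin T A" and closedD: "closedin T D"
    and cover: "A \<union> D = topspace T"
    and h: "homeomorphic_map (top_of_set (unit_ball p)) (subtopology T D) h"
    and h_sphere: "h ` unit_sphere p \<subseteq> A" and h_open: "h ` unit_open_ball p \<inter> A = {}"
begin

lemma topspace_D: "topspace (subtopology T D) = D"
  using cover by auto

lemma h_image: "h ` unit_ball p = D"
  using homeomorphic_imp_surjective_map[OF h] topspace_D by simp

lemma h_inj: "inj_on h (unit_ball p)"
  using homeomorphic_imp_injective_map[OF h] by simp

lemma h_mem_A_iff: "y \<in> unit_ball p \<Longrightarrow> h y \<in> A \<longleftrightarrow> y \<in> unit_sphere p"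
  using h_sphere h_open by (auto simp: unit_ball_decomp)

lemma AD: "A \<inter> D = h ` unit_sphere p"
  using h_sphere h_open h_image by (auto simp: unit_ball_decomp)

text \<open>The homotopy is constant on \<open>A\<close> and equals \<open>k\<close> in the chart;
  both prescriptions agree on the overlap, which is the image of the sphere. The set
  \<open>P\<close> is the whole ball or a punctured ball. It need not be closed: \<open>h\<close>
  P\<open>is closed in\<close>A \<union> h \<open>P\<close> because it is the intersection with
  \<open>D\<close>.\<close>

lemma glue_homotopy:
  assumes P: "unit_sphere p \<subseteq> P" "P \<subseteq> unit_ball p"
    and k: "continuous_on ({0..1} \<times> P) k" "\<And>t y. t \<in> {0..1} \<Longrightarrow> y \<in> P \<Longrightarrow> k (t,y) \<in> P"
    and k_sphere: "\<And>t y. t \<in> {0..1} \<Longrightarrow> y \<in> unit_sphere p \<Longrightarrow> k (t,y) = y"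
  obtains G where
    "continuous_map (prod_topology (top_of_set {0..1::real}) (subtopology T (A \<union> h ` P)))
       (subtopology T (A \<union> h ` P)) G"
    "\<And>t z. t \<in> {0..1} \<Longrightarrow> z \<in> A \<Longrightarrow> G (t,z) = z"
    "\<And>t y. t \<in> {0..1} \<Longrightarrow> y \<in> P \<Longrightarrow> G (t, h y) = h (k (t,y))"
proof -
  let ?N = "A \<union> h ` P" and ?I = "top_of_set {0..1::real}"
  let ?X = "prod_topology ?I (subtopology T ?N)"
  obtain g where g: "homeomorphic_maps (top_of_set (unit_ball p)) (subtopology T D) h g"
    using h homeomorphic_map_maps by blast
  have gh: "g (h y) = y" if "y \<in> unit_ball p" for y
    using g that by (auto simp: homeomorphic_maps_def)
  define G where "G = (\<lambda>(t,z). if z \<in> A then z else h (k (t, g z)))"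
  have hPD: "h ` P \<subseteq> D" using P h_image by blast
  have NT: "?N \<subseteq> topspace T" using hPD cover by auto
  have ND: "?N \<inter> D = h ` P" using AD hPD P by blast
  have G2: "G (t, h y) = h (k (t,y))" if "t \<in> {0..1}" "y \<in> P" for t y
    using that P k_sphere gh h_mem_A_iff[of y] by (auto simp: G_def subset_iff)
  have "continuous_map ?X (subtopology T ?N) G"
  proof (rule pasting_lemma_closed[where I = "UNIV :: bool set" and T = "\<lambda>b. if b then {0..1} \<times> A else {0..1} \<times> h ` P"
        and f = "\<lambda>b. if b then snd else (\<lambda>x. h (k (fst x, g (snd x))))"])
    fix b :: bool
    show "closedin ?X (if b then {0..1} \<times> A else {0..1} \<times> h ` P)"
    proof (cases b)
      case True
      have "closedin (subtopology T ?N) A"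
        using closedA NT by (metis Un_upper1 closedin_closed_subtopology closedin_subset_topspace)
      then show ?thesis using True by (simp add: closedin_prod_Times_iff)
    next
      case False
      have "closedin (subtopology T ?N) (?N \<inter> D)"
        using closedD by (simp add: closedin_subtopology_Int_closed)
      then show ?thesis using False ND by (simp add: closedin_prod_Times_iff)
    qed
    show "continuous_map (subtopology ?X (if b then {0..1} \<times> A else {0..1} \<times> h ` P)) (subtopology T ?N)
       (if b then snd else (\<lambda>x. h (k (fst x, g (snd x)))))"
    proof (cases b)
      case True
      then show ?thesis by (simp add: continuous_map_from_subtopology continuous_map_snd)
    next
      case False
      have sub: "subtopology ?X ({0..1} \<times> h ` P) = prod_topology ?I (subtopology T (h ` P))"
        by (simp add: subtopology_Times subtopology_subtopology Int_absorb1)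
      have gP: "continuous_map (subtopology T (h ` P)) (top_of_set P) g"
      proof -
        have "continuous_map (subtopology T D) (top_of_set (unit_ball p)) g"
          using g by (simp add: homeomorphic_maps_def)
        then have "continuous_map (subtopology (subtopology T D) (h ` P)) euclidean g"
          by (simp add: continuous_map_from_subtopology continuous_map_in_subtopology)
        then have "continuous_map (subtopology T (h ` P)) euclidean g"
          using hPD by (simp add: subtopology_subtopology Int_absorb1)
        moreover have "g ` (topspace T \<inter> h ` P) \<subseteq> P"
          using P gh by auto
        ultimately show ?thesis by (simp add: continuous_map_in_subtopology image_subset_iff_funcset)
      qed
      have kP: "continuous_map (prod_topology ?I (top_of_set P)) (top_of_set P) k"
        using k by (auto simp: continuous_map_in_subtopology)
      have hP: "continuous_map (top_of_set P) (subtopology T ?N) h"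
      proof -
        have "continuous_map (top_of_set (unit_ball p)) T h"
          using homeomorphic_imp_continuous_map[OF h] by (simp add: continuous_map_in_subtopology)
        then have "continuous_map (subtopology (top_of_set (unit_ball p)) P) T h"
          by (rule continuous_map_from_subtopology)
        then have "continuous_map (top_of_set P) T h"
          using P by (simp add: subtopology_subtopology Int_absorb1)
        then show ?thesis by (auto simp: continuous_map_in_subtopology)
      qed
      have "continuous_map (prod_topology ?I (subtopology T (h ` P))) (prod_topology ?I (top_of_set P))
          (\<lambda>x. (fst x, g (snd x)))"
        by (intro continuous_map_pairedI continuous_map_fst
            continuous_map_compose[OF continuous_map_snd gP, unfolded o_def])
      from continuous_map_compose[OF continuous_map_compose[OF this kP] hP]
      show ?thesis using False sub by (simp add: o_def)
    qed
  next
    fix i j :: bool and x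
    assume x: "x \<in> topspace ?X \<inter> (if i then {0..1} \<times> A else {0..1} \<times> h ` P) \<inter>
        (if j then {0..1} \<times> A else {0..1} \<times> h ` P)"
    have "snd x = h (k (fst x, g (snd x)))" if x: "x \<in> {0..1} \<times> A" "x \<in> {0..1} \<times> h ` P"
    proof -
      obtain t y where ty: "x = (t, h y)" "y \<in> P" "t \<in> {0..1}" "h y \<in> A" using x by auto
      then have "y \<in> unit_sphere p" using h_mem_A_iff P by blast
      then show ?thesis using ty gh P k_sphere by (simp add: subset_iff)
    qed
    then show "(if i then snd else (\<lambda>x. h (k (fst x, g (snd x))))) x =
        (if j then snd else (\<lambda>x. h (k (fst x, g (snd x))))) x"
      using x by (auto split: if_splits)
  next
    fix x assume x: "x \<in> topspace ?X"
    then obtain t z where tz: "x = (t,z)" "t \<in> {0..1}" "z \<in> ?N" by auto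
    show "\<exists>j. j \<in> UNIV \<and> x \<in> (if j then {0..1} \<times> A else {0..1} \<times> h ` P) \<and>
        G x = (if j then snd else (\<lambda>x. h (k (fst x, g (snd x))))) x"
    proof (cases "z \<in> A")
      case True
      then show ?thesis using tz by (intro exI[of _ True]) (auto simp: G_def)
    next
      case False
      then show ?thesis using tz by (intro exI[of _ False]) (auto simp: G_def)
    qed
  qed simp
  then show ?thesis using that G2 by (auto simp: G_def)
qed

text \<open>Excision cannot be applied to \<open>A\<close> directly, since \<open>A\<close> need not
  be a neighbourhood of the closure of the part cut away. Thickening \<open>A\<close> by an outer
  shell repairs this; the radius 1/2 is an arbitrary choice in (0,1).\<close>

definition collar :: "'a set" where
  "collar = A \<union> h ` {y \<in> unit_ball p. 1/2 \<le> L2_set y {..<p}}"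

text \<open>The radial push multiplies norms until at time 1 the shell lies on the sphere and the
  inner half ball is doubled in size. The cutoff \<open>max (1/2)\<close> keeps the denominator away
  from 0, so the push extends over the centre. Norms never decrease, hence the collar is preserved,
  and the final map is a homotopy inverse of the inclusion of pairs.\<close>

lemma iso_collar:
  "hom_induced n T A T collar id \<in> iso (relative_homology_group n T A) (relative_homology_group n T collar)"
proof -
  let ?N = "\<lambda>y. L2_set y {..<p}"
  let ?d = "\<lambda>t y. (1 - t) + t * max (1/2) (?N y)"
  let ?k = "\<lambda>(t,y) (i::nat). y i / ?d t y :: real"
  have d: "?d t y \<ge> 1/2" "?d t y \<le> 1" "?N y \<le> ?d t y"
    if "t \<in> {0..1}" "?N y \<le> 1" for t :: real and y
  proof -
    have t: "0 \<le> t" "t \<le> 1" using that by auto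
    have "?d t y = 1 - t * (1 - max (1/2) (?N y))" by (simp add: algebra_simps)
    moreover have "0 \<le> t * (1 - max (1/2) (?N y))" using t that by simp
    moreover have "t * (1 - max (1/2) (?N y)) \<le> 1 - max (1/2) (?N y)"
      using t that by (intro mult_left_le_one_le) auto
    ultimately show "?d t y \<ge> 1/2" "?d t y \<le> 1" "?N y \<le> ?d t y" by auto
  qed
  have Nk: "?N (?k (t,y)) = ?N y / ?d t y" if "t \<in> {0..1}" "?N y \<le> 1" for t :: real and y
    using L2_set_scale[of "1 / ?d t y" y "{..<p}"] d(1)[OF that] by simp
  have kball: "?k (t,y) \<in> unit_ball p" if "t \<in> {0..1}" "y \<in> unit_ball p" for t y
  proof -
    have y: "?N y \<le> 1" "\<forall>i\<ge>p. y i = 0" using that by (auto simp: unit_ball_L2)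
    have "?N y / ?d t y \<le> 1" using d[OF that(1) y(1)] by simp
    then show ?thesis using y Nk[OF that(1) y(1)] by (simp add: unit_ball_L2)
  qed
  have ksph: "?k (t,y) = y" if "t \<in> {0..1}" "y \<in> unit_sphere p" for t y
    using that by (simp add: unit_sphere_L2)
  have kcont: "continuous_on ({0..1} \<times> unit_ball p) ?k"
    unfolding case_prod_unfold
    by (intro continuous_intros) (use d(1) in \<open>fastforce simp: unit_ball_L2\<close>)
  obtain G where G: "continuous_map (prod_topology (top_of_set {0..1::real}) (subtopology T (A \<union> h ` unit_ball p)))
       (subtopology T (A \<union> h ` unit_ball p)) G"
    and GA: "\<And>t z. t \<in> {0..1} \<Longrightarrow> z \<in> A \<Longrightarrow> G (t,z) = z"
    and Gh: "\<And>t y. t \<in> {0..1} \<Longrightarrow> y \<in> unit_ball p \<Longrightarrow> G (t, h y) = h (?k (t,y))"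
    by (rule glue_homotopy[OF _ subset_refl kcont kball ksph])
      (auto simp: unit_ball_decomp intro: that)
  have cG: "continuous_map (prod_topology (top_of_set {0..1::real}) T) T G"
    using G h_image cover by simp
  have G0: "G (0,z) = z" if "z \<in> topspace T" for z
    using that GA[of 0 z] Gh[of 0] h_image by (auto simp flip: cover)
  have Gcollar: "G (t,z) \<in> collar" if t: "t \<in> {0..1}" and z: "z \<in> collar" for t z
    using z unfolding collar_def
  proof
    assume "z \<in> h ` {y \<in> unit_ball p. 1/2 \<le> ?N y}"
    then obtain y where y: "z = h y" "y \<in> unit_ball p" "1/2 \<le> ?N y" by auto
    then have N1: "?N y \<le> 1" by (simp add: unit_ball_L2)
    have "?N y \<le> ?N y / ?d t y" using d[OF t N1] y(3)
      by (simp add: le_divide_eq_1 mult_le_cancel_left1 pos_le_divide_eq)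
    then have "1/2 \<le> ?N (?k (t,y))" using Nk[OF t N1] y(3) by linarith
    then show "G (t,z) \<in> A \<union> h ` {y \<in> unit_ball p. 1/2 \<le> ?N y}"
      using y Gh[OF t y(2)] kball[OF t y(2)] by auto
  qed (use GA t in auto)
  have G1: "G (1,z) \<in> A" if "z \<in> collar" for z
    using that unfolding collar_def
  proof
    assume "z \<in> h ` {y \<in> unit_ball p. 1/2 \<le> ?N y}"
    then obtain y where y: "z = h y" "y \<in> unit_ball p" "1/2 \<le> ?N y" by auto
    then have N1: "?N y \<le> 1" by (simp add: unit_ball_L2)
    have "?N (?k (1,y)) = 1" using Nk[of 1 y] N1 y(3) by auto
    then have "?k (1,y) \<in> unit_sphere p"
      using kball[of 1 y] y(2) by (simp add: unit_ball_L2 unit_sphere_L2)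
    then show "G (1,z) \<in> A" using Gh[of 1 y] y h_sphere by auto
  qed (use GA in auto)
  have hom: "homotopic_with (\<lambda>f. f \<in> S \<rightarrow> S) T T (\<lambda>z. G (1,z)) id"
    if S: "S \<subseteq> topspace T" "\<And>t z. t \<in> {0..1} \<Longrightarrow> z \<in> S \<Longrightarrow> G (t,z) \<in> S" for S
  proof (rule homotopic_with_symD)
    show "homotopic_with (\<lambda>f. f \<in> S \<rightarrow> S) T T id (\<lambda>z. G (1,z))"
      by (subst homotopic_with) (use S cG G0 in \<open>auto intro!: exI[of _ G] simp: Pi_iff subset_iff\<close>)
  qed
  have collar_sub: "collar \<subseteq> topspace T" "A \<subseteq> collar"
    unfolding collar_def using cover h_image by auto
  have e: "continuous_map T T (\<lambda>z. G (1,z))"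
    using homotopic_with_imp_continuous_maps[OF hom[of "{}"]] by simp
  show ?thesis
    by (rule homotopy_equivalence_relative_homology_group_isomorphism[where g = "\<lambda>z. G (1,z)"])
      (use e collar_sub G1 GA hom[of A] hom[of collar] Gcollar in \<open>auto simp: o_def id_def\<close>)
qed

lemma collar_excision:
  "hom_induced n (subtopology T D) (h ` {y \<in> unit_ball p. 1/2 \<le> L2_set y {..<p}}) T collar id
    \<in> iso (relative_homology_group n (subtopology T D) (h ` {y \<in> unit_ball p. 1/2 \<le> L2_set y {..<p}}))
        (relative_homology_group n T collar)"
proof -
  \<comment> \<open>Cutting away everything outside \<open>D\<close> leaves the closed cell with its
    shell. The closure of \<open>?U\<close> lies in \<open>A\<close>, and \<open>A\<close> lies in
    the open complement of the closed inner ball \<open>?K\<close>, which is contained in the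
    collar.\<close>
  let ?U = "topspace T - D" and ?K = "h ` {y \<in> unit_ball p. L2_set y {..<p} \<le> 1/2}"
  have "T closure_of ?U \<subseteq> A"
    using closedA cover by (intro closure_of_minimal) auto
  also have "A \<subseteq> T interior_of collar"
  proof -
    have "closedin (subtopology T D) ?K"
    proof -
      have "closed {y \<in> unit_ball p. L2_set y {..<p} \<le> 1/2}"
        unfolding Collect_conj_eq Collect_mem_eq
        by (intro closed_Int compact_imp_closed compact_unit_ball closed_Collect_le continuous_intros)
      then have "closedin (top_of_set (unit_ball p)) {y \<in> unit_ball p. L2_set y {..<p} \<le> 1/2}"
        by (intro closed_subset) auto
      then show ?thesis using homeomorphic_map_closedness_eq[OF h] by blast
    qed
    then have "closedin T ?K" using closedD closedin_trans_full by blast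
    then have "openin T (topspace T - ?K)" by blast
    moreover have "topspace T - ?K \<subseteq> collar"
      unfolding collar_def using cover h_image by fastforce
    moreover have "A \<subseteq> topspace T - ?K"
    proof -
      have "{y \<in> unit_ball p. L2_set y {..<p} \<le> 1/2} \<subseteq> unit_open_ball p"
        by (auto simp: unit_ball_L2 unit_open_ball_L2)
      then show ?thesis using h_open cover by blast
    qed
    ultimately show ?thesis by (meson interior_of_maximal order_trans)
  qed
  finally have "hom_induced n (subtopology T (topspace T - ?U)) (collar - ?U) (subtopology T (topspace T)) collar id
    \<in> iso (relative_homology_group n (subtopology T (topspace T - ?U)) (collar - ?U))
          (relative_homology_group n (subtopology T (topspace T)) collar)"
    by (rule homology_excision_axiom) (use cover h_image in \<open>auto simp: collar_def\<close>)
  moreover have "topspace T - ?U = D" using cover by auto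
  moreover have "collar - ?U = h ` {y \<in> unit_ball p. 1/2 \<le> L2_set y {..<p}}"
  proof -
    have "unit_sphere p \<subseteq> {y \<in> unit_ball p. 1/2 \<le> L2_set y {..<p}}"
      by (auto simp: unit_ball_L2 unit_sphere_L2)
    then show ?thesis
      unfolding collar_def using cover h_image AD by blast
  qed
  ultimately show ?thesis by simp
qed

lemma cell_attachment_closed_cell: "cell_attachment (subtopology T D) (h ` unit_sphere p) D p h"
proof
  show "closedin (subtopology T D) (h ` unit_sphere p)"
    using closedA AD by (metis Int_commute closedin_subtopology_Int_closed)
  show "closedin (subtopology T D) D" using topspace_D closedin_topspace by metis
  show "h ` unit_sphere p \<union> D = topspace (subtopology T D)"
    using AD topspace_D by auto
  show "homeomorphic_map (top_of_set (unit_ball p)) (subtopology (subtopology T D) D) h"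
    using h by (simp add: subtopology_subtopology)
  show "h ` unit_open_ball p \<inter> h ` unit_sphere p = {}"
    using AD h_open by auto
qed simp

text \<open>The inclusion of (D, sphere) into (T, collar) factors in two ways. Through (D, shell) it
  is an isomorphism, by pushing within the cell and then excising; through (T, A) its second factor
  is an isomorphism. Hence so is the first factor.\<close>

lemma iso_closed_cell:
  "hom_induced n (subtopology T D) (h ` unit_sphere p) T A id
    \<in> iso (relative_homology_group n (subtopology T D) (h ` unit_sphere p)) (relative_homology_group n T A)"
proof -
  interpret D: cell_attachment "subtopology T D" "h ` unit_sphere p" D p h
    by (rule cell_attachment_closed_cell)
  let ?E = "h ` {y \<in> unit_ball p. 1/2 \<le> L2_set y {..<p}}"
  have E: "D.collar = ?E"
    unfolding D.collar_def by (auto simp: unit_ball_L2 unit_sphere_L2)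
  have idD: "continuous_map (subtopology T D) T id" by (simp add: continuous_map_from_subtopology)
  have "hom_induced n T A T collar id \<circ> hom_induced n (subtopology T D) (h ` unit_sphere p) T A id =
      hom_induced n (subtopology T D) (h ` unit_sphere p) T collar (id \<circ> id)"
    by (rule hom_induced_compose[symmetric]) (use idD h_sphere in \<open>auto simp: collar_def\<close>)
  also have "\<dots> = hom_induced n (subtopology T D) ?E T collar id \<circ>
      hom_induced n (subtopology T D) (h ` unit_sphere p) (subtopology T D) ?E id"
    by (rule hom_induced_compose) (use idD E D.collar_def in \<open>auto simp: collar_def\<close>)
  also have "\<dots> \<in> iso (relative_homology_group n (subtopology T D) (h ` unit_sphere p))
      (relative_homology_group n T collar)"
    using iso_set_trans[OF D.iso_collar[unfolded E] collar_excision] .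
  finally show ?thesis
    by (rule iso_cancel_left[OF hom_induced_hom iso_collar])
qed

text \<open>Radial projection, which at time 1 divides by the norm, deforms the punctured space into
  \<open>A\<close> while fixing \<open>A\<close>. So the homology of the pair (T minus the centre,
  A) is trivial, and the exact sequence of the triple gives injectivity.\<close>

lemma inj_on_complement_of_centre:
  "inj_on (hom_induced n T A T (topspace T - {h (\<lambda>_. 0)}) id) (carrier (relative_homology_group n T A))"
proof -
  let ?N = "\<lambda>y. L2_set y {..<p}" and ?o = "\<lambda>_::nat. 0 :: real"
  let ?P = "unit_ball p - {?o}"
  let ?d = "\<lambda>t y. (1 - t) + t * ?N y"
  let ?k = "\<lambda>(t,y) (i::nat). y i / ?d t y :: real"
  have N0: "?N y > 0" if "y \<in> ?P" for y
  proof -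
    have "\<exists>i<p. y i \<noteq> 0" using that unfolding unit_ball_def by (auto simp: fun_eq_iff) (meson not_le)
    then have "?N y \<noteq> 0" by (simp add: L2_set_eq_0_iff) blast
    then show ?thesis by (simp add: L2_set_nonneg order_less_le)
  qed
  have d: "?d t y > 0" "?N y \<le> ?d t y" if "t \<in> {0..1}" "y \<in> ?P" for t y
  proof -
    have t: "0 \<le> t" "t \<le> 1" and y: "?N y \<le> 1" using that by (auto simp: unit_ball_L2)
    have "?d t y - ?N y = (1 - t) * (1 - ?N y)" by (simp add: algebra_simps)
    moreover have "(1 - t) * (1 - ?N y) \<ge> 0" using t y by simp
    ultimately show "?N y \<le> ?d t y" by linarith
    then show "?d t y > 0" using N0[OF that(2)] by linarith
  qed
  have Nk: "?N (?k (t,y)) = ?N y / ?d t y" if "t \<in> {0..1}" "y \<in> ?P" for t y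
    using L2_set_scale[of "1 / ?d t y" y "{..<p}"] d(1)[OF that] by simp
  have kball: "?k (t,y) \<in> ?P" if "t \<in> {0..1}" "y \<in> ?P" for t y
  proof -
    have "?N (?k (t,y)) \<le> 1" "?N (?k (t,y)) > 0"
      unfolding Nk[OF that] using d[OF that] N0[OF that(2)] by auto
    moreover have "?k (t,y) \<noteq> ?o" using \<open>?N (?k (t,y)) > 0\<close> by (metis L2_set_0' less_irrefl)
    moreover have "\<forall>i\<ge>p. ?k (t,y) i = 0" using that by (simp add: unit_ball_L2)
    ultimately show ?thesis by (simp add: unit_ball_L2)
  qed
  have ksph: "?k (t,y) = y" if "t \<in> {0..1}" "y \<in> unit_sphere p" for t y
    using that by (simp add: unit_sphere_L2)
  have sphP: "unit_sphere p \<subseteq> ?P" by (auto simp: unit_ball_decomp unit_sphere_def)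
  have kcont: "continuous_on ({0..1} \<times> ?P) ?k"
    unfolding case_prod_unfold
    by (intro continuous_intros) (use d(1) in \<open>fastforce\<close>)
  let ?S = "A \<union> h ` ?P"
  obtain G where G: "continuous_map (prod_topology (top_of_set {0..1::real}) (subtopology T ?S)) (subtopology T ?S) G"
    and GA: "\<And>t z. t \<in> {0..1} \<Longrightarrow> z \<in> A \<Longrightarrow> G (t,z) = z"
    and Gh: "\<And>t y. t \<in> {0..1} \<Longrightarrow> y \<in> ?P \<Longrightarrow> G (t, h y) = h (?k (t,y))"
    by (rule glue_homotopy[OF sphP Diff_subset kcont kball ksph]) (blast intro: that)+
  have S: "?S = topspace T - {h ?o}"
  proof -
    have "h ?o \<notin> A" using h_open zero_in_unit_open_ball by blast
    moreover have "h ` ?P = D - {h ?o}"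
    proof -
      have "?o \<in> unit_ball p" by (simp add: unit_ball_def)
      then show ?thesis
        using inj_on_image_set_diff[OF h_inj, of "unit_ball p" "{?o}"] h_image by simp
    qed
    ultimately show ?thesis using cover by blast
  qed
  have AS: "A \<subseteq> ?S" by blast
  have topS: "topspace (subtopology T ?S) = ?S" using S by auto
  have G0: "G (0,z) = z" if "z \<in> ?S" for z using that GA[of 0 z] Gh[of 0] by auto
  have G1: "G (1,z) \<in> A" if "z \<in> ?S" for z
    using that
  proof
    assume "z \<in> h ` ?P"
    then obtain y where y: "z = h y" "y \<in> ?P" by auto
    have "?N (?k (1,y)) = 1" using Nk[of 1 y] y N0[of y] by simp
    then have "?k (1,y) \<in> unit_sphere p"
      using kball[of 1 y] y(2) by (simp add: unit_ball_L2 unit_sphere_L2)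
    then show "G (1,z) \<in> A" using Gh[of 1 y] y h_sphere by auto
  qed (use GA in auto)
  have "trivial_group (relative_homology_group n (subtopology T ?S) A)"
  proof (rule trivial_relative_homology_group_alt)
    have hom: "homotopic_with (\<lambda>k. k ` A \<subseteq> A) (subtopology T ?S) (subtopology T ?S) id (\<lambda>z. G (1,z))"
    proof (rule homotopic_with[THEN iffD2, OF _ exI[of _ G]])
      \<comment> \<open>Here \<open>h\<close> and \<open>k\<close> are arbitrary maps, not the
        chart: the condition on homotopies must depend only on values on the space, which contains
        \<open>A\<close>.\<close>
      show "h ` A \<subseteq> A \<longleftrightarrow> k ` A \<subseteq> A" if "\<And>x. x \<in> topspace (subtopology T ?S) \<Longrightarrow> h x = k x" for h k
      proof -
        have "h ` A = k ` A" using that AS unfolding topS by (intro image_cong) auto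
        then show ?thesis by simp
      qed
      show "continuous_map (prod_topology (top_of_set {0..1}) (subtopology T ?S)) (subtopology T ?S) G \<and>
          (\<forall>x\<in>topspace (subtopology T ?S). G (0, x) = id x) \<and>
          (\<forall>x\<in>topspace (subtopology T ?S). G (1, x) = G (1, x)) \<and>
          (\<forall>t\<in>{0..1}. (\<lambda>x. G (t, x)) ` A \<subseteq> A)"
        unfolding topS using G G0 GA by auto
    qed
    then show "homotopic_with (\<lambda>k. k ` A \<subseteq> A) (subtopology T ?S) (subtopology T ?S) (\<lambda>z. G (1,z)) id"
      by (rule homotopic_with_symD)
    have "continuous_map (subtopology T ?S) (subtopology T ?S) (\<lambda>z. G (1,z))"
      using homotopic_with_imp_continuous_maps[OF hom] by simp
    then show "continuous_map (subtopology T ?S) (subtopology (subtopology T ?S) A) (\<lambda>z. G (1,z))"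
      using G1 topS by (simp add: continuous_map_in_subtopology Pi_iff)
  qed
  then have triv: "carrier (relative_homology_group n (subtopology T ?S) A) =
      {\<one>\<^bsub>relative_homology_group n (subtopology T ?S) A\<^esub>}"
    by (simp add: trivial_group_def)
  let ?f = "hom_induced n (subtopology T ?S) A T A id"
  let ?g = "hom_induced n T A T ?S id"
  have ex: "exact_seq ([relative_homology_group n T ?S, relative_homology_group n T A,
      relative_homology_group n (subtopology T ?S) A], [?g, ?f])"
    by (rule homology_exactness_triple_3) blast
  interpret g: group_hom "relative_homology_group n T A" "relative_homology_group n T ?S" ?g
    by (simp add: group_hom_def group_hom_axioms_def hom_induced_hom)
  interpret f: group_hom "relative_homology_group n (subtopology T ?S) A" "relative_homology_group n T A" ?f
    by (simp add: group_hom_def group_hom_axioms_def hom_induced_hom)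
  have "kernel (relative_homology_group n T A) (relative_homology_group n T ?S) ?g =
      ?f ` carrier (relative_homology_group n (subtopology T ?S) A)"
    using ex by simp
  also have "\<dots> = {\<one>\<^bsub>relative_homology_group n T A\<^esub>}"
    by (simp add: triv)
  finally show ?thesis unfolding S by (simp add: g.inj_iff_trivial_ker flip: S)
qed

text \<open>Recentring the chart at the given point keeps the attachment data and moves the point to
  the origin.\<close>

lemma inj_on_point_complement:
  assumes "x \<in> h ` unit_open_ball p"
  shows "inj_on (hom_induced n T A T (topspace T - {x}) id) (carrier (relative_homology_group n T A))"
proof -
  obtain v where v: "v \<in> unit_open_ball p" "x = h v" using assms by auto
  obtain \<phi> where \<phi>: "homeomorphic_map (top_of_set (unit_ball p)) (top_of_set (unit_ball p)) \<phi>"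
      "\<phi> (\<lambda>_. 0) = v" "\<And>x. x \<in> unit_sphere p \<Longrightarrow> \<phi> x = x"
      "\<phi> ` unit_open_ball p = unit_open_ball p"
    using homeomorphic_map_unit_ball_recentre[OF v(1)] by metis
  interpret r: cell_attachment T A D p "h \<circ> \<phi>"
  proof
    show "homeomorphic_map (top_of_set (unit_ball p)) (subtopology T D) (h \<circ> \<phi>)"
      using homeomorphic_map_compose[OF \<phi>(1) h] .
    show "(h \<circ> \<phi>) ` unit_sphere p \<subseteq> A" using \<phi>(3) h_sphere by auto
    show "(h \<circ> \<phi>) ` unit_open_ball p \<inter> A = {}"
      using \<phi>(4) h_open by (metis image_comp)
  qed (use closedA closedD cover in auto)
  show ?thesis using r.inj_on_complement_of_centre \<phi>(2) v(2) by simp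
qed

end

section \<open>Relative homology of pairs of subspaces\<close>

text \<open>All pairs are subspaces of one ambient space with maps induced by \<open>id\<close>, so
  composites of inclusions collapse to a single inclusion.\<close>

abbreviation pair_homology :: "int \<Rightarrow> 'a topology \<Rightarrow> 'a set \<Rightarrow> 'a set \<Rightarrow> 'a chain set monoid" where
  "pair_homology n T U V \<equiv> relative_homology_group n (subtopology T U) V"

abbreviation pair_incl ::
    "int \<Rightarrow> 'a topology \<Rightarrow> 'a set \<Rightarrow> 'a set \<Rightarrow> 'a set \<Rightarrow> 'a set \<Rightarrow> 'a chain set \<Rightarrow> 'a chain set" where
  "pair_incl n T U V U' V' \<equiv> hom_induced n (subtopology T U) V (subtopology T U') V' id"

lemma continuous_map_subtopology_id: "U \<subseteq> U' \<Longrightarrow> continuous_map (subtopology T U) (subtopology T U') id"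
  by (auto simp: continuous_map_in_subtopology continuous_map_from_subtopology)

lemma pair_incl_comp:
  assumes "U \<subseteq> U'" "U' \<subseteq> U''" "V \<subseteq> V'" "V' \<subseteq> V''"
  shows "pair_incl n T U' V' U'' V'' (pair_incl n T U V U' V' c) = pair_incl n T U V U'' V'' c"
proof -
  have id: "id \<in> V \<rightarrow> V'" "id \<in> V' \<rightarrow> V''" using assms(3,4) by auto
  show ?thesis
    using hom_induced_compose'[OF continuous_map_subtopology_id[OF assms(1)] id(1)
        continuous_map_subtopology_id[OF assms(2)] id(2)] by simp
qed

lemma group_hom_hom_induced:
  "group_hom (relative_homology_group n T S) (relative_homology_group n T' S') (hom_induced n T S T' S' f)"
  by (simp add: group_hom_def group_hom_axioms_def hom_induced_hom)

lemma group_hom_hom_relboundary: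
  "group_hom (relative_homology_group n T S) (relative_homology_group (n - 1) (subtopology T S) R) (hom_relboundary n T S R)"
  by (simp add: group_hom_def group_hom_axioms_def group_homomorphism_hom_relboundary)

text \<open>The map factors through the homology of the pair (D, D), which is trivial. This is how
  classes supported away from a point are made to vanish.\<close>

lemma pair_incl_trivial:
  assumes "D \<subseteq> U" "E \<subseteq> D" "D \<subseteq> V"
  shows "pair_incl n T D E U V c = \<one>\<^bsub>pair_homology n T U V\<^esub>"
proof -
  interpret g: group_hom "pair_homology n T D D" "pair_homology n T U V" "pair_incl n T D D U V"
    by (rule group_hom_hom_induced)
  have "pair_homology n T D D = relative_homology_group n (subtopology T D) (topspace (subtopology T D))"
    by (metis relative_homology_group_restrict topspace_subtopology inf_assoc inf_idem)
  then have "trivial_group (pair_homology n T D D)"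
    by (metis trivial_relative_homology_group_topspace)
  then have "carrier (pair_homology n T D D) = {\<one>\<^bsub>pair_homology n T D D\<^esub>}"
    by (simp add: trivial_group_def)
  then have "pair_incl n T D E D D c = \<one>\<^bsub>pair_homology n T D D\<^esub>"
    by (metis hom_induced_carrier singletonD)
  then have "pair_incl n T D D U V (pair_incl n T D E D D c) = \<one>\<^bsub>pair_homology n T U V\<^esub>"
    by (simp only: g.hom_one)
  then show ?thesis
    using pair_incl_comp[OF subset_refl assms(1,2,3), of n T c] by simp
qed

section \<open>Infinite cyclic groups\<close>

text \<open>Stated with powers rather than as an isomorphism with the integers, since exponents are
  what is needed: their existence for generating, and the vanishing of the exponent of a trivial
  power for reading coefficients.\<close>

definition infinite_generator :: "('g, 'm) monoid_scheme \<Rightarrow> 'g \<Rightarrow> bool" where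
  "infinite_generator G g \<longleftrightarrow>
     g \<in> carrier G \<and> carrier G = range (\<lambda>n::int. g [^]\<^bsub>G\<^esub> n) \<and> (\<forall>n::int. g [^]\<^bsub>G\<^esub> n = \<one>\<^bsub>G\<^esub> \<longrightarrow> n = 0)"

lemma infinite_generator_if_iso:
  assumes "group G" and g: "g \<in> carrier G" and "pow G g \<in> iso integer_group G"
  shows "infinite_generator G g"
proof -
  interpret group G by fact
  have b: "bij_betw (\<lambda>n::int. g [^]\<^bsub>G\<^esub> n) UNIV (carrier G)" using assms(3) by (simp add: iso_def)
  then have "carrier G = range (\<lambda>n::int. g [^]\<^bsub>G\<^esub> n)" by (simp add: bij_betw_def)
  moreover have "n = 0" if "g [^]\<^bsub>G\<^esub> (n::int) = \<one>\<^bsub>G\<^esub>" for n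
    using that b by (metis UNIV_I bij_betw_imp_inj_on inj_onD int_pow_0)
  ultimately show ?thesis using g by (simp add: infinite_generator_def)
qed

lemma infinite_generator_cyclic:
  assumes "group G" and iso: "G \<cong> integer_group" and g: "g \<in> carrier G" "subgroup_generated G {g} = G"
  shows "infinite_generator G g"
proof -
  interpret group G by fact
  have c: "carrier G = range (\<lambda>n::int. g [^]\<^bsub>G\<^esub> n)"
    using carrier_subgroup_generated_by_singleton[OF g(1)] g(2) by simp
  have inf: "infinite (carrier G)"
    using iso_finite[OF iso] by simp
  have "n = 0" if "g [^]\<^bsub>G\<^esub> (n::int) = \<one>\<^bsub>G\<^esub>" for n
    using finite_cyclic_subgroup_int[OF g(1)] inf g(2) that by metis
  then show ?thesis using g c by (simp add: infinite_generator_def)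
qed

lemma singular_simplex_point:
  assumes "v \<in> topspace T"
  shows "singular_simplex 0 T (restrict (\<lambda>_. v) (standard_simplex 0))"
proof -
  have "continuous_map (subtopology (powertop_real UNIV) (standard_simplex 0)) T (\<lambda>_. v)"
    using assms by simp
  then have "continuous_map (subtopology (powertop_real UNIV) (standard_simplex 0)) T
      (restrict (\<lambda>_. v) (standard_simplex 0))"
    by (rule continuous_map_eq) simp
  then show ?thesis by (simp add: singular_simplex_def)
qed

lemma singular_relcycle_point:
  "v \<in> topspace T \<Longrightarrow> singular_relcycle 0 T {} (frag_of (restrict (\<lambda>_. v) (standard_simplex 0)))"
  using singular_simplex_point[of v T] by (simp add: chain_boundary_def singular_chain_of singular_cycle)

lemma point_class_generator:
  assumes top: "topspace T = {v}"
  shows "infinite_generator (homology_group 0 T) (point_class T v)"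
proof (rule infinite_generator_if_iso)
  have v: "v \<in> topspace T" using top by simp
  have "path_connected_space T"
    unfolding path_connected_space_def
  proof (intro ballI)
    fix x y assume "x \<in> topspace T" "y \<in> topspace T"
    moreover from this have "x = y" unfolding top by simp
    ultimately show "\<exists>g. pathin T g \<and> g 0 = x \<and> g 1 = y"
      by (intro exI[of _ "\<lambda>_. x"]) (simp add: pathin_const)
  qed
  then show "pow (homology_group 0 T) (point_class T v) \<in> iso integer_group (homology_group 0 T)"
    unfolding point_class_def by (rule iso_integer_zeroth_homology_group[OF _ singular_simplex_point[OF v]])
  show "point_class T v \<in> carrier (homology_group 0 T)"
    using singular_relcycle_point[OF v] by (simp add: point_class_def carrier_relative_homology_group_0)
qed simp

lemma (in group_hom) hom_finprod:
  assumes "comm_group G" "comm_group H" and f: "f \<in> A \<rightarrow> carrier G"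
  shows "h (finprod G f A) = finprod H (\<lambda>a. h (f a)) A"
proof -
  interpret G: comm_group G by fact
  interpret H: comm_group H by fact
  show ?thesis using f by (induction A rule: infinite_finite_induct) (auto simp: Pi_iff)
qed

lemma (in comm_group) finprod_pow_sum:
  assumes "g \<in> carrier G"
  shows "finprod G (\<lambda>a. g [^] (n a :: int)) A = g [^] (\<Sum>a\<in>A. n a)"
  using assms by (induction A rule: infinite_finite_induct) (auto simp: int_pow_mult)

section \<open>Cells and skeleta\<close>

locale regular_cw =
  fixes X :: "'a cw"
  assumes regular: "finite_regular_cw X"
begin

abbreviation "S \<equiv> cw_space X"

lemma Hausdorff: "Hausdorff_space S"
  and finite_all_cells: "finite (all_cells X)"
  and topspace_eq: "topspace S = \<Union>(all_cells X)"
  and disjoint_cells: "disjoint (all_cells X)"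
  using regular by (simp_all add: finite_regular_cw_def)

lemma cell_in_all: "e \<in> cw_cells X p \<Longrightarrow> e \<in> all_cells X"
  by (auto simp: all_cells_def)

lemma finite_cells: "finite (cw_cells X p)"
  using finite_all_cells by (rule finite_subset[rotated]) (auto simp: all_cells_def)

lemma dim_unique: "e \<in> cw_cells X p \<Longrightarrow> e \<in> cw_cells X q \<Longrightarrow> p = q"
proof -
  have "\<forall>p q. p \<noteq> q \<longrightarrow> cw_cells X p \<inter> cw_cells X q = {}"
    using regular by (simp add: finite_regular_cw_def)
  then show "e \<in> cw_cells X p \<Longrightarrow> e \<in> cw_cells X q \<Longrightarrow> p = q" by blast
qed

lemma cells_disjoint: "e \<in> all_cells X \<Longrightarrow> e' \<in> all_cells X \<Longrightarrow> x \<in> e \<Longrightarrow> x \<in> e' \<Longrightarrow> e = e'"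
  using disjoint_cells by (auto simp: disjoint_def)

text \<open>Injectivity of the characteristic map upgrades the information on the sphere: its image
  is exactly the closed cell minus the open cell, so the topological and the cellular boundary
  coincide.\<close>

lemma chart:
  assumes "e \<in> cw_cells X p"
  obtains h where "homeomorphic_map (top_of_set (unit_ball p)) (subtopology S (closed_cell X e)) h"
    "h ` unit_open_ball p = e" "h ` unit_sphere p = closed_cell X e - e"
    "h ` unit_sphere p \<subseteq> skeleton X (int p - 1)"
proof -
  have "\<forall>p. \<forall>e \<in> cw_cells X p. \<exists>h.
        homeomorphic_map (top_of_set (unit_ball p)) (subtopology S (closed_cell X e)) h \<and>
        h ` unit_open_ball p = e \<and> h ` unit_sphere p \<subseteq> skeleton X (int p - 1)"
    using regular unfolding finite_regular_cw_def subtopology_unit_ball by (elim conjE)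
  then obtain h where h: "homeomorphic_map (top_of_set (unit_ball p)) (subtopology S (closed_cell X e)) h"
    "h ` unit_open_ball p = e" "h ` unit_sphere p \<subseteq> skeleton X (int p - 1)"
    using assms by meson
  have "h ` unit_ball p = topspace (subtopology S (closed_cell X e))"
    using homeomorphic_imp_surjective_map[OF h(1)] by simp
  also have "\<dots> = closed_cell X e"
    using closure_of_subset_topspace[of S e] by (auto simp: closed_cell_def)
  finally have "h ` unit_ball p = closed_cell X e" .
  moreover have "inj_on h (unit_ball p)"
    using homeomorphic_imp_injective_map[OF h(1)] by simp
  then have "h ` (unit_ball p - unit_open_ball p) = h ` unit_ball p - h ` unit_open_ball p"
    by (rule inj_on_image_set_diff) (auto simp: unit_ball_decomp)
  moreover have "unit_ball p - unit_open_ball p = unit_sphere p"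
    using unit_ball_decomp[of p] by blast
  ultimately have "h ` unit_sphere p = closed_cell X e - e" using h(2) by simp
  then show ?thesis using that h by blast
qed

lemma cell_nonempty: "e \<in> all_cells X \<Longrightarrow> e \<noteq> {}"
proof -
  assume "e \<in> all_cells X"
  then obtain p where "e \<in> cw_cells X p" by (auto simp: all_cells_def)
  from chart[OF this] show ?thesis using zero_in_unit_open_ball by blast
qed

lemma cell_subset_closed: "e \<in> all_cells X \<Longrightarrow> e \<subseteq> closed_cell X e"
  unfolding closed_cell_def using topspace_eq by (intro closure_of_subset) auto

lemma closedin_closed_cell: "closedin S (closed_cell X e)"
  by (simp add: closed_cell_def)

lemma boundary_subset_skeleton: "e \<in> cw_cells X p \<Longrightarrow> closed_cell X e - e \<subseteq> skeleton X (int p - 1)"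
  by (erule chart) simp

lemma skeleton_mono: "m \<le> n \<Longrightarrow> skeleton X m \<subseteq> skeleton X n"
  unfolding skeleton_def by (intro Union_mono UN_mono) auto

lemma skeleton_subset: "skeleton X n \<subseteq> topspace S"
  unfolding skeleton_def topspace_eq all_cells_def by blast

lemma closed_cell_subset_skeleton: "e \<in> cw_cells X p \<Longrightarrow> closed_cell X e \<subseteq> skeleton X (int p)"
proof -
  assume e: "e \<in> cw_cells X p"
  then have "e \<subseteq> skeleton X (int p)" by (auto simp: skeleton_def)
  moreover have "closed_cell X e - e \<subseteq> skeleton X (int p)"
    using boundary_subset_skeleton[OF e] skeleton_mono[of "int p - 1" "int p"] by simp
  ultimately show ?thesis by blast
qed

lemma closedin_skeleton: "closedin S (skeleton X n)"
proof -
  let ?C = "\<Union>p \<in> {p. int p \<le> n}. cw_cells X p"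
  have "finite ?C" using finite_all_cells by (rule finite_subset[rotated]) (auto simp: all_cells_def)
  moreover have "skeleton X n = \<Union>(closed_cell X ` ?C)"
  proof
    show "skeleton X n \<subseteq> \<Union>(closed_cell X ` ?C)"
      unfolding skeleton_def using cell_subset_closed by (fastforce simp: all_cells_def)
    show "\<Union>(closed_cell X ` ?C) \<subseteq> skeleton X n"
      using closed_cell_subset_skeleton skeleton_mono by fastforce
  qed
  moreover have "closedin S (\<Union>(closed_cell X ` ?C))" if "finite ?C"
    using that closedin_closed_cell by (intro closedin_Union) auto
  ultimately show ?thesis by metis
qed

lemma cell_disjoint_skeleton: "e \<in> cw_cells X p \<Longrightarrow> n < int p \<Longrightarrow> e \<inter> skeleton X n = {}"
proof (rule ccontr)
  assume e: "e \<in> cw_cells X p" "n < int p" and "e \<inter> skeleton X n \<noteq> {}"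
  then obtain x q e' where "x \<in> e" "x \<in> e'" "int q \<le> n" "e' \<in> cw_cells X q"
    by (auto simp: skeleton_def)
  moreover from this have "e = e'" using cells_disjoint[OF cell_in_all[OF e(1)] cell_in_all] by blast
  ultimately have "p = q" using dim_unique[OF e(1)] by blast
  then show False using \<open>int q \<le> n\<close> e(2) by simp
qed

lemma skeleton_step: "skeleton X (int p) = skeleton X (int p - 1) \<union> \<Union>(cw_cells X p)"
proof -
  have "{q. int q \<le> int p} = insert p {q. int q \<le> int p - 1}" by auto
  then show ?thesis unfolding skeleton_def by (simp add: Un_commute)
qed

lemma closed_cell_inter_cell:
  assumes "\<sigma> \<in> cw_cells X p" "\<tau> \<in> cw_cells X p" "\<sigma> \<noteq> \<tau>"
  shows "closed_cell X \<sigma> \<inter> \<tau> = {}"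
proof -
  have "(closed_cell X \<sigma> - \<sigma>) \<inter> \<tau> = {}"
    using boundary_subset_skeleton[OF assms(1)] cell_disjoint_skeleton[OF assms(2), of "int p - 1"] by auto
  moreover have "\<sigma> \<inter> \<tau> = {}"
    using cells_disjoint[OF cell_in_all[OF assms(1)] cell_in_all[OF assms(2)]] assms(3) by blast
  ultimately show ?thesis by blast
qed

text \<open>For a set \<open>K\<close> of \<open>p\<close>-cells this interpolates between two
  consecutive skeleta.\<close>

definition partial_skeleton :: "nat \<Rightarrow> 'a set set \<Rightarrow> 'a set" where
  "partial_skeleton p K = skeleton X (int p - 1) \<union> \<Union>K"

lemma cell_attachment_partial_skeleton:
  assumes e: "e \<in> cw_cells X p" and K: "K \<subseteq> cw_cells X p" "e \<notin> K"
  obtains h where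
    "cell_attachment (subtopology S (partial_skeleton p (insert e K))) (partial_skeleton p K) (closed_cell X e) p h"
    "h ` unit_open_ball p = e" "h ` unit_sphere p = closed_cell X e - e"
proof -
  obtain h where h: "homeomorphic_map (top_of_set (unit_ball p)) (subtopology S (closed_cell X e)) h"
    "h ` unit_open_ball p = e" "h ` unit_sphere p = closed_cell X e - e"
    "h ` unit_sphere p \<subseteq> skeleton X (int p - 1)"
    using chart[OF e] .
  let ?B = "partial_skeleton p K" and ?B' = "partial_skeleton p (insert e K)"
  have BB: "?B' = ?B \<union> closed_cell X e" "?B \<subseteq> ?B'"
    unfolding partial_skeleton_def
    using boundary_subset_skeleton[OF e] cell_subset_closed[OF cell_in_all[OF e]] by auto
  have sub: "?B' \<subseteq> topspace S"
    unfolding partial_skeleton_def using skeleton_subset topspace_eq cell_in_all e K by blast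
  \<comment> \<open>Replacing cells by their closures adds only points of the lower skeleton, and
    exhibits the set as a finite union of closed sets.\<close>
  have BU: "?B = skeleton X (int p - 1) \<union> \<Union>(closed_cell X ` K)"
  proof
    show "?B \<subseteq> skeleton X (int p - 1) \<union> \<Union>(closed_cell X ` K)"
      unfolding partial_skeleton_def using K cell_subset_closed cell_in_all by fastforce
    show "skeleton X (int p - 1) \<union> \<Union>(closed_cell X ` K) \<subseteq> ?B"
      unfolding partial_skeleton_def using K boundary_subset_skeleton by fastforce
  qed
  have "finite K" using K finite_cells finite_subset by blast
  then have closedB: "closedin S ?B"
    unfolding BU using closedin_skeleton closedin_closed_cell
    by (intro closedin_Un closedin_Union) auto
  have "cell_attachment (subtopology S ?B') ?B (closed_cell X e) p h"
  proof
    show "closedin (subtopology S ?B') ?B" "closedin (subtopology S ?B') (closed_cell X e)"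
      using closedB closedin_closed_cell BB by (auto intro: closedin_subset_topspace)
    show "?B \<union> closed_cell X e = topspace (subtopology S ?B')" using sub BB by auto
    show "homeomorphic_map (top_of_set (unit_ball p)) (subtopology (subtopology S ?B') (closed_cell X e)) h"
      using h(1) BB by (simp add: subtopology_subtopology Int_absorb1)
    show "h ` unit_sphere p \<subseteq> ?B" using h(4) by (auto simp: partial_skeleton_def)
    have "e \<inter> k = {}" if "k \<in> K" for k
      using closed_cell_inter_cell[OF e, of k] cell_subset_closed[OF cell_in_all[OF e]] K that by blast
    then have "e \<inter> \<Union>K = {}" by blast
    then show "h ` unit_open_ball p \<inter> ?B = {}"
      using cell_disjoint_skeleton[OF e, of "int p - 1"] unfolding partial_skeleton_def h(2) by auto
  qed
  then show ?thesis using that h by blast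
qed

text \<open>For a vertex the closed cell is one point and the point class generates. Otherwise the
  chart transports the homology of the ball modulo its sphere, so the group is infinite cyclic and
  the \<open>SOME\<close> in the orientation has a witness.\<close>

lemma cell_orientation:
  assumes "e \<in> cw_cells X p"
  shows "infinite_generator (cell_homology X p e) (cell_orientation X p e)"
proof -
  obtain h where h: "homeomorphic_map (top_of_set (unit_ball p)) (subtopology S (closed_cell X e)) h"
    "h ` unit_open_ball p = e" "h ` unit_sphere p = closed_cell X e - e"
    "h ` unit_sphere p \<subseteq> skeleton X (int p - 1)"
    using chart[OF assms] .
  have grp: "group (cell_homology X p e)" by (simp add: cell_homology_def)
  show ?thesis
  proof (cases "p = 0")
    case True
    let ?T = "subtopology S (closed_cell X e)"
    have ball: "unit_open_ball p = {\<lambda>_. 0}" "unit_sphere p = {}"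
      using True by (auto simp: unit_open_ball_def unit_sphere_def)
    then have e: "e = {the_elem e}" using h(2) by auto
    have bd: "closed_cell X e - e = {}" using h(3) ball by simp
    then have "closed_cell X e = e" using cell_subset_closed cell_in_all assms by blast
    then have top: "topspace ?T = {the_elem e}"
      using e assms cell_in_all topspace_eq by (metis Int_absorb1 Union_upper topspace_subtopology)
    then have "infinite_generator (homology_group 0 ?T) (point_class ?T (the_elem e))"
      by (rule point_class_generator)
    then show ?thesis
      unfolding cell_homology_def cell_orientation_def bd True by simp
  next
    case False
    let ?G = "cell_homology X p e"
    have "hom_induced (int p) (top_of_set (unit_ball p)) (unit_sphere p) (subtopology S (closed_cell X e)) (closed_cell X e - e) h
        \<in> iso (relative_homology_group (int p) (top_of_set (unit_ball p)) (unit_sphere p)) ?G"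
      unfolding cell_homology_def
      by (rule homeomorphic_map_relative_homology_iso[OF h(1) _ h(3)]) (auto simp: unit_ball_decomp)
    then have "?G \<cong> relative_homology_group (int p) (top_of_set (unit_ball p)) (unit_sphere p)"
      by (rule group.iso_sym[OF group_relative_homology_group is_isoI])
    then have iso: "?G \<cong> integer_group"
      using homology_ball_sphere by (rule iso_trans)
    have "cyclic_group ?G"
      using isomorphic_group_cyclicity[OF iso grp group_integer_group] by simp
    then obtain g where "g \<in> carrier ?G \<and> subgroup_generated ?G {g} = ?G"
      by (auto simp: cyclic_group_def)
    then have "cell_orientation X p e \<in> carrier ?G \<and> subgroup_generated ?G {cell_orientation X p e} = ?G"
      unfolding cell_orientation_def if_not_P[OF False] by (rule someI)
    then show ?thesis by (elim conjE) (rule infinite_generator_cyclic[OF grp iso])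
  qed
qed

end

section \<open>Cellular homology\<close>

context regular_cw
begin

lemma skeletal_homology_pair:
  "skeletal_homology X p = pair_homology (int p) S (skeleton X (int p)) (skeleton X (int p - 1))"
  by (simp add: skeletal_homology_def)

lemma cell_homology_pair:
  "cell_homology X p e = pair_homology (int p) S (closed_cell X e) (closed_cell X e - e)"
  by (simp add: cell_homology_def)

lemma comm_group_skeletal: "comm_group (skeletal_homology X p)"
  by (simp add: skeletal_homology_def)

lemma cell_class_carrier [simp]: "cell_class X p e \<in> carrier (skeletal_homology X p)"
  by (simp add: cell_class_def skeletal_homology_def hom_induced_carrier)

lemma cell_orientation_carrier:
  "e \<in> cw_cells X p \<Longrightarrow> cell_orientation X p e \<in> carrier (cell_homology X p e)"
  using cell_orientation[of e p] unfolding infinite_generator_def by (rule conjunct1)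

lemma cell_orientation_generates:
  assumes "e \<in> cw_cells X p" "y \<in> carrier (cell_homology X p e)"
  shows "\<exists>m::int. y = cell_orientation X p e [^]\<^bsub>cell_homology X p e\<^esub> m"
proof -
  have "carrier (cell_homology X p e) = range (\<lambda>m::int. cell_orientation X p e [^]\<^bsub>cell_homology X p e\<^esub> m)"
    using cell_orientation[OF assms(1)] unfolding infinite_generator_def by (elim conjE)
  with assms(2) show ?thesis by (simp only: image_iff bex_UNIV)
qed

lemma partial_skeleton_all: "partial_skeleton p (cw_cells X p) = skeleton X (int p)"
  by (simp add: partial_skeleton_def skeleton_step)

lemma skeleton_subset_partial: "skeleton X (int p - 1) \<subseteq> partial_skeleton p K"
  by (simp add: partial_skeleton_def)

lemma boundary_subset_partial:
  "e \<in> cw_cells X p \<Longrightarrow> closed_cell X e - e \<subseteq> partial_skeleton p K"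
  using boundary_subset_skeleton skeleton_subset_partial by blast

lemma closed_cell_subset_partial:
  assumes "e \<in> cw_cells X p" shows "closed_cell X e \<subseteq> partial_skeleton p (insert e K)"
  using boundary_subset_partial[OF assms, of "insert e K"] by (auto simp: partial_skeleton_def)

lemma attach_cell:
  assumes e: "e \<in> cw_cells X p" and K: "K \<subseteq> cw_cells X p" "e \<notin> K"
  shows iso_attach_cell:
    "pair_incl n S (closed_cell X e) (closed_cell X e - e) (partial_skeleton p (insert e K)) (partial_skeleton p K)
      \<in> iso (pair_homology n S (closed_cell X e) (closed_cell X e - e))
            (pair_homology n S (partial_skeleton p (insert e K)) (partial_skeleton p K))"
    and inj_attach_cell:
    "x \<in> e \<Longrightarrow> inj_on
       (pair_incl n S (partial_skeleton p (insert e K)) (partial_skeleton p K)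
          (partial_skeleton p (insert e K)) (partial_skeleton p (insert e K) - {x}))
       (carrier (pair_homology n S (partial_skeleton p (insert e K)) (partial_skeleton p K)))"
proof -
  let ?B = "partial_skeleton p K" and ?B' = "partial_skeleton p (insert e K)"
  obtain h where "cell_attachment (subtopology S ?B') ?B (closed_cell X e) p h"
    and h: "h ` unit_open_ball p = e" "h ` unit_sphere p = closed_cell X e - e"
    using cell_attachment_partial_skeleton[OF assms] .
  then interpret c: cell_attachment "subtopology S ?B'" ?B "closed_cell X e" p h by simp
  have sub: "subtopology (subtopology S ?B') (closed_cell X e) = subtopology S (closed_cell X e)"
    using closed_cell_subset_partial[OF e] by (simp add: subtopology_subtopology Int_absorb1)
  show "pair_incl n S (closed_cell X e) (closed_cell X e - e) ?B' ?B
      \<in> iso (pair_homology n S (closed_cell X e) (closed_cell X e - e)) (pair_homology n S ?B' ?B)"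
    using c.iso_closed_cell[of n] unfolding sub h .
  have "topspace (subtopology S ?B') = ?B'"
    using c.cover closed_cell_subset_partial[OF e] cell_in_all[OF e] topspace_eq
    by (auto simp: partial_skeleton_def)
  then show "x \<in> e \<Longrightarrow> inj_on (pair_incl n S ?B' ?B ?B' (?B' - {x})) (carrier (pair_homology n S ?B' ?B))"
    using c.inj_on_point_complement[of x n] h(1) by simp
qed

section \<open>Cell classes generate the skeletal homology\<close>

definition partial_group :: "nat \<Rightarrow> 'a set set \<Rightarrow> 'a chain set monoid" where
  "partial_group p K = pair_homology (int p) S (partial_skeleton p K) (skeleton X (int p - 1))"

definition partial_class :: "nat \<Rightarrow> 'a set set \<Rightarrow> 'a set \<Rightarrow> 'a chain set" where
  "partial_class p K e =
     pair_incl (int p) S (closed_cell X e) (closed_cell X e - e) (partial_skeleton p K) (skeleton X (int p - 1))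
       (cell_orientation X p e)"

lemma comm_group_partial: "comm_group (partial_group p K)"
  by (simp add: partial_group_def)

lemma partial_class_carrier: "partial_class p K e \<in> carrier (partial_group p K)"
  unfolding partial_group_def partial_class_def by (rule hom_induced_carrier)

text \<open>Induction over \<open>K\<close> along the exact sequence of the triple formed by the
  partial skeleta with and without \<open>e\<close> and the lower skeleton. Modulo the earlier cells
  the group is cyclic on the class of \<open>e\<close>.\<close>

lemma partial_generation:
  assumes "K \<subseteq> cw_cells X p" and "z \<in> carrier (partial_group p K)"
  shows "\<exists>n. z = finprod (partial_group p K) (\<lambda>e. partial_class p K e [^]\<^bsub>partial_group p K\<^esub> (n e :: int)) K"
proof -
  have "finite K" using assms(1) finite_cells finite_subset by blast
  then show ?thesis using assms
  proof (induction K arbitrary: z)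
    case empty
    interpret G: comm_group "partial_group p {}" by (rule comm_group_partial)
    \<comment> \<open>Without cells both members of the pair are the lower skeleton, and the
      identity, seen as an inclusion, is trivial.\<close>
    have "z = pair_incl (int p) S (skeleton X (int p - 1)) (skeleton X (int p - 1)) (skeleton X (int p - 1)) (skeleton X (int p - 1)) z"
      using empty.prems(2) by (simp add: partial_group_def partial_skeleton_def hom_induced_id)
    also have "\<dots> = \<one>\<^bsub>partial_group p {}\<^esub>"
    proof -
      have "partial_skeleton p {} = skeleton X (int p - 1)" by (simp add: partial_skeleton_def)
      then show ?thesis by (simp only: partial_group_def) (intro pair_incl_trivial subset_refl)
    qed
    finally show ?case by simp
  next
    case (insert e K)
    let ?B = "partial_skeleton p K" and ?B' = "partial_skeleton p (insert e K)" and ?A = "skeleton X (int p - 1)"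
    let ?g = "cell_orientation X p e" and ?H = "pair_homology (int p) S ?B' ?B"
    have e: "e \<in> cw_cells X p" and K: "K \<subseteq> cw_cells X p" using insert.prems by auto
    have BB: "?B \<subseteq> ?B'" by (auto simp: partial_skeleton_def)
    interpret G: comm_group "partial_group p K" by (rule comm_group_partial)
    interpret G': comm_group "partial_group p (insert e K)" by (rule comm_group_partial)
    interpret j: group_hom "partial_group p (insert e K)" ?H "pair_incl (int p) S ?B' ?A ?B' ?B"
      unfolding partial_group_def by (rule group_hom_hom_induced)
    interpret i: group_hom "partial_group p K" "partial_group p (insert e K)" "pair_incl (int p) S ?B ?A ?B' ?A"
      unfolding partial_group_def by (rule group_hom_hom_induced)
    interpret k: group_hom "cell_homology X p e" ?H
      "pair_incl (int p) S (closed_cell X e) (closed_cell X e - e) ?B' ?B"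
      unfolding cell_homology_pair by (rule group_hom_hom_induced)
    have g: "?g \<in> carrier (cell_homology X p e)" by (rule cell_orientation_carrier[OF e])
    have cl: "closed_cell X e \<subseteq> ?B'" by (rule closed_cell_subset_partial[OF e])
    have bd: "closed_cell X e - e \<subseteq> ?A" by (rule boundary_subset_skeleton[OF e])
    note c = partial_class_carrier
    have jc: "pair_incl (int p) S ?B' ?A ?B' ?B (partial_class p (insert e K) e) =
        pair_incl (int p) S (closed_cell X e) (closed_cell X e - e) ?B' ?B ?g"
      unfolding partial_class_def by (rule pair_incl_comp[OF cl subset_refl bd skeleton_subset_partial])
    have zH: "pair_incl (int p) S ?B' ?A ?B' ?B z \<in> carrier ?H" by (rule hom_induced_carrier)
    have onto: "pair_incl (int p) S (closed_cell X e) (closed_cell X e - e) ?B' ?B ` carrier (cell_homology X p e) = carrier ?H"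
      using iso_attach_cell[OF e K insert.hyps(2), of "int p"] unfolding cell_homology_pair
      by (simp add: iso_def bij_betw_def)
    have "\<exists>y \<in> carrier (cell_homology X p e). pair_incl (int p) S ?B' ?A ?B' ?B z =
         pair_incl (int p) S (closed_cell X e) (closed_cell X e - e) ?B' ?B y"
      using equalityD2[OF onto, THEN subsetD, OF zH] by (simp only: image_iff)
    then obtain y where y: "y \<in> carrier (cell_homology X p e)"
        "pair_incl (int p) S ?B' ?A ?B' ?B z =
         pair_incl (int p) S (closed_cell X e) (closed_cell X e - e) ?B' ?B y" ..
    obtain m :: int where "y = ?g [^]\<^bsub>cell_homology X p e\<^esub> m"
      using cell_orientation_generates[OF e y(1)] ..
    with y(2) have m: "pair_incl (int p) S ?B' ?A ?B' ?B z =
        pair_incl (int p) S (closed_cell X e) (closed_cell X e - e) ?B' ?B (?g [^]\<^bsub>cell_homology X p e\<^esub> m)"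
      by (simp only:)
    \<comment> \<open>The class \<open>z\<close> with the contribution of \<open>e\<close> divided
      out. It dies modulo the earlier cells, hence by exactness comes from the previous stage, where
      the induction hypothesis applies.\<close>
    let ?w = "z \<otimes>\<^bsub>partial_group p (insert e K)\<^esub> inv\<^bsub>partial_group p (insert e K)\<^esub> (partial_class p (insert e K) e [^]\<^bsub>partial_group p (insert e K)\<^esub> m)"
    have z: "z \<in> carrier (partial_group p (insert e K))" by (rule insert.prems(2))
    have w: "?w \<in> carrier (partial_group p (insert e K))" using z c by simp
    have "pair_incl (int p) S ?B' ?A ?B' ?B (partial_class p (insert e K) e [^]\<^bsub>partial_group p (insert e K)\<^esub> m) =
        pair_incl (int p) S ?B' ?A ?B' ?B z"
      unfolding m j.hom_int_pow[OF c] k.hom_int_pow[OF g] jc ..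
    then have "pair_incl (int p) S ?B' ?A ?B' ?B ?w = \<one>\<^bsub>?H\<^esub>"
      using z c by (simp add: j.hom_closed)
    then have "?w \<in> kernel (partial_group p (insert e K)) ?H (pair_incl (int p) S ?B' ?A ?B' ?B)"
      using w by (simp add: kernel_def)
    also have "\<dots> = pair_incl (int p) S ?B ?A ?B' ?A ` carrier (partial_group p K)"
    proof -
      have sub: "subtopology (subtopology S ?B') ?B = subtopology S ?B"
        using BB by (simp add: subtopology_subtopology Int_absorb1)
      show ?thesis
        using homology_exactness_triple_3[OF skeleton_subset_partial[of p K], of "int p" "subtopology S ?B'"]
        unfolding sub partial_group_def by simp
    qed
    finally obtain y where y: "y \<in> carrier (partial_group p K)" "?w = pair_incl (int p) S ?B ?A ?B' ?A y" by auto
    obtain n :: "'a set \<Rightarrow> int" where n: "y = finprod (partial_group p K) (\<lambda>e. partial_class p K e [^]\<^bsub>partial_group p K\<^esub> n e) K"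
      using insert.IH[OF K y(1)] ..
    have ic: "pair_incl (int p) S ?B ?A ?B' ?A (partial_class p K e') = partial_class p (insert e K) e'" if "e' \<in> K" for e'
    proof -
      have "closed_cell X e' \<subseteq> ?B"
        using closed_cell_subset_partial[of e' p K] that K by (auto simp: insert_absorb)
      moreover have "closed_cell X e' - e' \<subseteq> ?A" using boundary_subset_skeleton that K by blast
      ultimately show ?thesis unfolding partial_class_def by (intro pair_incl_comp BB subset_refl)
    qed
    have "?w = finprod (partial_group p (insert e K)) (\<lambda>e'. pair_incl (int p) S ?B ?A ?B' ?A (partial_class p K e' [^]\<^bsub>partial_group p K\<^esub> n e')) K"
      unfolding y(2) n using c by (intro i.hom_finprod G.comm_group_axioms G'.comm_group_axioms) auto
    also have "\<dots> = finprod (partial_group p (insert e K)) (\<lambda>e'. partial_class p (insert e K) e' [^]\<^bsub>partial_group p (insert e K)\<^esub> n e') K"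
      using c ic by (intro G'.finprod_cong') (auto simp: i.hom_int_pow)
    finally have w': "?w = finprod (partial_group p (insert e K)) (\<lambda>e'. partial_class p (insert e K) e' [^]\<^bsub>partial_group p (insert e K)\<^esub> n e') K" .
    let ?n = "n(e := m)"
    have "z = partial_class p (insert e K) e [^]\<^bsub>partial_group p (insert e K)\<^esub> m \<otimes>\<^bsub>partial_group p (insert e K)\<^esub> ?w"
      using z c by (simp add: G'.m_lcomm)
    also have "?w = finprod (partial_group p (insert e K)) (\<lambda>e'. partial_class p (insert e K) e' [^]\<^bsub>partial_group p (insert e K)\<^esub> ?n e') K"
      unfolding w' using c insert.hyps(2) by (intro G'.finprod_cong') auto
    also have "partial_class p (insert e K) e [^]\<^bsub>partial_group p (insert e K)\<^esub> m \<otimes>\<^bsub>partial_group p (insert e K)\<^esub> \<dots> =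
        finprod (partial_group p (insert e K)) (\<lambda>e'. partial_class p (insert e K) e' [^]\<^bsub>partial_group p (insert e K)\<^esub> ?n e') (insert e K)"
      using insert.hyps c by (subst G'.finprod_insert) auto
    finally show ?case by blast
  qed
qed

lemma cell_class_generation:
  assumes "z \<in> carrier (skeletal_homology X p)"
  obtains n where "z = finprod (skeletal_homology X p)
     (\<lambda>\<tau>. cell_class X p \<tau> [^]\<^bsub>skeletal_homology X p\<^esub> (n \<tau> :: int)) (cw_cells X p)"
  using partial_generation[OF subset_refl, of z p] assms
  unfolding partial_group_def partial_class_def partial_skeleton_all skeletal_homology_pair cell_class_def
  by blast

section \<open>Coefficients via the local homology of the p-skeleton at a point\<close>

definition local_group :: "nat \<Rightarrow> 'a \<Rightarrow> 'a chain set monoid" where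
  "local_group p x = pair_homology (int p) S (skeleton X (int p)) (skeleton X (int p) - {x})"

definition local_map :: "nat \<Rightarrow> 'a \<Rightarrow> 'a chain set \<Rightarrow> 'a chain set" where
  "local_map p x = pair_incl (int p) S (skeleton X (int p)) (skeleton X (int p - 1)) (skeleton X (int p)) (skeleton X (int p) - {x})"

lemma group_hom_local_map: "group_hom (skeletal_homology X p) (local_group p x) (local_map p x)"
  unfolding skeletal_homology_pair local_group_def local_map_def by (rule group_hom_hom_induced)

lemma comm_group_local: "comm_group (local_group p x)"
  by (simp add: local_group_def)

lemma local_map_trivial:
  assumes "\<tau> \<in> cw_cells X p" "x \<in> \<tau>"
    and "D \<subseteq> skeleton X (int p)" "E \<subseteq> skeleton X (int p - 1)" "E \<subseteq> D" "x \<notin> D"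
  shows "local_map p x (pair_incl (int p) S D E (skeleton X (int p)) (skeleton X (int p - 1)) c) = \<one>\<^bsub>local_group p x\<^esub>"
proof -
  have "x \<notin> skeleton X (int p - 1)"
    using cell_disjoint_skeleton[OF assms(1), of "int p - 1"] assms(2) by auto
  then have "skeleton X (int p - 1) \<subseteq> skeleton X (int p) - {x}"
    using skeleton_mono[of "int p - 1" "int p"] by auto
  then have "local_map p x (pair_incl (int p) S D E (skeleton X (int p)) (skeleton X (int p - 1)) c) =
      pair_incl (int p) S D E (skeleton X (int p)) (skeleton X (int p) - {x}) c"
    unfolding local_map_def by (intro pair_incl_comp assms subset_refl)
  also have "\<dots> = \<one>\<^bsub>local_group p x\<^esub>"
    unfolding local_group_def using assms by (intro pair_incl_trivial) auto
  finally show ?thesis .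
qed

lemma local_map_other_cell:
  assumes "\<sigma> \<in> cw_cells X p" "\<tau> \<in> cw_cells X p" "\<sigma> \<noteq> \<tau>" "x \<in> \<tau>"
  shows "local_map p x (cell_class X p \<sigma>) = \<one>\<^bsub>local_group p x\<^esub>"
  unfolding cell_class_def
  using closed_cell_inter_cell[OF assms(1-3)] assms
  by (intro local_map_trivial[OF assms(2,4)] closed_cell_subset_skeleton boundary_subset_skeleton) auto

text \<open>The class of \<tau> has infinite order locally. Taking \<open>?B\<close> to be the
  skeleton without the open cell \<tau>, the map from the homology of the closed cell factors as the
  attaching isomorphism into the pair (\<open>?Z\<close>, \<open>?B\<close>), followed by the map
  that enlarges \<open>?B\<close> to the complement of \<open>x\<close>; both are injective.\<close>

lemma local_map_cell:
  assumes \<tau>: "\<tau> \<in> cw_cells X p" and x: "x \<in> \<tau>"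
    and eq: "local_map p x (cell_class X p \<tau>) [^]\<^bsub>local_group p x\<^esub> (n::int) = \<one>\<^bsub>local_group p x\<^esub>"
  shows "n = 0"
proof -
  let ?K = "cw_cells X p - {\<tau>}" and ?g = "cell_orientation X p \<tau>"
  let ?Z = "skeleton X (int p)" and ?B = "partial_skeleton p ?K" and ?A = "skeleton X (int p - 1)"
  let ?D = "closed_cell X \<tau>"
  have K: "?K \<subseteq> cw_cells X p" "\<tau> \<notin> ?K" by auto
  have Z: "partial_skeleton p (insert \<tau> ?K) = ?Z"
    using \<tau> by (simp add: insert_absorb partial_skeleton_all)
  have gen: "infinite_generator (cell_homology X p \<tau>) ?g" by (rule cell_orientation[OF \<tau>])
  have g: "?g \<in> carrier (cell_homology X p \<tau>)" by (rule cell_orientation_carrier[OF \<tau>])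
  let ?i = "pair_incl (int p) S ?D (?D - \<tau>) ?Z ?B" and ?j = "pair_incl (int p) S ?Z ?B ?Z (?Z - {x})"
  interpret i: group_hom "cell_homology X p \<tau>" "pair_homology (int p) S ?Z ?B" ?i
    unfolding cell_homology_pair by (rule group_hom_hom_induced)
  interpret j: group_hom "pair_homology (int p) S ?Z ?B" "local_group p x" ?j
    unfolding local_group_def by (rule group_hom_hom_induced)
  have inj_i: "inj_on ?i (carrier (cell_homology X p \<tau>))"
    using iso_attach_cell[OF \<tau> K, of "int p"] unfolding Z cell_homology_pair by (simp add: iso_def bij_betw_def)
  have inj_j: "inj_on ?j (carrier (pair_homology (int p) S ?Z ?B))"
    using inj_attach_cell[OF \<tau> K x, of "int p"] unfolding Z .
  have xB: "x \<notin> ?B"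
    using cell_disjoint_skeleton[OF \<tau>, of "int p - 1"] cells_disjoint[OF cell_in_all[OF \<tau>] cell_in_all _ ] x
    by (fastforce simp: partial_skeleton_def)
  have B: "?A \<subseteq> ?B" "?B \<subseteq> ?Z" "?B \<subseteq> ?Z - {x}"
    using xB skeleton_step[of p] by (auto simp: partial_skeleton_def)
  have D: "?D \<subseteq> ?Z" "?D - \<tau> \<subseteq> ?A" "?D - \<tau> \<subseteq> ?B"
    using closed_cell_subset_skeleton[OF \<tau>] boundary_subset_skeleton[OF \<tau>] B by auto
  have "local_map p x (cell_class X p \<tau>) = ?j (?i ?g)"
    unfolding local_map_def cell_class_def using B D by (simp add: pair_incl_comp)
  then have "?j (?i (?g [^]\<^bsub>cell_homology X p \<tau>\<^esub> n)) = \<one>\<^bsub>local_group p x\<^esub>"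
    using eq g by (simp add: i.hom_int_pow j.hom_int_pow)
  then have "?i (?g [^]\<^bsub>cell_homology X p \<tau>\<^esub> n) = \<one>\<^bsub>pair_homology (int p) S ?Z ?B\<^esub>"
    using inj_j g by (metis i.G.int_pow_closed i.hom_closed inj_on_eq_iff i.H.one_closed j.hom_one)
  then have "?g [^]\<^bsub>cell_homology X p \<tau>\<^esub> n = \<one>\<^bsub>cell_homology X p \<tau>\<^esub>"
    using inj_i g by (metis i.G.int_pow_closed i.G.one_closed i.hom_one inj_on_eq_iff)
  then show ?thesis using gen by (simp add: infinite_generator_def)
qed

definition combination :: "nat \<Rightarrow> ('a set \<Rightarrow> int) \<Rightarrow> 'a chain set" where
  "combination p n = finprod (skeletal_homology X p)
     (\<lambda>\<tau>. cell_class X p \<tau> [^]\<^bsub>skeletal_homology X p\<^esub> n \<tau>) (cw_cells X p)"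

lemma hom_combination:
  assumes "group_hom (skeletal_homology X p) H f" "comm_group H"
  shows "f (combination p n) = finprod H (\<lambda>\<tau>. f (cell_class X p \<tau>) [^]\<^bsub>H\<^esub> n \<tau>) (cw_cells X p)"
proof -
  interpret f: group_hom "skeletal_homology X p" H f by fact
  interpret G: comm_group "skeletal_homology X p" by (rule comm_group_skeletal)
  interpret H: comm_group H by fact
  have "f (combination p n) = finprod H (\<lambda>\<tau>. f (cell_class X p \<tau> [^]\<^bsub>skeletal_homology X p\<^esub> n \<tau>)) (cw_cells X p)"
    unfolding combination_def by (intro f.hom_finprod G.comm_group_axioms assms(2)) auto
  then show ?thesis by (simp add: f.hom_int_pow)
qed

lemma local_map_combination:
  assumes "\<tau> \<in> cw_cells X p" "x \<in> \<tau>"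
  shows "local_map p x (combination p n) = local_map p x (cell_class X p \<tau>) [^]\<^bsub>local_group p x\<^esub> n \<tau>"
proof -
  interpret H: comm_group "local_group p x" by (rule comm_group_local)
  interpret f: group_hom "skeletal_homology X p" "local_group p x" "local_map p x" by (rule group_hom_local_map)
  let ?f = "\<lambda>\<sigma>. local_map p x (cell_class X p \<sigma>) [^]\<^bsub>local_group p x\<^esub> n \<sigma>"
  have "local_map p x (combination p n) = finprod (local_group p x) ?f (cw_cells X p)"
    by (rule hom_combination[OF group_hom_local_map comm_group_local])
  also have "\<dots> = finprod (local_group p x) (\<lambda>\<sigma>. if \<sigma> = \<tau> then ?f \<sigma> else \<one>\<^bsub>local_group p x\<^esub>) (cw_cells X p)"
    using local_map_other_cell[OF _ assms(1) _ assms(2)] by (intro H.finprod_cong') auto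
  also have "\<dots> = ?f \<tau>"
    using assms finite_cells by (intro H.finprod_singleton_swap) auto
  finally show ?thesis .
qed

text \<open>Linear independence of the cell classes: compare both sides locally at a point of
  \<tau>.\<close>

lemma combination_inject:
  assumes "combination p n = combination p m" "\<tau> \<in> cw_cells X p"
  shows "n \<tau> = m \<tau>"
proof -
  obtain x where x: "x \<in> \<tau>" using cell_nonempty cell_in_all assms(2) by blast
  interpret f: group_hom "skeletal_homology X p" "local_group p x" "local_map p x" by (rule group_hom_local_map)
  let ?u = "local_map p x (cell_class X p \<tau>)"
  have "?u [^]\<^bsub>local_group p x\<^esub> n \<tau> = ?u [^]\<^bsub>local_group p x\<^esub> m \<tau>"
    using local_map_combination[OF assms(2) x] assms(1) by metis
  then have "?u [^]\<^bsub>local_group p x\<^esub> (n \<tau> - m \<tau>) = \<one>\<^bsub>local_group p x\<^esub>"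
    by (simp add: f.H.int_pow_diff)
  then show ?thesis using local_map_cell[OF assms(2) x] by fastforce
qed

end

section \<open>Incidence numbers and the cellular boundary\<close>

context regular_cw
begin

definition skeletal_boundary :: "nat \<Rightarrow> 'a chain set \<Rightarrow> 'a chain set" where
  "skeletal_boundary p = hom_relboundary (int (Suc p)) (subtopology S (skeleton X (int (Suc p))))
     (skeleton X (int p)) (skeleton X (int p - 1))"

lemma skeletal_homology_Suc:
  "skeletal_homology X (Suc p) = pair_homology (int (Suc p)) S (skeleton X (int (Suc p))) (skeleton X (int p))"
  by (simp add: skeletal_homology_def)

lemma subtopology_skeleton:
  "m \<le> n \<Longrightarrow> subtopology (subtopology S (skeleton X n)) (skeleton X m) = subtopology S (skeleton X m)"
  using skeleton_mono[of m n] by (simp add: subtopology_subtopology Int_absorb1)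

lemma group_hom_skeletal_boundary:
  "group_hom (skeletal_homology X (Suc p)) (skeletal_homology X p) (skeletal_boundary p)"
  using group_hom_hom_relboundary[of "int (Suc p)" "subtopology S (skeleton X (int (Suc p)))"
      "skeleton X (int p)" "skeleton X (int p - 1)"]
  unfolding skeletal_boundary_def skeletal_homology_Suc skeletal_homology_pair
  by (simp add: subtopology_skeleton)

text \<open>Justifies the definite description in \<open>incidence\<close>: generation provides
  coefficients, which are set to 0 off the \<open>p\<close>-cells, and independence makes them
  unique. The uniqueness clause serves later to identify incidence numbers of a subcomplex.\<close>

lemma incidence_expansion:
  shows incidence_outside: "\<tau> \<notin> cw_cells X p \<Longrightarrow> incidence X p \<sigma> \<tau> = 0"
    and skeletal_boundary_cell_class:
      "skeletal_boundary p (cell_class X (Suc p) \<sigma>) = combination p (incidence X p \<sigma>)"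
    and incidence_unique:
      "\<lbrakk>\<And>\<tau>. \<tau> \<notin> cw_cells X p \<Longrightarrow> n \<tau> = 0;
        skeletal_boundary p (cell_class X (Suc p) \<sigma>) = combination p n\<rbrakk> \<Longrightarrow> incidence X p \<sigma> = n"
proof -
  interpret b: group_hom "skeletal_homology X (Suc p)" "skeletal_homology X p" "skeletal_boundary p"
    by (rule group_hom_skeletal_boundary)
  interpret G: comm_group "skeletal_homology X p" by (rule comm_group_skeletal)
  let ?P = "\<lambda>n. (\<forall>\<tau>. \<tau> \<notin> cw_cells X p \<longrightarrow> n \<tau> = 0) \<and>
     skeletal_boundary p (cell_class X (Suc p) \<sigma>) = combination p n"
  have inc: "incidence X p \<sigma> = (THE n. ?P n)"
    unfolding incidence_def skeletal_boundary_def combination_def ..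
  have "skeletal_boundary p (cell_class X (Suc p) \<sigma>) \<in> carrier (skeletal_homology X p)" by simp
  then obtain m :: "'a set \<Rightarrow> int" where m: "skeletal_boundary p (cell_class X (Suc p) \<sigma>) = combination p m"
    unfolding combination_def by (rule cell_class_generation)
  let ?m = "\<lambda>\<tau>. if \<tau> \<in> cw_cells X p then m \<tau> else 0"
  have "combination p m = combination p ?m"
    unfolding combination_def by (intro G.finprod_cong') auto
  then have P: "?P ?m" using m by simp
  have uniq: "n = ?m" if "?P n" for n
  proof
    fix \<tau> show "n \<tau> = ?m \<tau>"
      using that P combination_inject[of p n ?m \<tau>] by (cases "\<tau> \<in> cw_cells X p") auto
  qed
  have spec: "?P (incidence X p \<sigma>)" unfolding inc using P uniq by (rule theI)
  show "\<tau> \<notin> cw_cells X p \<Longrightarrow> incidence X p \<sigma> \<tau> = 0" using spec by blast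
  show "skeletal_boundary p (cell_class X (Suc p) \<sigma>) = combination p (incidence X p \<sigma>)" using spec by blast
  show "\<lbrakk>\<And>\<tau>. \<tau> \<notin> cw_cells X p \<Longrightarrow> n \<tau> = 0;
        skeletal_boundary p (cell_class X (Suc p) \<sigma>) = combination p n\<rbrakk> \<Longrightarrow> incidence X p \<sigma> = n"
    using uniq[of n] uniq[OF spec] by simp
qed

text \<open>By naturality the boundary of the class of \<sigma> comes from the topological boundary
  of \<sigma>. At a point of \<tau> outside the closed cell it vanishes locally, whereas a nonzero
  coefficient at \<tau> would survive there.\<close>

lemma incidence_face:
  assumes \<sigma>: "\<sigma> \<in> cw_cells X (Suc p)" and ne: "incidence X p \<sigma> \<tau> \<noteq> 0"
  shows "\<tau> \<in> cw_cells X p" "is_face X \<tau> \<sigma>"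
proof -
  show \<tau>: "\<tau> \<in> cw_cells X p" using incidence_outside ne by blast
  have "x \<in> closed_cell X \<sigma>" if x: "x \<in> \<tau>" for x
  proof (rule ccontr)
    assume nx: "x \<notin> closed_cell X \<sigma>"
    let ?D = "closed_cell X \<sigma>" and ?g = "cell_orientation X (Suc p) \<sigma>"
    let ?E = "?D - \<sigma>"
    have bd: "?E \<subseteq> skeleton X (int p)" using boundary_subset_skeleton[OF \<sigma>] by simp
    have cl: "?D \<subseteq> skeleton X (int (Suc p))" by (rule closed_cell_subset_skeleton[OF \<sigma>])
    have sub: "subtopology (subtopology S ?D) ?E = subtopology S ?E"
      by (simp add: subtopology_subtopology Int_absorb1)
    have idE: "id \<in> ?E \<rightarrow> skeleton X (int p)" "id \<in> {} \<rightarrow> skeleton X (int p - 1)" using bd by auto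
    \<comment> \<open>With the empty set as third member of the triple, this is the absolute
      boundary class on the boundary sphere of \<sigma>.\<close>
    let ?c = "hom_relboundary (int (Suc p)) (subtopology S ?D) ?E {} ?g"
    have "skeletal_boundary p (cell_class X (Suc p) \<sigma>) =
        pair_incl (int p) S ?E {} (skeleton X (int p)) (skeleton X (int p - 1)) ?c"
      using fun_cong[OF naturality_hom_induced_relboundary[OF continuous_map_subtopology_id[OF cl, of S] idE, where p = "int (Suc p)"], of ?g]
      unfolding skeletal_boundary_def cell_class_def
      by (simp add: sub subtopology_skeleton)
    then have "local_map p x (skeletal_boundary p (cell_class X (Suc p) \<sigma>)) = \<one>\<^bsub>local_group p x\<^esub>"
      using local_map_trivial[OF \<tau> x bd, of "{}" ?c] nx by simp
    then have "local_map p x (cell_class X p \<tau>) [^]\<^bsub>local_group p x\<^esub> incidence X p \<sigma> \<tau> = \<one>\<^bsub>local_group p x\<^esub>"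
      unfolding skeletal_boundary_cell_class local_map_combination[OF \<tau> x] .
    then show False using local_map_cell[OF \<tau> x] ne by blast
  qed
  then show "is_face X \<tau> \<sigma>"
    using cell_in_all[OF \<sigma>] cell_in_all[OF \<tau>] by (auto simp: is_face_def)
qed

text \<open>Each boundary of a triple is a connecting map followed by passage to a pair. In the
  composite, passing to the pair is followed by the connecting map of that same pair, two
  consecutive maps of a long exact sequence.\<close>

lemma skeletal_boundary_twice:
  assumes "c \<in> carrier (skeletal_homology X (Suc (Suc p)))"
  shows "skeletal_boundary p (skeletal_boundary (Suc p) c) = \<one>\<^bsub>skeletal_homology X p\<^esub>"
proof -
  let ?T2 = "subtopology S (skeleton X (int (Suc (Suc p))))" and ?T1 = "subtopology S (skeleton X (int (Suc p)))"
  let ?T0 = "subtopology S (skeleton X (int p))"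
  let ?A = "skeleton X (int p)"
  let ?b = "hom_boundary (int (Suc (Suc p))) ?T2 (skeleton X (int (Suc p))) c"
  interpret h: group_hom "homology_group (int p) ?T0" "skeletal_homology X p"
    "hom_induced (int p) ?T0 {} ?T0 (skeleton X (int p - 1)) id"
    unfolding skeletal_homology_pair by (rule group_hom_hom_induced)
  have sb1: "skeletal_boundary (Suc p) c = hom_induced (int (Suc p)) ?T1 {} ?T1 ?A id ?b"
    unfolding skeletal_boundary_def hom_relboundary_def by (simp add: subtopology_skeleton)
  have "exact_seq ([homology_group (int (Suc p) - 1) (subtopology ?T1 ?A), relative_homology_group (int (Suc p)) ?T1 ?A,
      homology_group (int (Suc p)) ?T1],
     [hom_boundary (int (Suc p)) ?T1 ?A, hom_induced (int (Suc p)) ?T1 {} ?T1 ?A id])"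
    by (rule homology_exactness_axiom_1)
  then have "kernel (relative_homology_group (int (Suc p)) ?T1 ?A) (homology_group (int p) ?T0) (hom_boundary (int (Suc p)) ?T1 ?A)
      = hom_induced (int (Suc p)) ?T1 {} ?T1 ?A id ` carrier (homology_group (int (Suc p)) ?T1)"
    by (simp add: subtopology_skeleton)
  moreover have "?b \<in> carrier (homology_group (int (Suc p)) ?T1)"
    using hom_boundary_carrier[of "int (Suc (Suc p))" ?T2 "skeleton X (int (Suc p))" c]
    by (simp add: subtopology_skeleton)
  ultimately have "hom_boundary (int (Suc p)) ?T1 ?A (skeletal_boundary (Suc p) c) = \<one>\<^bsub>homology_group (int p) ?T0\<^esub>"
    unfolding sb1 kernel_def by blast
  then show ?thesis
    unfolding skeletal_boundary_def[of p] hom_relboundary_def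
    by (simp add: subtopology_skeleton del: one_relative_homology_group)
qed

text \<open>The sum is the coefficient of \<rho> in a double boundary, read as an exponent in local
  homology at a point of \<rho>, where the class of \<rho> has infinite order.\<close>

lemma incidence_incidence:
  assumes \<rho>: "\<rho> \<in> cw_cells X p"
  shows "(\<Sum>\<tau>\<in>cw_cells X (Suc p). incidence X (Suc p) \<sigma> \<tau> * incidence X p \<tau> \<rho>) = 0"
proof -
  obtain x where x: "x \<in> \<rho>" using cell_nonempty cell_in_all \<rho> by blast
  interpret b: group_hom "skeletal_homology X (Suc p)" "skeletal_homology X p" "skeletal_boundary p"
    by (rule group_hom_skeletal_boundary)
  interpret f: group_hom "skeletal_homology X p" "local_group p x" "local_map p x" by (rule group_hom_local_map)
  interpret H: comm_group "local_group p x" by (rule comm_group_local)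
  let ?u = "local_map p x (cell_class X p \<rho>)"
  have u: "?u \<in> carrier (local_group p x)" by simp
  have hom: "group_hom (skeletal_homology X (Suc p)) (local_group p x) (\<lambda>z. local_map p x (skeletal_boundary p z))"
    by (intro group_hom.intro group_hom_axioms.intro b.G.group_axioms f.H.group_axioms homI) simp_all
  have "\<one>\<^bsub>local_group p x\<^esub> = local_map p x (skeletal_boundary p (skeletal_boundary (Suc p) (cell_class X (Suc (Suc p)) \<sigma>)))"
    by (simp add: skeletal_boundary_twice)
  also have "\<dots> = finprod (local_group p x)
      (\<lambda>\<tau>. local_map p x (skeletal_boundary p (cell_class X (Suc p) \<tau>)) [^]\<^bsub>local_group p x\<^esub> incidence X (Suc p) \<sigma> \<tau>)
      (cw_cells X (Suc p))"
    unfolding skeletal_boundary_cell_class[of "Suc p"] by (rule hom_combination[OF hom comm_group_local])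
  also have "\<dots> = finprod (local_group p x)
      (\<lambda>\<tau>. ?u [^]\<^bsub>local_group p x\<^esub> (incidence X (Suc p) \<sigma> \<tau> * incidence X p \<tau> \<rho>)) (cw_cells X (Suc p))"
    unfolding skeletal_boundary_cell_class local_map_combination[OF \<rho> x] f.H.int_pow_pow[OF u]
    by (simp add: mult.commute)
  also have "\<dots> = ?u [^]\<^bsub>local_group p x\<^esub> (\<Sum>\<tau>\<in>cw_cells X (Suc p). incidence X (Suc p) \<sigma> \<tau> * incidence X p \<tau> \<rho>)"
    by (rule H.finprod_pow_sum[OF u])
  finally show ?thesis using local_map_cell[OF \<rho> x] by metis
qed

text \<open>Collapse everything to a one-point space. Every vertex class goes to the same generator,
  because vertices are oriented by point classes; the boundary of a 1-cell goes to the identity,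
  because it already dies in the homology of the 1-skeleton.\<close>

lemma sum_incidence_vertices:
  "(\<Sum>v\<in>cw_cells X 0. incidence X 0 \<sigma> v) = 0"
proof -
  let ?T0 = "subtopology S (skeleton X 0)" and ?T1 = "subtopology S (skeleton X 1)"
  let ?P = "discrete_topology {()}" and ?k = "\<lambda>_. ()"
  let ?q = "hom_induced 0 ?T0 {} ?P {} ?k"
  let ?c = "cell_class X (Suc 0) \<sigma>" and ?u = "point_class ?P ()"
  have neg: "skeleton X (- 1) = {}" by (auto simp: skeleton_def)
  have G0: "skeletal_homology X 0 = homology_group 0 ?T0" by (simp add: skeletal_homology_def neg)
  have gen: "infinite_generator (homology_group 0 ?P) ?u" by (rule point_class_generator) simp
  interpret q: group_hom "skeletal_homology X 0" "homology_group 0 ?P" ?q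
    unfolding G0 by (rule group_hom_hom_induced)
  interpret H: comm_group "homology_group 0 ?P" by simp
  have u: "?u \<in> carrier (homology_group 0 ?P)" using gen unfolding infinite_generator_def by (rule conjunct1)
  have qv: "?q (cell_class X 0 v) = ?u" if v: "v \<in> cw_cells X 0" for v
  proof -
    let ?D = "closed_cell X v"
    have E: "closed_cell X v - v = {}" using boundary_subset_skeleton[OF v] neg by simp
    then have cl: "cell_class X 0 v = hom_induced 0 (subtopology S ?D) {} ?T0 {} id (point_class (subtopology S ?D) (the_elem v))"
      unfolding cell_class_def cell_orientation_def E by (simp add: neg)
    have D0: "?D \<subseteq> skeleton X 0" using closed_cell_subset_skeleton[OF v] by simp
    have "the_elem v \<in> v"
    proof -
      obtain h where h: "h ` unit_open_ball 0 = v" using chart[OF v] by metis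
      have "unit_open_ball 0 = {\<lambda>_. 0}" by (auto simp: unit_open_ball_def)
      then have "v = {h (\<lambda>_. 0)}" using h by auto
      then show ?thesis by (metis singletonI the_elem_eq)
    qed
    then have vD: "the_elem v \<in> topspace (subtopology S ?D)"
      using cell_subset_closed[OF cell_in_all[OF v]] cell_in_all[OF v] topspace_eq by auto
    have "?q (cell_class X 0 v) = hom_induced 0 (subtopology S ?D) {} ?P {} (?k \<circ> id) (point_class (subtopology S ?D) (the_elem v))"
      unfolding cl using continuous_map_subtopology_id[OF D0]
      by (intro hom_induced_compose') auto
    also have "\<dots> = homologous_rel_set 0 ?P {} (Simplices.chain_map 0 (?k \<circ> id) (frag_of (restrict (\<lambda>_. the_elem v) (standard_simplex 0))))"
      unfolding point_class_def
      using hom_induced_chain_map[OF _ _ singular_relcycle_point[OF vD], of ?P "?k \<circ> id" "{}"] by simp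
    also have "Simplices.chain_map 0 (?k \<circ> id) (frag_of (restrict (\<lambda>_. the_elem v) (standard_simplex 0)))
        = frag_of (restrict (\<lambda>_. ()) (standard_simplex 0))"
      by (simp add: simplex_map_def restrict_def fun_eq_iff)
    finally show ?thesis by (simp add: point_class_def)
  qed
  have "?q (skeletal_boundary 0 ?c) = \<one>\<^bsub>homology_group 0 ?P\<^esub>"
  proof -
    have sb: "skeletal_boundary 0 ?c = hom_boundary 1 ?T1 (skeleton X 0) ?c"
      unfolding skeletal_boundary_def using hom_relboundary_empty[of 1 ?T1 "skeleton X 0"] by (simp add: neg)
    have c: "?c \<in> carrier (relative_homology_group 1 ?T1 (skeleton X 0))"
      using cell_class_carrier[of "Suc 0" \<sigma>] by (simp add: skeletal_homology_Suc)
    have "exact_seq ([homology_group (1-1) ?T1, homology_group (1-1) (subtopology ?T1 (skeleton X 0)),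
        relative_homology_group 1 ?T1 (skeleton X 0)],
       [hom_induced (1-1) (subtopology ?T1 (skeleton X 0)) {} ?T1 {} id, hom_boundary 1 ?T1 (skeleton X 0)])"
      by (rule homology_exactness_axiom_2)
    then have "kernel (homology_group 0 ?T0) (homology_group 0 ?T1) (hom_induced 0 ?T0 {} ?T1 {} id) =
        hom_boundary 1 ?T1 (skeleton X 0) ` carrier (relative_homology_group 1 ?T1 (skeleton X 0))"
      by (simp add: subtopology_skeleton)
    then have 1: "hom_induced 0 ?T0 {} ?T1 {} id (skeletal_boundary 0 ?c) = \<one>\<^bsub>homology_group 0 ?T1\<^esub>"
      unfolding sb kernel_def using c by blast
    have "hom_induced 0 ?T1 {} ?P {} ?k (hom_induced 0 ?T0 {} ?T1 {} id (skeletal_boundary 0 ?c)) =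
        hom_induced 0 ?T0 {} ?P {} (?k \<circ> id) (skeletal_boundary 0 ?c)"
      by (rule hom_induced_compose') (use continuous_map_subtopology_id[OF skeleton_mono[of 0 1], of S] in auto)
    then have "?q (skeletal_boundary 0 ?c) = hom_induced 0 ?T1 {} ?P {} ?k \<one>\<^bsub>homology_group 0 ?T1\<^esub>"
      unfolding 1 by simp
    then show ?thesis
      using group_hom.hom_one[OF group_hom_hom_induced] by metis
  qed
  moreover have "?q (skeletal_boundary 0 ?c) = ?u [^]\<^bsub>homology_group 0 ?P\<^esub> (\<Sum>v\<in>cw_cells X 0. incidence X 0 \<sigma> v)"
  proof -
    have "?q (skeletal_boundary 0 ?c) =
        finprod (homology_group 0 ?P) (\<lambda>v. ?q (cell_class X 0 v) [^]\<^bsub>homology_group 0 ?P\<^esub> incidence X 0 \<sigma> v) (cw_cells X 0)"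
      unfolding skeletal_boundary_cell_class
      by (rule hom_combination[OF q.group_hom_axioms H.comm_group_axioms])
    also have "\<dots> = finprod (homology_group 0 ?P) (\<lambda>v. ?u [^]\<^bsub>homology_group 0 ?P\<^esub> incidence X 0 \<sigma> v) (cw_cells X 0)"
      using u by (intro H.finprod_cong') (auto simp: qv)
    finally show ?thesis by (simp only: H.finprod_pow_sum[OF u])
  qed
  ultimately show ?thesis using gen unfolding infinite_generator_def by metis
qed

text \<open>A cell of least dimension \<open>p > 0\<close> would have a nonempty boundary sphere
  mapped into an empty skeleton.\<close>

lemma vertex_exists:
  assumes "topspace S \<noteq> {}"
  shows "cw_cells X 0 \<noteq> {}"
proof -
  have ex: "\<exists>p. cw_cells X p \<noteq> {}" using assms topspace_eq by (auto simp: all_cells_def)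
  define p where "p = (LEAST p. cw_cells X p \<noteq> {})"
  have p: "cw_cells X p \<noteq> {}" unfolding p_def using ex by (rule LeastI_ex)
  have less: "cw_cells X q = {}" if "q < p" for q using not_less_Least that unfolding p_def by blast
  show ?thesis
  proof (cases "p = 0")
    case False
    obtain e where e: "e \<in> cw_cells X p" using p by blast
    have "skeleton X (int p - 1) = {}"
      unfolding skeleton_def using less by auto
    moreover obtain h where "h ` unit_sphere p \<subseteq> skeleton X (int p - 1)" using chart[OF e] by metis
    moreover have "(\<lambda>i. if i = 0 then 1 else 0) \<in> unit_sphere p"
      using False by (auto simp: unit_sphere_def if_distrib[of "\<lambda>x. x ^ 2"] cong: if_cong)
    ultimately show ?thesis by blast
  qed (use p in auto)
qed

end

section \<open>Subcomplexes\<close>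

lemma subcomplex_cells: "subcomplex A X \<Longrightarrow> cw_cells A p \<subseteq> cw_cells X p"
  by (simp add: subcomplex_def)

lemma subcomplex_all_cells: "subcomplex A X \<Longrightarrow> all_cells A \<subseteq> all_cells X"
  using subcomplex_cells by (fastforce simp: all_cells_def)

lemma closed_cell_subcomplex:
  assumes "subcomplex A X" "e \<in> all_cells A"
  shows "closed_cell A e = closed_cell X e"
    and "subtopology (cw_space A) (closed_cell X e) = subtopology (cw_space X) (closed_cell X e)"
proof -
  let ?U = "\<Union>(all_cells A)"
  have sp: "cw_space A = subtopology (cw_space X) ?U" and sub: "closed_cell X e \<subseteq> ?U"
    using assms by (auto simp: subcomplex_def)
  have "closed_cell A e = ?U \<inter> cw_space X closure_of (?U \<inter> e)"
    unfolding closed_cell_def sp closure_of_subtopology ..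
  also have "?U \<inter> e = e" using assms(2) by auto
  finally show "closed_cell A e = closed_cell X e"
    using sub by (simp add: closed_cell_def Int_absorb1)
  show "subtopology (cw_space A) (closed_cell X e) = subtopology (cw_space X) (closed_cell X e)"
    unfolding sp using sub by (simp add: subtopology_subtopology Int_absorb1)
qed

lemma subcomplex_skeleton:
  assumes "subcomplex A X" "finite_regular_cw X"
  shows "skeleton A n = skeleton X n \<inter> \<Union>(all_cells A)"
proof
  interpret regular_cw X using assms(2) by unfold_locales
  show "skeleton A n \<subseteq> skeleton X n \<inter> \<Union>(all_cells A)"
    unfolding skeleton_def all_cells_def using subcomplex_cells[OF assms(1)] by fast
  show "skeleton X n \<inter> \<Union>(all_cells A) \<subseteq> skeleton A n"
  proof
    fix x assume "x \<in> skeleton X n \<inter> \<Union>(all_cells A)"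
    then obtain p q e e' where x: "int p \<le> n" "e \<in> cw_cells X p" "x \<in> e" "e' \<in> cw_cells A q" "x \<in> e'"
      by (auto simp: skeleton_def all_cells_def)
    then have "e' \<in> cw_cells X q" using subcomplex_cells[OF assms(1)] by blast
    then have "e = e'" "p = q"
      using cells_disjoint[OF cell_in_all cell_in_all] dim_unique x by metis+
    then show "x \<in> skeleton A n" using x by (auto simp: skeleton_def)
  qed
qed

text \<open>The values of a carrier are given only as subcomplexes; this makes the theory of regular
  complexes available for them. The charts are those of the ambient complex.\<close>

lemma subcomplex_finite_regular:
  assumes "subcomplex A X" "finite_regular_cw X"
  shows "finite_regular_cw A"
proof -
  interpret regular_cw X using assms(2) by unfold_locales
  let ?U = "\<Union>(all_cells A)"
  have sp: "cw_space A = subtopology (cw_space X) ?U" using assms by (auto simp: subcomplex_def)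
  have all: "all_cells A \<subseteq> all_cells X" by (rule subcomplex_all_cells[OF assms(1)])
  have dim: "cw_cells A p \<inter> cw_cells A q = {}" if "p \<noteq> q" for p q
    using subcomplex_cells[OF assms(1)] dim_unique that by blast
  have charts: "\<exists>h. homeomorphic_map (subtopology (Euclidean_space p) (unit_ball p))
       (subtopology (cw_space A) (closed_cell A e)) h \<and>
      h ` unit_open_ball p = e \<and> h ` unit_sphere p \<subseteq> skeleton A (int p - 1)"
    if e: "e \<in> cw_cells A p" for p e
  proof -
    have eA: "e \<in> all_cells A" using e by (auto simp: all_cells_def)
    have eX: "e \<in> cw_cells X p" using e subcomplex_cells[OF assms(1)] by blast
    obtain h where h: "homeomorphic_map (top_of_set (unit_ball p)) (subtopology S (closed_cell X e)) h"
      "h ` unit_open_ball p = e" "h ` unit_sphere p = closed_cell X e - e"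
      "h ` unit_sphere p \<subseteq> skeleton X (int p - 1)"
      using chart[OF eX] .
    have "closed_cell X e \<subseteq> ?U" using assms(1) eA by (auto simp: subcomplex_def)
    then have "h ` unit_sphere p \<subseteq> skeleton A (int p - 1)"
      unfolding subcomplex_skeleton[OF assms] using h(3,4) by blast
    then show ?thesis
      using h(1,2) unfolding closed_cell_subcomplex[OF assms(1) eA] subtopology_unit_ball by blast
  qed
  have top: "\<Union>(all_cells A) = topspace (cw_space A)"
    unfolding sp using all topspace_eq by auto
  have "Hausdorff_space (cw_space A)" using Hausdorff by (simp add: sp Hausdorff_space_subtopology)
  moreover have "finite (all_cells A)" using all finite_all_cells by (rule finite_subset)
  moreover have "disjoint (all_cells A)" using disjoint_cells all by (rule pairwise_subset)
  ultimately show ?thesis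
    unfolding finite_regular_cw_def using dim charts top by (intro conjI allI impI ballI)
qed

text \<open>The boundary maps of the triples of skeleta commute with the inclusion, which sends cell
  classes to cell classes. So the incidence numbers of \<open>A\<close>, being 0 off its cells,
  satisfy the characterisation of those of \<open>X\<close>.\<close>

lemma incidence_subcomplex:
  assumes sub: "subcomplex A X" and X: "finite_regular_cw X" and \<sigma>: "\<sigma> \<in> cw_cells A (Suc p)"
  shows "incidence A p \<sigma> = incidence X p \<sigma>"
proof -
  interpret X: regular_cw X using X by unfold_locales
  interpret A: regular_cw A using subcomplex_finite_regular[OF sub X] by unfold_locales
  let ?U = "\<Union>(all_cells A)"
  have sp: "cw_space A = subtopology (cw_space X) ?U" using sub by (auto simp: subcomplex_def)
  have skU: "skeleton A n \<subseteq> ?U" and skX: "skeleton A n \<subseteq> skeleton X n" for n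
    unfolding subcomplex_skeleton[OF sub X] by auto
  have top: "subtopology (cw_space A) (skeleton A n) = subtopology (cw_space X) (skeleton A n)" for n
    unfolding sp using skU[of n] by (simp add: subtopology_subtopology Int_absorb1)
  define i where "i q = pair_incl (int q) (cw_space X) (skeleton A (int q)) (skeleton A (int q - 1))
      (skeleton X (int q)) (skeleton X (int q - 1))" for q
  have i_hom: "group_hom (skeletal_homology A q) (skeletal_homology X q) (i q)" for q
    unfolding A.skeletal_homology_pair X.skeletal_homology_pair i_def top by (rule group_hom_hom_induced)
  have i_class: "i q (cell_class A q e) = cell_class X q e" if e: "e \<in> cw_cells A q" for q e
  proof -
    have eA: "e \<in> all_cells A" by (rule A.cell_in_all[OF e])
    note cc = closed_cell_subcomplex[OF sub eA]
    \<comment> \<open>After rewriting, both orientations are the same \<open>SOME\<close> term, so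
      they are equal and not just equal up to sign.\<close>
    have or: "cell_orientation A q e = cell_orientation X q e"
      by (simp add: cell_orientation_def cell_homology_def cc)
    have "cell_class A q e = pair_incl (int q) (cw_space X) (closed_cell X e) (closed_cell X e - e)
        (skeleton A (int q)) (skeleton A (int q - 1)) (cell_orientation X q e)"
      unfolding cell_class_def or cc top ..
    then show ?thesis
      unfolding i_def cell_class_def
      using A.closed_cell_subset_skeleton[OF e] A.boundary_subset_skeleton[OF e] skX
      by (simp add: pair_incl_comp cc)
  qed
  have "X.skeletal_boundary p (i (Suc p) (cell_class A (Suc p) \<sigma>)) = i p (A.skeletal_boundary p (cell_class A (Suc p) \<sigma>))"
  proof -
    have idm: "id \<in> skeleton A (int p) \<rightarrow> skeleton X (int p)" "id \<in> skeleton A (int p - 1) \<rightarrow> skeleton X (int p - 1)"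
      using skX[of "int p"] skX[of "int p - 1"] by auto
    have subA: "subtopology (subtopology (cw_space X) (skeleton A (int (Suc p)))) (skeleton A (int p)) =
        subtopology (cw_space X) (skeleton A (int p))"
      using A.skeleton_mono[of "int p" "int (Suc p)"] by (simp add: subtopology_subtopology Int_absorb1)
    have subX: "subtopology (subtopology (cw_space X) (skeleton X (int (Suc p)))) (skeleton X (int p)) =
        subtopology (cw_space X) (skeleton X (int p))"
      by (rule X.subtopology_skeleton) simp
    have e: "int (Suc p) - 1 = int p" by simp
    show ?thesis
      using fun_cong[OF naturality_hom_induced_relboundary[OF continuous_map_subtopology_id[OF skX[of "int (Suc p)"], of "cw_space X"] idm,
            where p = "int (Suc p)"], of "cell_class A (Suc p) \<sigma>"]
      unfolding X.skeletal_boundary_def A.skeletal_boundary_def i_def top subA subX e o_def .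
  qed
  then have "X.skeletal_boundary p (cell_class X (Suc p) \<sigma>) = i p (A.combination p (incidence A p \<sigma>))"
    unfolding i_class[OF \<sigma>] A.skeletal_boundary_cell_class .
  also have "\<dots> = finprod (skeletal_homology X p)
      (\<lambda>\<tau>. i p (cell_class A p \<tau>) [^]\<^bsub>skeletal_homology X p\<^esub> incidence A p \<sigma> \<tau>) (cw_cells A p)"
    by (rule A.hom_combination[OF i_hom X.comm_group_skeletal])
  also have "\<dots> = X.combination p (incidence A p \<sigma>)"
  proof -
    interpret G: comm_group "skeletal_homology X p" by (rule X.comm_group_skeletal)
    show ?thesis unfolding X.combination_def
      using subcomplex_cells[OF sub, of p] A.incidence_outside
      by (intro G.finprod_mono_neutral_cong_left X.finite_cells) (auto simp: i_class)
  qed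
  finally have "X.skeletal_boundary p (cell_class X (Suc p) \<sigma>) = X.combination p (incidence A p \<sigma>)" .
  moreover have "incidence A p \<sigma> \<tau> = 0" if "\<tau> \<notin> cw_cells X p" for \<tau>
    using that subcomplex_cells[OF sub, of p] A.incidence_outside by blast
  ultimately show ?thesis by (intro X.incidence_unique[symmetric])
qed

section \<open>Cellular chains\<close>

text \<open>The linear extension of an assignment on basis cells. Boundaries and all linear graded
  maps are brought into this form, so that composing linear maps becomes
  \<open>extend_extend\<close>, an exchange of finite sums.\<close>

definition extend :: "'a cw \<Rightarrow> nat \<Rightarrow> ('a set \<Rightarrow> 'b \<Rightarrow> 'k::field) \<Rightarrow> ('a set \<Rightarrow> 'k) \<Rightarrow> 'b \<Rightarrow> 'k" where
  "extend X p \<phi> c = (\<lambda>e. \<Sum>\<sigma>\<in>cw_cells X p. c \<sigma> * \<phi> \<sigma> e)"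

lemma extend_add: "extend X p \<phi> (\<lambda>e. c e + d e) = (\<lambda>e. extend X p \<phi> c e + extend X p \<phi> d e)"
  by (simp add: extend_def sum.distrib distrib_right)

lemma extend_scale: "extend X p \<phi> (\<lambda>e. s * c e) = (\<lambda>e. s * extend X p \<phi> c e)"
  by (simp add: extend_def sum_distrib_left mult.assoc)

lemma extend_zero [simp]: "extend X p \<phi> (\<lambda>_. 0) = (\<lambda>_. 0)"
  by (simp add: extend_def)

lemma extend_diff:
  "extend X p (\<lambda>\<sigma> e. \<phi> \<sigma> e - \<psi> \<sigma> e) c = (\<lambda>e. extend X p \<phi> c e - extend X p \<psi> c e)"
  by (simp add: extend_def sum_subtractf right_diff_distrib)

lemma extend_cong:
  "(\<And>\<sigma>. \<sigma> \<in> cw_cells X p \<Longrightarrow> c \<sigma> \<noteq> 0 \<Longrightarrow> \<phi> \<sigma> = \<psi> \<sigma>) \<Longrightarrow> extend X p \<phi> c = extend X p \<psi> c"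
  unfolding extend_def by (rule ext, rule sum.cong, simp, metis mult_zero_left)

lemma extend_extend:
  "extend X p \<phi> (extend Z q \<psi> c) = extend Z q (\<lambda>\<sigma>. extend X p \<phi> (\<psi> \<sigma>)) c"
proof
  fix e
  have "extend X p \<phi> (extend Z q \<psi> c) e = (\<Sum>\<sigma>\<in>cw_cells X p. \<Sum>\<rho>\<in>cw_cells Z q. c \<rho> * \<psi> \<rho> \<sigma> * \<phi> \<sigma> e)"
    by (simp add: extend_def sum_distrib_right)
  also have "\<dots> = (\<Sum>\<rho>\<in>cw_cells Z q. \<Sum>\<sigma>\<in>cw_cells X p. c \<rho> * \<psi> \<rho> \<sigma> * \<phi> \<sigma> e)"
    by (rule sum.swap)
  also have "\<dots> = extend Z q (\<lambda>\<sigma>. extend X p \<phi> (\<psi> \<sigma>)) c e"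
    by (simp add: extend_def sum_distrib_left mult.assoc)
  finally show "extend X p \<phi> (extend Z q \<psi> c) e = extend Z q (\<lambda>\<sigma>. extend X p \<phi> (\<psi> \<sigma>)) c e" .
qed

lemma extend_chains:
  assumes "\<And>\<sigma>. \<sigma> \<in> cw_cells X p \<Longrightarrow> c \<sigma> \<noteq> 0 \<Longrightarrow> \<phi> \<sigma> \<in> chains Y q"
  shows "extend X p \<phi> c \<in> chains Y q"
proof -
  have "c \<sigma> * \<phi> \<sigma> e = 0" if "\<sigma> \<in> cw_cells X p" "e \<notin> cw_cells Y q" for \<sigma> e
    using assms[OF that(1)] that(2) by (cases "c \<sigma> = 0") (auto simp: chains_def)
  then show ?thesis unfolding chains_def extend_def by (auto intro: sum.neutral)
qed

declare cell_boundary.simps(2) [simp del]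

lemma cell_boundary_eq_extend:
  "cell_boundary X (Suc p) c = extend X (Suc p) (\<lambda>\<sigma> \<tau>. of_int (incidence X p \<sigma> \<tau>)) c"
  by (simp add: extend_def cell_boundary.simps)

lemma cell_boundary_extend:
  "cell_boundary Y q (extend X p \<phi> c) = extend X p (\<lambda>\<sigma>. cell_boundary Y q (\<phi> \<sigma>)) c"
proof (cases q)
  case 0
  then show ?thesis by (simp add: extend_def)
next
  case (Suc r)
  show ?thesis unfolding Suc cell_boundary_eq_extend by (rule extend_extend)
qed

lemma cell_boundary_diff:
  "cell_boundary X p (\<lambda>e. c e - d e) = (\<lambda>e. cell_boundary X p c e - cell_boundary X p d e)"
  by (cases p) (simp_all add: cell_boundary.simps left_diff_distrib sum_subtractf)

lemma augmentation_extend: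
  "augmentation Y (extend X p \<phi> c) = (\<Sum>\<sigma>\<in>cw_cells X p. c \<sigma> * augmentation Y (\<phi> \<sigma>))"
  unfolding augmentation_def extend_def sum_distrib_left by (rule sum.swap)

lemma chains_zero [simp]: "(\<lambda>_. 0) \<in> chains X p"
  by (simp add: chains_def)

lemma chains_diff: "c \<in> chains X p \<Longrightarrow> d \<in> chains X p \<Longrightarrow> (\<lambda>e. c e - d e) \<in> chains X p"
  by (simp add: chains_def)

lemma chains_mono: "cw_cells A p \<subseteq> cw_cells X p \<Longrightarrow> chains A p \<subseteq> chains X p"
  by (auto simp: chains_def)

lemma cell_chain_chains: "\<sigma> \<in> cw_cells X p \<Longrightarrow> cell_chain \<sigma> \<in> chains X p"
  by (auto simp: chains_def cell_chain_def)

lemma carried_by_iff: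
  "carried_by r X F w \<longleftrightarrow> (\<forall>p. \<forall>\<sigma>\<in>cw_cells X p. w p (cell_chain \<sigma>) \<in> chains (F \<sigma>) (p + r))"
  by (auto simp: carried_by_def chains_def)

context regular_cw
begin

lemma extend_cell_chain:
  assumes "\<sigma> \<in> cw_cells X p"
  shows "extend X p \<phi> (cell_chain \<sigma>) = \<phi> \<sigma>"
proof
  fix e
  have "extend X p \<phi> (cell_chain \<sigma>) e = (\<Sum>\<rho>\<in>cw_cells X p. if \<rho> = \<sigma> then \<phi> \<rho> e else 0)"
    unfolding extend_def cell_chain_def by (intro sum.cong) auto
  then show "extend X p \<phi> (cell_chain \<sigma>) e = \<phi> \<sigma> e"
    using assms finite_cells by simp
qed

lemma chain_eq_extend:
  assumes "c \<in> chains X p"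
  shows "c = extend X p cell_chain c"
proof
  fix e
  have "extend X p cell_chain c e = (\<Sum>\<rho>\<in>cw_cells X p. if e = \<rho> then c \<rho> else 0)"
    unfolding extend_def cell_chain_def by (intro sum.cong) auto
  then show "c e = extend X p cell_chain c e"
    using assms finite_cells by (auto simp: chains_def)
qed

lemma cell_boundary_cell_chain:
  "\<sigma> \<in> cw_cells X (Suc p) \<Longrightarrow> cell_boundary X (Suc p) (cell_chain \<sigma>) = (\<lambda>\<tau>. of_int (incidence X p \<sigma> \<tau>))"
  unfolding cell_boundary_eq_extend by (rule extend_cell_chain)

lemma cell_boundary_as_extend:
  "c \<in> chains X p \<Longrightarrow> cell_boundary X p c = extend X p (\<lambda>\<sigma>. cell_boundary X p (cell_chain \<sigma>)) c"
  using cell_boundary_extend[of X p X p cell_chain c] chain_eq_extend[of c p] by simp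

lemma cell_boundary_chains: "cell_boundary X (Suc p) c \<in> chains X p"
  by (simp add: chains_def cell_boundary.simps incidence_outside)

lemma cell_boundary_boundary:
  "cell_boundary X p (cell_boundary X (Suc p) c) = (\<lambda>_. 0 :: 'k::field)"
proof (cases p)
  case (Suc q)
  have "extend X (Suc q) (\<lambda>\<tau> \<rho>. of_int (incidence X q \<tau> \<rho>) :: 'k) (\<lambda>\<tau>. of_int (incidence X (Suc q) \<sigma> \<tau>)) = (\<lambda>_. 0)" for \<sigma>
  proof
    fix \<rho>
    show "extend X (Suc q) (\<lambda>\<tau> \<rho>. of_int (incidence X q \<tau> \<rho>) :: 'k) (\<lambda>\<tau>. of_int (incidence X (Suc q) \<sigma> \<tau>)) \<rho> = 0"
    proof (cases "\<rho> \<in> cw_cells X q")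
      case True
      have "extend X (Suc q) (\<lambda>\<tau> \<rho>. of_int (incidence X q \<tau> \<rho>) :: 'k) (\<lambda>\<tau>. of_int (incidence X (Suc q) \<sigma> \<tau>)) \<rho> =
         of_int (\<Sum>\<tau>\<in>cw_cells X (Suc q). incidence X (Suc q) \<sigma> \<tau> * incidence X q \<tau> \<rho>)"
        by (simp add: extend_def)
      then show ?thesis using incidence_incidence[OF True] by simp
    qed (simp add: extend_def incidence_outside)
  qed
  then show ?thesis
    unfolding Suc cell_boundary_eq_extend extend_extend by (simp add: extend_def)
qed simp

lemma augmentation_boundary: "augmentation X (cell_boundary X (Suc 0) c) = (0 :: 'k::field)"
proof -
  have "augmentation X (\<lambda>\<tau>. of_int (incidence X 0 \<sigma> \<tau>) :: 'k) = 0" for \<sigma>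
    using sum_incidence_vertices[of \<sigma>] by (simp add: augmentation_def flip: of_int_sum)
  then show ?thesis
    unfolding cell_boundary_eq_extend augmentation_extend by simp
qed

lemma augmentation_cell_chain: "v \<in> cw_cells X 0 \<Longrightarrow> augmentation X (cell_chain v) = 1"
  unfolding augmentation_def cell_chain_def using finite_cells by simp

text \<open>\<open>graded_linear\<close> provides only additivity and homogeneity on chains;
  induction over the finitely many cells yields the expansion in the basis.\<close>

lemma graded_linear_eq_extend:
  assumes w: "graded_linear r X Y w" and c: "c \<in> chains X p"
  shows "w p c = extend X p (\<lambda>\<sigma>. w p (cell_chain \<sigma>)) c"
proof -
  have add: "w p (\<lambda>e. a e + b e) = (\<lambda>e. w p a e + w p b e)" if "a \<in> chains X p" "b \<in> chains X p" for a b
    using w that unfolding graded_linear_def by blast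
  have scale: "w p (\<lambda>e. s * a e) = (\<lambda>e. s * w p a e)" if "a \<in> chains X p" for s a
    using w that unfolding graded_linear_def by blast
  have zero: "w p (\<lambda>_. 0) = (\<lambda>_. 0)"
    using scale[OF chains_zero, of 0] by simp
  have sum: "(\<lambda>e. \<Sum>\<sigma>\<in>K. c \<sigma> * cell_chain \<sigma> e) \<in> chains X p \<and>
      w p (\<lambda>e. \<Sum>\<sigma>\<in>K. c \<sigma> * cell_chain \<sigma> e) = (\<lambda>e. \<Sum>\<sigma>\<in>K. c \<sigma> * w p (cell_chain \<sigma>) e)"
    if "finite K" "K \<subseteq> cw_cells X p" for K
    using that
  proof (induction K)
    case (insert \<sigma> K)
    let ?d = "\<lambda>e. c \<sigma> * cell_chain \<sigma> e" and ?s = "\<lambda>e. \<Sum>\<sigma>\<in>K. c \<sigma> * cell_chain \<sigma> e"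
    have \<sigma>: "cell_chain \<sigma> \<in> chains X p" using insert.prems by (intro cell_chain_chains) auto
    then have d: "?d \<in> chains X p" by (auto simp: chains_def)
    have s: "?s \<in> chains X p" "w p ?s = (\<lambda>e. \<Sum>\<sigma>\<in>K. c \<sigma> * w p (cell_chain \<sigma>) e)"
      using insert by auto
    note add[OF d s(1)] scale[OF \<sigma>, of "c \<sigma>"]
    moreover have "(\<lambda>e. ?d e + ?s e) \<in> chains X p" using d s(1) by (simp add: chains_def)
    ultimately show ?case using insert.hyps s(2) by simp
  qed (use zero in simp)
  show ?thesis
    using sum[OF finite_cells subset_refl] chain_eq_extend[OF c] unfolding extend_def by metis
qed

lemma graded_linear_extend:
  assumes "\<And>p \<sigma>. \<sigma> \<in> cw_cells X p \<Longrightarrow> \<phi> p \<sigma> \<in> chains Y (p + r)"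
  shows "graded_linear r X Y (\<lambda>p. extend X p (\<phi> p))"
  unfolding graded_linear_def using assms by (auto simp: extend_add extend_scale intro!: extend_chains)

end

lemma cell_boundary_subcomplex:
  assumes sub: "subcomplex A X" and X: "finite_regular_cw X" and c: "c \<in> chains A p"
  shows "cell_boundary A p c = cell_boundary X p c"
proof (cases p)
  case (Suc q)
  interpret regular_cw X using X by unfold_locales
  show ?thesis
    unfolding Suc cell_boundary_eq_extend extend_def
    using c incidence_subcomplex[OF sub X] subcomplex_cells[OF sub, of "Suc q"] finite_cells[of "Suc q"]
    by (intro ext sum.mono_neutral_cong_left) (auto simp: chains_def Suc)
qed simp

lemma augmentation_subcomplex:
  assumes sub: "subcomplex A X" and X: "finite_regular_cw X" and c: "c \<in> chains A 0"
  shows "augmentation A c = augmentation X c"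
proof -
  interpret regular_cw X using X by unfold_locales
  show ?thesis
    unfolding augmentation_def using c subcomplex_cells[OF sub, of 0] finite_cells[of 0]
    by (intro sum.mono_neutral_left) (auto simp: chains_def)
qed

section \<open>Acyclic carriers\<close>

text \<open>Cycles of the augmented complex: the chains that can be filled in an acyclic complex in
  every degree, including 0.\<close>

definition reduced_cycle :: "'a cw \<Rightarrow> nat \<Rightarrow> ('a set \<Rightarrow> 'k::field) \<Rightarrow> bool" where
  "reduced_cycle X p z \<longleftrightarrow> (if p = 0 then augmentation X z = 0 else cell_boundary X p z = (\<lambda>_. 0))"

text \<open>In degree 0 every chain is a multiple of one \<open>z\<^sub>0\<close> modulo boundaries,
  and boundaries have augmentation 0. A vertex has augmentation 1, so that of
  \<open>z\<^sub>0\<close> is nonzero; a chain of augmentation 0 is then the zero multiple, that is,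
  a boundary.\<close>

lemma acyclic_fill:
  fixes z :: "'a set \<Rightarrow> 'k::field"
  assumes "finite_regular_cw A" and acyclic: "acyclic_cw TYPE('k) A" and ne: "topspace (cw_space A) \<noteq> {}"
    and z: "z \<in> chains A p" "reduced_cycle A p z"
  shows "\<exists>c \<in> chains A (Suc p). cell_boundary A (Suc p) c = z"
proof (cases "p = 0")
  case False
  then have "z \<in> cell_cycles A p" using z by (simp add: cell_cycles_def reduced_cycle_def)
  then have "z \<in> cell_boundaries A p" using acyclic False unfolding acyclic_cw_def by blast
  then show ?thesis unfolding cell_boundaries_def by blast
next
  case True
  interpret regular_cw A using assms(1) by unfold_locales
  have cyc: "y \<in> cell_cycles A 0" if "y \<in> chains A 0" for y :: "'a set \<Rightarrow> 'k"
    using that by (simp add: cell_cycles_def)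
  have "\<exists>z\<^sub>0 \<in> (cell_cycles A 0 :: ('a set \<Rightarrow> 'k) set). \<forall>y \<in> cell_cycles A 0.
      \<exists>!r. (\<lambda>e. y e - r * z\<^sub>0 e) \<in> cell_boundaries A 0"
    using acyclic unfolding acyclic_cw_def by (rule conjunct2)
  then obtain z\<^sub>0 :: "'a set \<Rightarrow> 'k" where
    "\<forall>y \<in> cell_cycles A 0. \<exists>!r. (\<lambda>e. y e - r * z\<^sub>0 e) \<in> cell_boundaries A 0" ..
  note z\<^sub>0 = this[THEN bspec, THEN ex1_implies_ex]
  have aug: "augmentation A y = r * augmentation A z\<^sub>0"
    if "(\<lambda>e. y e - r * z\<^sub>0 e) \<in> cell_boundaries A 0" for y r
  proof -
    have "augmentation A (\<lambda>e. y e - r * z\<^sub>0 e) = 0"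
      using that augmentation_boundary unfolding cell_boundaries_def by auto
    then show ?thesis by (simp add: augmentation_def sum_subtractf sum_distrib_left)
  qed
  obtain v where v: "v \<in> cw_cells A 0" using vertex_exists[OF ne] by blast
  obtain r where "(\<lambda>e. cell_chain v e - r * z\<^sub>0 e) \<in> cell_boundaries A 0"
    using z\<^sub>0[OF cyc[OF cell_chain_chains[OF v]]] ..
  from aug[OF this] have nz: "augmentation A z\<^sub>0 \<noteq> 0"
    by (auto simp: augmentation_cell_chain[OF v])
  have zc: "z \<in> chains A 0" using z(1) True by simp
  obtain s where s: "(\<lambda>e. z e - s * z\<^sub>0 e) \<in> cell_boundaries A 0"
    using z\<^sub>0[OF cyc[OF zc]] ..
  from aug[OF this] have "s = 0" using z(2) nz True by (simp add: reduced_cycle_def)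
  then have "z \<in> cell_boundaries A 0" using s by simp
  then show ?thesis unfolding True cell_boundaries_def by blast
qed

lemma acyclic_fill_subcomplex:
  fixes z :: "'a set \<Rightarrow> 'k::field"
  assumes sub: "subcomplex A X" and X: "finite_regular_cw X"
    and "acyclic_cw TYPE('k) A" and "topspace (cw_space A) \<noteq> {}"
    and z: "z \<in> chains A p" "reduced_cycle X p z"
  shows "\<exists>c. c \<in> chains A (Suc p) \<and> cell_boundary X (Suc p) c = z"
proof -
  have "reduced_cycle A p z"
    using z cell_boundary_subcomplex[OF sub X z(1)] augmentation_subcomplex[OF sub X, of z]
    by (auto simp: reduced_cycle_def)
  from acyclic_fill[OF subcomplex_finite_regular[OF sub X] assms(3,4) z(1) this]
  obtain c where c: "c \<in> chains A (Suc p)" "cell_boundary A (Suc p) c = z" by blast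
  then show ?thesis using cell_boundary_subcomplex[OF sub X c(1)] by auto
qed

locale carrier_between =
  X: regular_cw X + Y: regular_cw Y
  for X :: "'x cw" and Y :: "'y cw" +
  fixes F :: "'x set \<Rightarrow> 'y cw" and K :: "'k::field itself"
  assumes carrier: "acyclic_carrier K X Y F"
begin

lemma carrier_subcomplex: "\<sigma> \<in> cw_cells X p \<Longrightarrow> subcomplex (F \<sigma>) Y"
  using carrier X.cell_in_all unfolding acyclic_carrier_def carrier_cw_def by blast

lemma carrier_fill:
  fixes z :: "'y set \<Rightarrow> 'k"
  assumes "\<sigma> \<in> cw_cells X q" and "z \<in> chains (F \<sigma>) p" "reduced_cycle Y p z"
  shows "\<exists>c. c \<in> chains (F \<sigma>) (Suc p) \<and> cell_boundary Y (Suc p) c = z"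
proof -
  have K: "acyclic_cw TYPE('k) A = acyclic_cw K A" for A :: "'y cw" by (simp only: acyclic_cw_def)
  show ?thesis
    using carrier X.cell_in_all[OF assms(1)] assms(2,3)
    by (intro acyclic_fill_subcomplex[OF carrier_subcomplex[OF assms(1)] Y.regular])
      (auto simp: acyclic_carrier_def K)
qed

lemma carrier_face:
  assumes "\<sigma> \<in> cw_cells X (Suc p)" "incidence X p \<sigma> \<tau> \<noteq> 0"
  shows "\<tau> \<in> cw_cells X p" "chains (F \<tau>) q \<subseteq> chains (F \<sigma>) q"
proof -
  show "\<tau> \<in> cw_cells X p" by (rule X.incidence_face[OF assms])
  have "subcomplex (F \<tau>) (F \<sigma>)"
    using carrier X.incidence_face(2)[OF assms] unfolding acyclic_carrier_def carrier_cw_def by blast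
  then show "chains (F \<tau>) q \<subseteq> chains (F \<sigma>) q" by (intro chains_mono subcomplex_cells)
qed

text \<open>Only faces of \<sigma> occur in its boundary, and their carriers lie in
  \<open>F \<sigma>\<close>.\<close>

lemma extend_boundary_chains:
  fixes \<phi> :: "'x set \<Rightarrow> 'y set \<Rightarrow> 'k"
  assumes "\<And>\<tau>. \<tau> \<in> cw_cells X p \<Longrightarrow> \<phi> \<tau> \<in> chains (F \<tau>) q" and "\<sigma> \<in> cw_cells X (Suc p)"
  shows "extend X p \<phi> (cell_boundary X (Suc p) (cell_chain \<sigma>)) \<in> chains (F \<sigma>) q"
proof (rule extend_chains)
  fix \<tau> assume \<tau>: "\<tau> \<in> cw_cells X p" "cell_boundary X (Suc p) (cell_chain \<sigma>) \<tau> \<noteq> (0::'k)"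
  then have "incidence X p \<sigma> \<tau> \<noteq> 0"
    unfolding X.cell_boundary_cell_chain[OF assms(2)] by (metis of_int_0)
  then show "\<phi> \<tau> \<in> chains (F \<sigma>) q" using carrier_face[OF assms(2)] assms(1)[OF \<tau>(1)] by blast
qed

text \<open>The value of the chain map on each basis cell. A vertex gets any chain of augmentation 1
  in its carrier; a higher cell gets a filling, within its carrier, of the image of its boundary
  under the previous level.\<close>

fun lift :: "nat \<Rightarrow> 'x set \<Rightarrow> 'y set \<Rightarrow> 'k" where
  "lift 0 \<sigma> = (SOME c. c \<in> chains (F \<sigma>) 0 \<and> augmentation Y c = 1)"
| "lift (Suc p) \<sigma> = (SOME c. c \<in> chains (F \<sigma>) (Suc p) \<and>
     cell_boundary Y (Suc p) c = extend X p (lift p) (cell_boundary X (Suc p) (cell_chain \<sigma>)))"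

declare lift.simps [simp del]

lemma lift_0:
  assumes "\<sigma> \<in> cw_cells X 0"
  shows "lift 0 \<sigma> \<in> chains (F \<sigma>) 0 \<and> augmentation Y (lift 0 \<sigma>) = 1"
proof -
  have sub: "subcomplex (F \<sigma>) Y" by (rule carrier_subcomplex[OF assms])
  interpret A: regular_cw "F \<sigma>" using subcomplex_finite_regular[OF sub Y.regular] by unfold_locales
  have "topspace (cw_space (F \<sigma>)) \<noteq> {}"
    using carrier X.cell_in_all[OF assms] unfolding acyclic_carrier_def by blast
  then obtain v where v: "v \<in> cw_cells (F \<sigma>) 0" using A.vertex_exists by blast
  let ?c = "cell_chain v :: 'y set \<Rightarrow> 'k"
  have "?c \<in> chains (F \<sigma>) 0 \<and> augmentation Y ?c = 1"
    using cell_chain_chains[OF v] Y.augmentation_cell_chain subcomplex_cells[OF sub, of 0] v by blast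
  then have "\<exists>c :: 'y set \<Rightarrow> 'k. c \<in> chains (F \<sigma>) 0 \<and> augmentation Y c = 1"
    by (rule exI[of _ ?c])
  then show ?thesis unfolding lift.simps by (rule someI_ex)
qed

text \<open>A filling exists because the image of the boundary is a reduced cycle: in degree 0 as
  each vertex lifts with augmentation 1 and boundaries have augmentation 0, in higher degrees as the
  previous level commutes with boundaries and a double boundary vanishes.\<close>

lemma lift_step:
  assumes IH: "\<And>\<tau>. \<tau> \<in> cw_cells X p \<Longrightarrow> lift p \<tau> \<in> chains (F \<tau>) p"
    and IH': "\<And>q \<tau>. p = Suc q \<Longrightarrow> \<tau> \<in> cw_cells X p \<Longrightarrow>
      cell_boundary Y p (lift p \<tau>) = extend X q (lift q) (cell_boundary X p (cell_chain \<tau>))"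
    and \<sigma>: "\<sigma> \<in> cw_cells X (Suc p)"
  shows "lift (Suc p) \<sigma> \<in> chains (F \<sigma>) (Suc p) \<and>
     cell_boundary Y (Suc p) (lift (Suc p) \<sigma>) = extend X p (lift p) (cell_boundary X (Suc p) (cell_chain \<sigma>))"
proof -
  let ?b = "cell_boundary X (Suc p) (cell_chain \<sigma>) :: 'x set \<Rightarrow> 'k"
  have "reduced_cycle Y p (extend X p (lift p) ?b)"
  proof (cases p)
    case 0
    have "augmentation Y (extend X 0 (lift 0) ?b) = (\<Sum>v\<in>cw_cells X 0. ?b v)"
      unfolding augmentation_extend using lift_0 by (intro sum.cong) auto
    also have "\<dots> = 0" using X.augmentation_boundary unfolding 0 augmentation_def .
    finally show ?thesis by (simp add: reduced_cycle_def 0)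
  next
    case (Suc q)
    have "cell_boundary Y p (extend X p (lift p) ?b) =
        extend X p (\<lambda>\<tau>. extend X q (lift q) (cell_boundary X p (cell_chain \<tau>))) ?b"
      unfolding cell_boundary_extend by (intro extend_cong IH' Suc)
    also have "\<dots> = extend X q (lift q) (cell_boundary X p ?b)"
      unfolding extend_extend[symmetric] X.cell_boundary_as_extend[OF X.cell_boundary_chains] ..
    also have "\<dots> = (\<lambda>_. 0)" by (simp only: X.cell_boundary_boundary extend_zero)
    finally show ?thesis by (simp add: reduced_cycle_def Suc)
  qed
  from carrier_fill[OF \<sigma> extend_boundary_chains[OF IH \<sigma>] this]
  show ?thesis unfolding lift.simps by (rule someI_ex)
qed

lemma lift_carried:
  "\<sigma> \<in> cw_cells X p \<Longrightarrow> lift p \<sigma> \<in> chains (F \<sigma>) p"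
  "\<sigma> \<in> cw_cells X (Suc p) \<Longrightarrow>
     cell_boundary Y (Suc p) (lift (Suc p) \<sigma>) = extend X p (lift p) (cell_boundary X (Suc p) (cell_chain \<sigma>))"
proof -
  have *: "(\<forall>\<sigma>\<in>cw_cells X p. lift p \<sigma> \<in> chains (F \<sigma>) p) \<and>
    (\<forall>q. p = Suc q \<longrightarrow> (\<forall>\<tau>\<in>cw_cells X p.
      cell_boundary Y p (lift p \<tau>) = extend X q (lift q) (cell_boundary X p (cell_chain \<tau>))))" for p
  proof (induction p)
    case (Suc p)
    then show ?case using lift_step[of p] by simp
  qed (use lift_0 in simp)
  show "\<sigma> \<in> cw_cells X p \<Longrightarrow> lift p \<sigma> \<in> chains (F \<sigma>) p"
    "\<sigma> \<in> cw_cells X (Suc p) \<Longrightarrow>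
     cell_boundary Y (Suc p) (lift (Suc p) \<sigma>) = extend X p (lift p) (cell_boundary X (Suc p) (cell_chain \<sigma>))"
    using *[of p] *[of "Suc p"] by simp_all
qed

lemma chain_map_exists:
  "\<exists>f :: ('x, 'y, 'k) graded_map. chain_map X Y f \<and> carried_by 0 X F f"
proof (intro exI conjI)
  let ?f = "\<lambda>p. extend X p (lift p)"
  have Y: "lift p \<sigma> \<in> chains Y p" if "\<sigma> \<in> cw_cells X p" for p \<sigma>
    using lift_carried(1)[OF that] chains_mono[OF subcomplex_cells[OF carrier_subcomplex[OF that]]] by blast
  show "chain_map X Y ?f"
    unfolding chain_map_def
  proof (intro conjI allI ballI)
    show "graded_linear 0 X Y ?f" using Y by (intro X.graded_linear_extend) simp
    fix p and c :: "'x set \<Rightarrow> 'k" assume c: "c \<in> chains X (Suc p)"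
    have "cell_boundary Y (Suc p) (?f (Suc p) c) =
        extend X (Suc p) (\<lambda>\<sigma>. extend X p (lift p) (cell_boundary X (Suc p) (cell_chain \<sigma>))) c"
      unfolding cell_boundary_extend by (intro extend_cong lift_carried(2))
    also have "\<dots> = ?f p (cell_boundary X (Suc p) c)"
      unfolding extend_extend[symmetric] X.cell_boundary_as_extend[OF c] ..
    finally show "cell_boundary Y (Suc p) (?f (Suc p) c) = ?f p (cell_boundary X (Suc p) c)" .
  next
    fix c :: "'x set \<Rightarrow> 'k" assume "c \<in> chains X 0"
    show "augmentation Y (?f 0 c) = augmentation X c"
      unfolding augmentation_extend unfolding augmentation_def[of X] using lift_0
      by (intro sum.cong) auto
  qed
  show "carried_by 0 X F ?f"
    unfolding carried_by_iff using lift_carried(1) by (simp add: X.extend_cell_chain)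
qed

section \<open>Homotopies between two carried chain maps\<close>

context
  fixes f g :: "('x, 'y, 'k) graded_map"
  assumes f: "chain_map X Y f" "carried_by 0 X F f" and g: "chain_map X Y g" "carried_by 0 X F g"
begin

fun homotopy :: "nat \<Rightarrow> 'x set \<Rightarrow> 'y set \<Rightarrow> 'k" where
  "homotopy 0 \<sigma> = (SOME c. c \<in> chains (F \<sigma>) (Suc 0) \<and>
     cell_boundary Y (Suc 0) c = (\<lambda>e. f 0 (cell_chain \<sigma>) e - g 0 (cell_chain \<sigma>) e))"
| "homotopy (Suc p) \<sigma> = (SOME c. c \<in> chains (F \<sigma>) (Suc (Suc p)) \<and>
     cell_boundary Y (Suc (Suc p)) c = (\<lambda>e. f (Suc p) (cell_chain \<sigma>) e - g (Suc p) (cell_chain \<sigma>) e -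
       extend X p (homotopy p) (cell_boundary X (Suc p) (cell_chain \<sigma>)) e))"

declare homotopy.simps [simp del]

lemma fg_chains:
  "\<sigma> \<in> cw_cells X p \<Longrightarrow> f p (cell_chain \<sigma>) \<in> chains (F \<sigma>) p"
  "\<sigma> \<in> cw_cells X p \<Longrightarrow> g p (cell_chain \<sigma>) \<in> chains (F \<sigma>) p"
  using f(2) g(2) unfolding carried_by_iff by fastforce+

lemma fg_boundary:
  assumes "c \<in> chains X (Suc p)"
  shows "cell_boundary Y (Suc p) (\<lambda>e. f (Suc p) c e - g (Suc p) c e) =
     extend X p (\<lambda>\<tau> e. f p (cell_chain \<tau>) e - g p (cell_chain \<tau>) e) (cell_boundary X (Suc p) c)"
proof -
  have "graded_linear 0 X Y f" "graded_linear 0 X Y g" using f(1) g(1) by (auto simp: chain_map_def)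
  note ext = this[THEN X.graded_linear_eq_extend, OF X.cell_boundary_chains]
  have "cell_boundary Y (Suc p) (f (Suc p) c) = f p (cell_boundary X (Suc p) c)"
    "cell_boundary Y (Suc p) (g (Suc p) c) = g p (cell_boundary X (Suc p) c)"
    using f(1) g(1) assms unfolding chain_map_def by blast+
  then show ?thesis unfolding cell_boundary_diff extend_diff ext[symmetric] by simp
qed

text \<open>The chain \<open>f - g\<close> minus the homotopy of the boundary is a reduced cycle in
  the carrier, hence can be filled there. For \<open>p = 0\<close> the expression
  \<open>p - 1\<close> is 0, but the boundary of a vertex is the zero function, so the last term
  vanishes; the cycle condition is then equality of augmentations.\<close>

lemma homotopy_spec:
  "\<sigma> \<in> cw_cells X p \<Longrightarrow> homotopy p \<sigma> \<in> chains (F \<sigma>) (Suc p) \<and>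
     cell_boundary Y (Suc p) (homotopy p \<sigma>) = (\<lambda>e. f p (cell_chain \<sigma>) e - g p (cell_chain \<sigma>) e -
       extend X (p - 1) (homotopy (p - 1)) (cell_boundary X p (cell_chain \<sigma>)) e)"
proof (induction p arbitrary: \<sigma>)
  case 0
  let ?z = "\<lambda>e. f 0 (cell_chain \<sigma>) e - g 0 (cell_chain \<sigma>) e"
  have "augmentation Y (f 0 (cell_chain \<sigma>)) = augmentation X (cell_chain \<sigma> :: 'x set \<Rightarrow> 'k)"
    "augmentation Y (g 0 (cell_chain \<sigma>)) = augmentation X (cell_chain \<sigma> :: 'x set \<Rightarrow> 'k)"
    using f(1) g(1) cell_chain_chains[OF 0] unfolding chain_map_def by blast+
  then have "reduced_cycle Y 0 ?z"
    by (simp add: reduced_cycle_def augmentation_def sum_subtractf)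
  from carrier_fill[OF 0 chains_diff[OF fg_chains[OF 0]] this]
  have "homotopy 0 \<sigma> \<in> chains (F \<sigma>) (Suc 0) \<and> cell_boundary Y (Suc 0) (homotopy 0 \<sigma>) = ?z"
    unfolding homotopy.simps by (rule someI_ex)
  then show ?case by simp
next
  case (Suc p)
  let ?b = "cell_boundary X (Suc p) (cell_chain \<sigma>) :: 'x set \<Rightarrow> 'k"
  let ?fg = "\<lambda>p \<tau> e. f p (cell_chain \<tau>) e - g p (cell_chain \<tau>) e"
  let ?z = "\<lambda>e. ?fg (Suc p) \<sigma> e - extend X p (homotopy p) ?b e"
  have "cell_boundary Y (Suc p) (extend X p (homotopy p) ?b) =
      extend X p (\<lambda>\<tau> e. ?fg p \<tau> e - extend X (p - 1) (homotopy (p - 1)) (cell_boundary X p (cell_chain \<tau>)) e) ?b"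
    unfolding cell_boundary_extend using Suc.IH by (intro extend_cong) blast
  also have "\<dots> = (\<lambda>e. extend X p (?fg p) ?b e -
      extend X (p - 1) (homotopy (p - 1)) (cell_boundary X p ?b) e)"
    unfolding extend_diff[of X p "?fg p"] extend_extend[symmetric] X.cell_boundary_as_extend[OF X.cell_boundary_chains] ..
  also have "\<dots> = extend X p (?fg p) ?b"
    by (simp only: X.cell_boundary_boundary extend_zero diff_0_right)
  finally have "cell_boundary Y (Suc p) ?z = (\<lambda>_. 0)"
    unfolding cell_boundary_diff[of Y "Suc p" "?fg (Suc p) \<sigma>"] fg_boundary[OF cell_chain_chains[OF Suc.prems]]
    by simp
  then have cyc: "reduced_cycle Y (Suc p) ?z" by (simp add: reduced_cycle_def)
  have "?z \<in> chains (F \<sigma>) (Suc p)"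
    using Suc by (intro chains_diff fg_chains extend_boundary_chains) auto
  from carrier_fill[OF Suc.prems this cyc]
  have "homotopy (Suc p) \<sigma> \<in> chains (F \<sigma>) (Suc (Suc p)) \<and> cell_boundary Y (Suc (Suc p)) (homotopy (Suc p) \<sigma>) = ?z"
    unfolding homotopy.simps by (rule someI_ex)
  then show ?case by simp
qed

lemma chain_homotopy_exists:
  "\<exists>H :: ('x, 'y, 'k) graded_map. chain_homotopy X Y H g f \<and> carried_by 1 X F H"
proof (intro exI conjI)
  let ?H = "\<lambda>p. extend X p (homotopy p)"
  let ?fg = "\<lambda>p \<tau> e. f p (cell_chain \<tau>) e - g p (cell_chain \<tau>) e"
  have lin: "graded_linear 0 X Y f" "graded_linear 0 X Y g" using f(1) g(1) by (auto simp: chain_map_def)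
  show "carried_by 1 X F ?H"
    unfolding carried_by_iff using homotopy_spec by (simp add: X.extend_cell_chain)
  have Y: "homotopy p \<sigma> \<in> chains Y (Suc p)" if "\<sigma> \<in> cw_cells X p" for p \<sigma>
    using homotopy_spec[OF that] chains_mono[OF subcomplex_cells[OF carrier_subcomplex[OF that]]] by blast
  show "chain_homotopy X Y ?H g f"
    unfolding chain_homotopy_def
  proof (intro conjI allI ballI)
    show "graded_linear 1 X Y ?H" using Y by (intro X.graded_linear_extend) simp
    fix p e and c :: "'x set \<Rightarrow> 'k" assume c: "c \<in> chains X p"
    have "cell_boundary Y (Suc p) (?H p c) =
        extend X p (\<lambda>\<sigma> e. ?fg p \<sigma> e - ?H (p - 1) (cell_boundary X p (cell_chain \<sigma>)) e) c"
      unfolding cell_boundary_extend using homotopy_spec by (intro extend_cong) blast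
    also have "\<dots> = (\<lambda>e. f p c e - g p c e - ?H (p - 1) (cell_boundary X p c) e)"
      unfolding extend_diff extend_extend[symmetric] X.cell_boundary_as_extend[OF c]
        X.graded_linear_eq_extend[OF lin(1) c, symmetric] X.graded_linear_eq_extend[OF lin(2) c, symmetric] ..
    finally show "cell_boundary Y (Suc p) (?H p c) e + ?H (p - 1) (cell_boundary X p c) e = f p c e - g p c e"
      by simp
  qed
qed

end

end

section \<open>Filtered complexes\<close>

lemma subcomplex_refl: "finite_regular_cw X \<Longrightarrow> subcomplex X X"
  by (auto simp: subcomplex_def finite_regular_cw_def closed_cell_def closure_of_subset_topspace)

text \<open>In a common ambient complex, cells determine the topology. This compares carriers taken
  at different times.\<close>

lemma subcomplex_if_cells_subset:
  assumes A: "subcomplex A X" and B: "subcomplex B X" and cells: "\<And>p. cw_cells A p \<subseteq> cw_cells B p"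
  shows "subcomplex A B"
proof -
  have all: "all_cells A \<subseteq> all_cells B" using cells by (fastforce simp: all_cells_def)
  have "cw_space A = subtopology (cw_space B) (\<Union>(all_cells A))"
    using A B Union_mono[OF all] by (simp add: subcomplex_def subtopology_subtopology Int_absorb1)
  moreover have "closed_cell B e \<subseteq> \<Union>(all_cells A)" if "e \<in> all_cells A" for e
  proof -
    have "closed_cell B e = closed_cell X e" using closed_cell_subcomplex(1)[OF B] all that by blast
    then show ?thesis using A that unfolding subcomplex_def by blast
  qed
  ultimately show ?thesis using cells by (simp add: subcomplex_def)
qed

lemma subcomplex_trans:
  assumes A: "subcomplex A B" and B: "subcomplex B X"
  shows "subcomplex A X"
proof -
  have all: "all_cells A \<subseteq> all_cells B" by (rule subcomplex_all_cells[OF A])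
  have "cw_space A = subtopology (cw_space X) (\<Union>(all_cells A))"
    using A B Union_mono[OF all] by (simp add: subcomplex_def subtopology_subtopology Int_absorb1)
  moreover have "closed_cell X e \<subseteq> \<Union>(all_cells A)" if "e \<in> all_cells A" for e
  proof -
    have "closed_cell X e = closed_cell B e" using closed_cell_subcomplex(1)[OF B] all that by blast
    then show ?thesis using A that unfolding subcomplex_def by blast
  qed
  ultimately show ?thesis using A B by (fastforce simp: subcomplex_def)
qed

section \<open>Final stages of a tame filtration and smallest carriers\<close>

lemma right_open_interval_tail:
  assumes "right_open_interval I"
  obtains u where "(\<forall>x\<in>I. x < u) \<or> (\<forall>x\<in>I. {x..} \<subseteq> I)"
proof -
  consider "I = UNIV" | b where "I = {..<b}" | a where "I = {a..}" | a b where "I = {a..<b}"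
    using assms unfolding right_open_interval_def by blast
  then show ?thesis
  proof cases
    case 2 then show ?thesis by (intro that[of b]) auto
  next
    case 4 then show ?thesis by (intro that[of b]) auto
  qed (auto intro!: that[of 0])
qed

lemma tame_eventually_constant:
  assumes "tame X"
  obtains m where "\<And>b. m \<le> b \<Longrightarrow> X b = X m"
proof -
  obtain P where P: "finite P" "partition_on UNIV P"
    "\<And>I. I \<in> P \<Longrightarrow> right_open_interval I" "\<And>I a b. I \<in> P \<Longrightarrow> a \<in> I \<Longrightarrow> b \<in> I \<Longrightarrow> X a = X b"
    using assms unfolding tame_def by blast
  have "\<forall>I\<in>P. \<exists>u. (\<forall>x\<in>I. x < u) \<or> (\<forall>x\<in>I. {x..} \<subseteq> I)"
    using P(3) right_open_interval_tail by metis
  then obtain u where u: "\<And>I. I \<in> P \<Longrightarrow> (\<forall>x\<in>I. x < u I) \<or> (\<forall>x\<in>I. {x..} \<subseteq> I)"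
    by metis
  \<comment> \<open>The block containing \<open>m\<close> cannot lie strictly below its own bound
    \<open>u I\<close>, as \<open>u I\<close> is at most \<open>m\<close>; hence it contains the
    whole ray from \<open>m\<close> on.\<close>
  define m where "m = Max (u ` P)"
  obtain I where I: "I \<in> P" "m \<in> I" using P(2) unfolding partition_on_def by blast
  have "u I \<le> m" unfolding m_def using P(1) I(1) by simp
  then have "{m..} \<subseteq> I" using u[OF I(1)] I(2) by force
  then have "X b = X m" if "m \<le> b" for b using P(4)[OF I(1)] I(2) that by (metis atLeast_iff subsetD)
  then show ?thesis by (rule that)
qed

text \<open>The carriers of a cell are nested finite complexes, so there is a smallest one even if the
  cell is present from \<open>-\<infinity>\<close> on and has no first time.\<close>

lemma minimal_time:
  assumes X: "filtered_cw X" and Y: "filtered_cw Y" and F: "eps_acyclic_carrier K \<epsilon> X Y F"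
    and \<sigma>: "\<sigma> \<in> all_cells (X a)"
  obtains t where "\<sigma> \<in> all_cells (X t)"
    and "\<And>b p. \<sigma> \<in> all_cells (X b) \<Longrightarrow> cw_cells (F t \<sigma>) p \<subseteq> cw_cells (F b \<sigma>) p"
proof -
  \<comment> \<open>Times are real and need not have a least element, so the number of cells of the
    carrier is minimised instead.\<close>
  obtain t where t: "\<sigma> \<in> all_cells (X t)"
    and least: "\<And>b. \<sigma> \<in> all_cells (X b) \<Longrightarrow> card (all_cells (F t \<sigma>)) \<le> card (all_cells (F b \<sigma>))"
    using ex_has_least_nat[of "\<lambda>a. \<sigma> \<in> all_cells (X a)" a "\<lambda>a. card (all_cells (F a \<sigma>))"] \<sigma> by blast
  have mono: "subcomplex (F b \<sigma>) (F c \<sigma>)" if "b \<le> c" "\<sigma> \<in> all_cells (X b)" for b c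
    using F that unfolding eps_acyclic_carrier_def by blast
  have "cw_cells (F t \<sigma>) p \<subseteq> cw_cells (F b \<sigma>) p" if b: "\<sigma> \<in> all_cells (X b)" for b p
  proof (cases "t \<le> b")
    case True
    then show ?thesis using subcomplex_cells[OF mono[OF True t]] by simp
  next
    case False
    have "acyclic_carrier K (X t) (shift Y \<epsilon> t) (F t)" using F unfolding eps_acyclic_carrier_def by blast
    then have "subcomplex (F t \<sigma>) (Y (t + \<epsilon>))"
      using t unfolding acyclic_carrier_def carrier_cw_def shift_def by blast
    moreover have "finite_regular_cw (Y (t + \<epsilon>))" using Y unfolding filtered_cw_def by blast
    ultimately interpret Ft: regular_cw "F t \<sigma>" using subcomplex_finite_regular by unfold_locales
    have sub: "subcomplex (F b \<sigma>) (F t \<sigma>)" using mono[of b t] False b by simp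
    \<comment> \<open>For \<open>b < t\<close> the carrier at \<open>b\<close> is contained in the
      one at \<open>t\<close> and has no fewer cells, so they have the same cells.\<close>
    have eq: "all_cells (F b \<sigma>) = all_cells (F t \<sigma>)"
      using subcomplex_all_cells[OF sub] least[OF b] Ft.finite_all_cells by (intro card_seteq)
    show ?thesis
    proof
      fix e assume e: "e \<in> cw_cells (F t \<sigma>) p"
      then have "e \<in> all_cells (F b \<sigma>)" using eq Ft.cell_in_all by blast
      then obtain q where q: "e \<in> cw_cells (F b \<sigma>) q" unfolding all_cells_def by blast
      \<comment> \<open>\<open>all_cells\<close> forgets dimensions; they are recovered from their
        uniqueness in the larger carrier.\<close>
      then have "q = p" using Ft.dim_unique[OF e] subcomplex_cells[OF sub, of q] by blast
      then show "e \<in> cw_cells (F b \<sigma>) p" using q by simp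
    qed
  qed
  with t show ?thesis by (rule that)
qed

text \<open>Boundaries and augmentations of a subcomplex are those of the ambient complex, so it
  suffices that cells of \<open>A\<close> are sent into chains of \<open>B\<close>.\<close>

lemma chain_map_restrict:
  fixes f :: "('a, 'b, 'k::field) graded_map"
  assumes A: "subcomplex A X" and X: "finite_regular_cw X" and B: "subcomplex B Y" and Y: "finite_regular_cw Y"
    and f: "chain_map X Y f"
    and carried: "\<And>p \<sigma>. \<sigma> \<in> cw_cells A p \<Longrightarrow> f p (cell_chain \<sigma>) \<in> chains B p"
  shows "chain_map A B f"
proof -
  interpret X: regular_cw X using X by unfold_locales
  have AX: "c \<in> chains X p" if "c \<in> chains A p" for p and c :: "'a set \<Rightarrow> 'k"
    using that chains_mono[OF subcomplex_cells[OF A]] by blast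
  have lin: "graded_linear 0 X Y f" using f unfolding chain_map_def by blast
  have fB: "f p c \<in> chains B p" if c: "c \<in> chains A p" for p c
    unfolding X.graded_linear_eq_extend[OF lin AX[OF c]]
    using c carried by (intro extend_chains) (auto simp: chains_def)
  show ?thesis
    unfolding chain_map_def
  proof (intro conjI allI ballI)
    show "graded_linear 0 A B f"
      using lin AX fB unfolding graded_linear_def by simp
  next
    fix p and c :: "'a set \<Rightarrow> 'k" assume c: "c \<in> chains A (Suc p)"
    show "cell_boundary B (Suc p) (f (Suc p) c) = f p (cell_boundary A (Suc p) c)"
      unfolding cell_boundary_subcomplex[OF B Y fB[OF c]] cell_boundary_subcomplex[OF A X c]
      using f AX[OF c] unfolding chain_map_def by blast
  next
    fix c :: "'a set \<Rightarrow> 'k" assume c: "c \<in> chains A 0"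
    show "augmentation B (f 0 c) = augmentation A c"
      unfolding augmentation_subcomplex[OF B Y fB[OF c]] augmentation_subcomplex[OF A X c]
      using f AX[OF c] unfolding chain_map_def by blast
  qed
qed

theorem proposition4p2:
  fixes X :: "real \<Rightarrow> 'x cw" and Y :: "real \<Rightarrow> 'y cw"
    and \<epsilon> :: real
    and F :: "real \<Rightarrow> 'x set \<Rightarrow> 'y cw"
  assumes "filtered_cw X" and "tame X"
    and "filtered_cw Y" and "tame Y"
    and "\<epsilon> \<ge> 0"
    and "eps_acyclic_carrier TYPE('k::field) \<epsilon> X Y F"
  shows "\<exists>f :: real \<Rightarrow> ('x, 'y, 'k) graded_map.
           carried_chain_maps \<epsilon> X Y F f \<and>
           (\<forall>g :: real \<Rightarrow> ('x, 'y, 'k) graded_map. carried_chain_maps \<epsilon> X Y F g \<longrightarrow>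
              (\<exists>H :: real \<Rightarrow> ('x, 'y, 'k) graded_map. \<forall>a.
                 chain_homotopy (X a) (shift Y \<epsilon> a) (H a) (g a) (f a) \<and>
                 carried_by 1 (X a) (F a) (H a)))"
proof -
  have regX: "finite_regular_cw (X r)" and regY: "finite_regular_cw (Y r)" for r
    using assms(1,3) by (auto simp: filtered_cw_def)
  have F: "acyclic_carrier TYPE('k) (X a) (Y (a + \<epsilon>)) (F a)" for a
    using assms(6) unfolding eps_acyclic_carrier_def shift_def by blast
  obtain m where m: "\<And>b. m \<le> b \<Longrightarrow> X b = X m" using tame_eventually_constant[OF assms(2)] by blast
  obtain n where n: "\<And>b. n \<le> b \<Longrightarrow> Y b = Y n" using tame_eventually_constant[OF assms(4)] by blast
  \<comment> \<open>From \<open>M\<close> on, \<open>X\<close> is constant, and so is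
    \<open>Y\<close> from \<open>M + \<epsilon>\<close> on. Both inclusions into the final complexes
    then hold for every time, also for those chosen below, which may exceed
    \<open>M\<close>.\<close>
  define M where "M = max m (n - \<epsilon>)"
  have subX: "subcomplex (X a) (X M)" for a
  proof (cases "a \<le> M")
    case False
    then have "X a = X M" using m[of a] m[of M] by (simp add: M_def)
    then show ?thesis using subcomplex_refl[OF regX] by simp
  qed (use assms(1) in \<open>auto simp: filtered_cw_def\<close>)
  have subY: "subcomplex (Y (a + \<epsilon>)) (Y (M + \<epsilon>))" for a
  proof (cases "a \<le> M")
    case False
    then have "Y (a + \<epsilon>) = Y (M + \<epsilon>)" using n[of "a + \<epsilon>"] n[of "M + \<epsilon>"] by (simp add: M_def)
    then show ?thesis using subcomplex_refl[OF regY] by simp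
  qed (use assms(3) in \<open>auto simp: filtered_cw_def\<close>)
  interpret XM: regular_cw "X M" by unfold_locales (rule regX)
  interpret YM: regular_cw "Y (M + \<epsilon>)" by unfold_locales (rule regY)
  have "\<exists>t. \<sigma> \<in> all_cells (X t) \<and>
     (\<forall>b p. \<sigma> \<in> all_cells (X b) \<longrightarrow> cw_cells (F t \<sigma>) p \<subseteq> cw_cells (F b \<sigma>) p)"
    if \<sigma>: "\<sigma> \<in> all_cells (X M)" for \<sigma>
  proof -
    obtain t where "\<sigma> \<in> all_cells (X t)"
      "\<And>b p. \<sigma> \<in> all_cells (X b) \<Longrightarrow> cw_cells (F t \<sigma>) p \<subseteq> cw_cells (F b \<sigma>) p"
      using minimal_time[OF assms(1,3,6) \<sigma>] by blast
    then show ?thesis by blast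
  qed
  then obtain t where t: "\<And>\<sigma>. \<sigma> \<in> all_cells (X M) \<Longrightarrow> \<sigma> \<in> all_cells (X (t \<sigma>))"
    and least: "\<And>\<sigma> b p. \<sigma> \<in> all_cells (X M) \<Longrightarrow> \<sigma> \<in> all_cells (X b) \<Longrightarrow>
      cw_cells (F (t \<sigma>) \<sigma>) p \<subseteq> cw_cells (F b \<sigma>) p"
    by metis
  define G where "G \<sigma> = F (t \<sigma>) \<sigma>" for \<sigma>
  have Gsub: "subcomplex (G \<sigma>) (Y (M + \<epsilon>))" if "\<sigma> \<in> all_cells (X M)" for \<sigma>
    unfolding G_def using F[of "t \<sigma>"] t[OF that] subY subcomplex_trans
    unfolding acyclic_carrier_def carrier_cw_def by blast
  have "acyclic_carrier TYPE('k) (X M) (Y (M + \<epsilon>)) G"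
    unfolding acyclic_carrier_def carrier_cw_def
  proof (intro conjI ballI allI impI)
    fix \<sigma> assume \<sigma>: "\<sigma> \<in> all_cells (X M)"
    show "subcomplex (G \<sigma>) (Y (M + \<epsilon>))" by (rule Gsub[OF \<sigma>])
    show "topspace (cw_space (G \<sigma>)) \<noteq> {}" "acyclic_cw TYPE('k) (G \<sigma>)"
      using F[of "t \<sigma>"] t[OF \<sigma>] unfolding acyclic_carrier_def G_def by blast+
  next
    fix \<tau> \<sigma> assume "is_face (X M) \<tau> \<sigma>"
    then have \<tau>: "\<tau> \<in> all_cells (X M)" and \<sigma>: "\<sigma> \<in> all_cells (X M)" and sub: "\<tau> \<subseteq> closed_cell (X M) \<sigma>"
      by (auto simp: is_face_def)
    \<comment> \<open>Faces are compared at the time chosen for \<sigma>. The closed cell of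
      \<sigma> is covered by cells of that stage, so a point of \<tau> lies in one of them, which is
      \<tau> by disjointness. Thus the smallest carrier of \<tau> lies in its carrier at this time,
      which lies in \<open>G \<sigma>\<close>.\<close>
    note t\<sigma> = t[OF \<sigma>]
    note cl = closed_cell_subcomplex(1)[OF subX t\<sigma>]
    obtain x where x: "x \<in> \<tau>" using XM.cell_nonempty[OF \<tau>] by blast
    have "closed_cell (X M) \<sigma> \<subseteq> \<Union>(all_cells (X (t \<sigma>)))"
      using subX[of "t \<sigma>"] t\<sigma> by (auto simp: subcomplex_def)
    then obtain \<tau>' where \<tau>': "\<tau>' \<in> all_cells (X (t \<sigma>))" "x \<in> \<tau>'" using x sub by blast
    then have "\<tau> = \<tau>'"
      using XM.cells_disjoint[OF \<tau> _ x] subcomplex_all_cells[OF subX, of "t \<sigma>"] by blast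
    then have \<tau>t: "\<tau> \<in> all_cells (X (t \<sigma>))" using \<tau>' by simp
    then have "is_face (X (t \<sigma>)) \<tau> \<sigma>" using t\<sigma> sub by (simp add: is_face_def cl)
    then have "subcomplex (F (t \<sigma>) \<tau>) (F (t \<sigma>) \<sigma>)"
      using F[of "t \<sigma>"] unfolding acyclic_carrier_def carrier_cw_def by blast
    then have "cw_cells (G \<tau>) p \<subseteq> cw_cells (G \<sigma>) p" for p
      using least[OF \<tau> \<tau>t, of p] subcomplex_cells unfolding G_def by blast
    then show "subcomplex (G \<tau>) (G \<sigma>)"
      by (rule subcomplex_if_cells_subset[OF Gsub[OF \<tau>] Gsub[OF \<sigma>]])
  qed
  then interpret G: carrier_between "X M" "Y (M + \<epsilon>)" G "TYPE('k)" by unfold_locales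
  obtain f :: "('x, 'y, 'k) graded_map" where f: "chain_map (X M) (Y (M + \<epsilon>)) f" "carried_by 0 (X M) G f"
    using G.chain_map_exists by blast
  have f_carried: "f p (cell_chain \<sigma>) \<in> chains (F a \<sigma>) p" if \<sigma>: "\<sigma> \<in> cw_cells (X a) p" for a p \<sigma>
  proof -
    have \<sigma>M: "\<sigma> \<in> cw_cells (X M) p" using subcomplex_cells[OF subX] \<sigma> by blast
    then have "f p (cell_chain \<sigma>) \<in> chains (G \<sigma>) p" using f(2) unfolding carried_by_iff by fastforce
    moreover have "\<sigma> \<in> all_cells (X a)" using \<sigma> by (auto simp: all_cells_def)
    then have "chains (G \<sigma>) p \<subseteq> (chains (F a \<sigma>) p :: ('y set \<Rightarrow> 'k) set)"
      unfolding G_def by (intro chains_mono least XM.cell_in_all[OF \<sigma>M])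
    ultimately show ?thesis by blast
  qed
  have f_map: "chain_map (X a) (Y (a + \<epsilon>)) f" for a
  proof (rule chain_map_restrict[OF subX regX subY regY f(1)])
    fix p \<sigma> assume \<sigma>: "\<sigma> \<in> cw_cells (X a) p"
    then have "\<sigma> \<in> all_cells (X a)" by (auto simp: all_cells_def)
    then have "subcomplex (F a \<sigma>) (Y (a + \<epsilon>))"
      using F[of a] unfolding acyclic_carrier_def carrier_cw_def by blast
    then show "f p (cell_chain \<sigma>) \<in> chains (Y (a + \<epsilon>)) p"
      using f_carried[OF \<sigma>] chains_mono[OF subcomplex_cells] by blast
  qed
  have f_carried': "carried_by 0 (X a) (F a) f" for a
    unfolding carried_by_iff using f_carried by simp
  \<comment> \<open>The family is constant, so compatibility with the inclusions is the equality of
    \<open>f\<close> with itself.\<close>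
  have "carried_chain_maps \<epsilon> X Y F (\<lambda>_. f)"
    unfolding carried_chain_maps_def shift_def using f_map f_carried' by blast
  moreover have "\<exists>H :: real \<Rightarrow> ('x, 'y, 'k) graded_map. \<forall>a.
      chain_homotopy (X a) (shift Y \<epsilon> a) (H a) (g a) f \<and> carried_by 1 (X a) (F a) (H a)"
    if g: "carried_chain_maps \<epsilon> X Y F g" for g :: "real \<Rightarrow> ('x, 'y, 'k) graded_map"
  proof -
    have "\<exists>H :: ('x, 'y, 'k) graded_map. chain_homotopy (X a) (shift Y \<epsilon> a) H (g a) f \<and> carried_by 1 (X a) (F a) H" for a
    proof -
      interpret a: carrier_between "X a" "Y (a + \<epsilon>)" "F a" "TYPE('k)"
        by unfold_locales (rule regX regY F)+
      have "chain_map (X a) (Y (a + \<epsilon>)) (g a)" "carried_by 0 (X a) (F a) (g a)"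
        using g unfolding carried_chain_maps_def shift_def by blast+
      then show ?thesis
        unfolding shift_def by (rule a.chain_homotopy_exists[OF f_map f_carried'])
    qed
    then show ?thesis by metis
  qed
  ultimately show ?thesis by blast
qed

end
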